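(* Let $R$ be a Noetherian commutative ring of prime characteristic $p>0$, let $I$ be a non-zero proper ideal of $R$, and let $\mathfrak{a}_\bullet$ and $\mathfrak{b}_\bullet$ be two $(I,p)$-admissible filtrations of ideals in $R$. Then: (1) $\mathfrak{c}_\bullet=\{\mathfrak{a}_n\mathfrak{b}_n\}_{n\ge 0}$ is an $(I,p)$-admissible filtration; (2) if $R$ is regular, then $\mathfrak{d}_\bullet=\{\mathfrak{a}_n\cap\mathfrak{b}_n\}_{n\ge 0}$ is an $(I,p)$-admissible filtration; (3) $\mathfrak{e}_\bullet=\{\sum_{i=0}^n\mathfrak{a}_i\mathfrak{b}_{n-i}\}_{n\ge 0}$ is an $(I,p)$-admissible filtration.
   Context: A filtration of ideals in $R$ is a sequence $\mathfrak{a}_\bullet=\{\mathfrak{a}_i\}_{i\ge 0}$ of ideals with $\mathfrak{a}_0=R$, $\mathfrak{a}_{i+1}\subseteq\mathfrak{a}_i$, and $\mathfrak{a}_i\mathfrak{a}_j\subseteq \mathfrak{a}_{i+j}$ for all $i,j\ge 0$. For an ideal $J$, $J^{[p^e]}$ is the ideal generated by all $f^{p^e}$, $f\in J$. A filtration $\mathfrak{a}_\bullet$ is $(I,p)$-admissible if (i) $\mathfrak{a}_k\subseteq I$ for some $k$, and (ii) there exist integers $h>0$ and $c$ such that $\mathfrak{a}_{(h+m)p^e+c}\subseteq\mathfrak{a}_{m+1}^{[p^e]}$ for all integers $m,e\ge 0$ (with the convention $\mathfrak{a}_i=R$ for $i<0$). *)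

theory Defs
  imports
    "HOL-Algebra.Ideal_Product"
    "HOL-Algebra.Ring_Divisibility"
    "HOL-Library.Extended_Nat"
    "HOL-Computational_Algebra.Primes"
begin

text \<open>The characteristic: the kernel of the canonical map from the integers to \<open>R\<close> is generated
  by \<open>n\<close>.\<close>

definition has_characteristic :: "('a, 'b) ring_scheme \<Rightarrow> nat \<Rightarrow> bool" where
  "has_characteristic R n \<longleftrightarrow>
     (\<forall>k::nat. [k] \<cdot>\<^bsub>R\<^esub> \<one>\<^bsub>R\<^esub> = \<zero>\<^bsub>R\<^esub> \<longleftrightarrow> n dvd k)"

section \<open>Regular rings\<close>

text \<open>The fraction \<open>r/s\<close>, as a class of pairs in \<open>R \<times> S\<close>; the factor \<open>t\<close> accounts for zero
  divisors.\<close>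

definition fraction :: "('a, 'b) ring_scheme \<Rightarrow> 'a set \<Rightarrow> 'a \<Rightarrow> 'a \<Rightarrow> ('a \<times> 'a) set" where
  "fraction R S r s =
     {(r', s'). r' \<in> carrier R \<and> s' \<in> S \<and>
        (\<exists>t \<in> S. t \<otimes>\<^bsub>R\<^esub> (r \<otimes>\<^bsub>R\<^esub> s') = t \<otimes>\<^bsub>R\<^esub> (r' \<otimes>\<^bsub>R\<^esub> s))}"

text \<open>The localization \<open>S\<^sup>-\<^sup>1 R\<close> at a multiplicative set \<open>S\<close>. As in \<^const>\<open>FactGroup\<close>, an operation on
  classes is the union over all representatives; for multiplicative \<open>S\<close> the sets in that union all
  coincide.\<close>

definition localization :: "('a, 'b) ring_scheme \<Rightarrow> 'a set \<Rightarrow> ('a \<times> 'a) set ring" where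
  "localization R S =
     \<lparr> carrier = {fraction R S r s | r s. r \<in> carrier R \<and> s \<in> S},
       monoid.mult = (\<lambda>u v. \<Union>(r, s) \<in> u. \<Union>(r', s') \<in> v. fraction R S (r \<otimes>\<^bsub>R\<^esub> r') (s \<otimes>\<^bsub>R\<^esub> s')),
       one = fraction R S \<one>\<^bsub>R\<^esub> \<one>\<^bsub>R\<^esub>,
       zero = fraction R S \<zero>\<^bsub>R\<^esub> \<one>\<^bsub>R\<^esub>,
       add = (\<lambda>u v. \<Union>(r, s) \<in> u. \<Union>(r', s') \<in> v.
                fraction R S ((r \<otimes>\<^bsub>R\<^esub> s') \<oplus>\<^bsub>R\<^esub> (r' \<otimes>\<^bsub>R\<^esub> s)) (s \<otimes>\<^bsub>R\<^esub> s')) \<rparr>"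

text \<open>The supremum of the lengths \<open>n\<close> of chains \<open>P 0 \<subset> \<dots> \<subset> P n\<close> of prime ideals. (The zero ring,
  which has no prime ideals, gets dimension \<open>0\<close>.)\<close>

definition krull_dim :: "('a, 'b) ring_scheme \<Rightarrow> enat" where
  "krull_dim R =
     Sup {enat n | n. \<exists>P :: nat \<Rightarrow> 'a set.
            (\<forall>i \<le> n. primeideal (P i) R) \<and> (\<forall>i < n. P i \<subset> P (Suc i))}"

definition local_ring :: "('a, 'b) ring_scheme \<Rightarrow> bool" where
  "local_ring R \<longleftrightarrow> cring R \<and> (\<exists>!M. maximalideal M R)"

text \<open>A Noetherian local ring whose maximal ideal is generated by \<open>dim R\<close> elements.\<close>

definition regular_local_ring :: "('a, 'b) ring_scheme \<Rightarrow> bool" where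
  "regular_local_ring R \<longleftrightarrow>
     local_ring R \<and> noetherian_ring R \<and>
     (\<exists>A. A \<subseteq> carrier R \<and> finite A \<and> enat (card A) = krull_dim R \<and>
          maximalideal (Idl\<^bsub>R\<^esub> A) R)"

definition regular_ring :: "('a, 'b) ring_scheme \<Rightarrow> bool" where
  "regular_ring R \<longleftrightarrow>
     cring R \<and> noetherian_ring R \<and>
     (\<forall>P. primeideal P R \<longrightarrow> regular_local_ring (localization R (carrier R - P)))"

section \<open>Admissible filtrations\<close>

definition ideal_filtration :: "('a, 'b) ring_scheme \<Rightarrow> (nat \<Rightarrow> 'a set) \<Rightarrow> bool" where
  "ideal_filtration R \<aa> \<longleftrightarrow>
     (\<forall>i. ideal (\<aa> i) R) \<and>
     \<aa> 0 = carrier R \<and>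
     (\<forall>i. \<aa> (Suc i) \<subseteq> \<aa> i) \<and>
     (\<forall>i j. ideal_prod R (\<aa> i) (\<aa> j) \<subseteq> \<aa> (i + j))"

text \<open>The convention \<open>\<aa>\<^sub>i = R\<close> for \<open>i < 0\<close>.\<close>

definition filtration_at :: "('a, 'b) ring_scheme \<Rightarrow> (nat \<Rightarrow> 'a set) \<Rightarrow> int \<Rightarrow> 'a set" where
  "filtration_at R \<aa> i = (if i < 0 then carrier R else \<aa> (nat i))"

text \<open>The Frobenius power \<open>J\<^bsup>[p^e]\<^esup>\<close>.\<close>

definition frobenius_power :: "('a, 'b) ring_scheme \<Rightarrow> nat \<Rightarrow> nat \<Rightarrow> 'a set \<Rightarrow> 'a set" where
  "frobenius_power R p e J = Idl\<^bsub>R\<^esub> {f [^]\<^bsub>R\<^esub> (p ^ e) | f. f \<in> J}"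

definition admissible_filtration ::
    "('a, 'b) ring_scheme \<Rightarrow> 'a set \<Rightarrow> nat \<Rightarrow> (nat \<Rightarrow> 'a set) \<Rightarrow> bool" where
  "admissible_filtration R I p \<aa> \<longleftrightarrow>
     ideal_filtration R \<aa> \<and>
     (\<exists>k. \<aa> k \<subseteq> I) \<and>
     (\<exists>h c :: int. h > 0 \<and>
        (\<forall>m e :: nat. filtration_at R \<aa> ((h + int m) * int (p ^ e) + c)
                       \<subseteq> frobenius_power R p e (\<aa> (m + 1))))"

end

theory Submission
  imports Defs
begin

text \<open>Parts (1) and (3) only combine the two given bounds. Part (2) needs the inclusion
  \<open>J\<^bsup>[q]\<^esup> \<inter> K\<^bsup>[q]\<^esup> \<subseteq> (J \<inter> K)\<^bsup>[q]\<^esup>\<close>, a consequence of the flatness of the Frobenius of a regular ring.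
  It may be checked at each prime \<open>P\<close>. If \<open>x\<^sub>1, \<dots>, x\<^sub>d\<close> generate \<open>P R\<^sub>P\<close> and \<open>d = dim R\<^sub>P\<close>, then they
  form a regular sequence, so \<open>R\<^sub>P / P\<^bsup>[q]\<^esup>\<close> has length exactly \<open>q\<^sup>d\<close> for every \<open>q = p\<^sup>e\<close>. Now take a
  composition series of \<open>R\<^sub>P / P\<^bsup>[q']\<^esup>\<close> through a given ideal \<open>J\<close>. The Frobenius turns each factor into a
  cyclic module of length at most \<open>q\<^sup>d\<close>, while the total length is \<open>(q q')\<^sup>d\<close>; hence every factor has
  length exactly \<open>q\<^sup>d\<close>, that is, \<open>(J\<^bsup>[q]\<^esup> : u\<^sup>q) = P\<^bsup>[q]\<^esup>\<close> whenever \<open>u \<notin> J\<close> and \<open>P u \<subseteq> J\<close>. This gives the inclusion for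
  ideals containing some \<open>P\<^bsup>[q']\<^esup>\<close>, and the general case follows by weak Artin--Rees arguments.

  Instead of working with ideals of \<open>R\<^sub>P\<close> we work with their contractions to \<open>R\<close>, which are the ideals
  \<open>J\<close> with \<open>sat J = J\<close>.\<close>

section \<open>Ideals and saturation at a prime\<close>

text \<open>Flatness of the Frobenius is never stated; the colon identity of the overview is all
  that is used of it. Its proof compares two lengths, which need different notions. Upper bounds
  must survive quotients, multiplication by an element and the Frobenius, any of which may collapse
  a factor, so they count steps that may be trivial. Lower bounds count strict inclusions, which
  survive multiplication by a nonzerodivisor; regularity enters there. As regularity is defined by a
  number of generators and the length of prime chains, nonzerodivisors become available only after
  Krull's height theorem, which shows that the local quotients by subsets of the generating set are
  domains. Keeping all ideals in the one ring \<open>R\<close> avoids a change of type with each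
  quotient; \<open>K / J\<close> is represented by a pair of ideals. Given the colon identity, an
  element of both Frobenius powers is pushed down a composition series from \<open>J\<close> to
  \<open>J \<inter> K\<close>. Artin--Rees is used twice: to compare the intersection of two ideals
  thickened by a Frobenius power of \<open>P\<close> with that of the originals, and to remove the
  thickening.\<close>

no_notation Sum_Type.Plus (infixr \<open><+>\<close> 65)

section \<open>Sums and cyclic extensions of ideals\<close>

lemma (in ideal) a_minus_closed: "a \<in> I \<Longrightarrow> b \<in> I \<Longrightarrow> a \<ominus> b \<in> I"
  by (simp add: a_minus_def)

lemma (in ring) minus_closed_ideal:
  "ideal J R \<Longrightarrow> a \<in> J \<Longrightarrow> b \<in> J \<Longrightarrow> a \<ominus> b \<in> J"
  by (rule ideal.a_minus_closed)

lemma (in ring) add_closed_ideal: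
  "ideal J R \<Longrightarrow> a \<in> J \<Longrightarrow> b \<in> J \<Longrightarrow> a \<oplus> b \<in> J"
  by (simp add: additive_subgroup.a_closed ideal.axioms(1))

lemma (in ring) zero_mem_ideal: "ideal J R \<Longrightarrow> \<zero> \<in> J"
  by (simp add: additive_subgroup.zero_closed ideal.axioms(1))

lemma (in ring) ideal_subset_carrier: "ideal J R \<Longrightarrow> J \<subseteq> carrier R"
  by (simp add: additive_subgroup.a_subset ideal.axioms(1))

lemmas (in ring) ideal_ops =
  minus_closed_ideal add_closed_ideal ideal.I_l_closed ideal.I_r_closed zero_mem_ideal

lemma (in cring) idealI_cring:
  assumes "J \<subseteq> carrier R" "\<zero> \<in> J" "\<And>a b. a \<in> J \<Longrightarrow> b \<in> J \<Longrightarrow> a \<oplus> b \<in> J"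
    and "\<And>a x. a \<in> J \<Longrightarrow> x \<in> carrier R \<Longrightarrow> x \<otimes> a \<in> J"
  shows "ideal J R"
proof (rule idealI)
  show "ring R" by (rule ring_axioms)
  show "subgroup J (add_monoid R)"
  proof (rule add.subgroupI)
    show "J \<subseteq> carrier R" "J \<noteq> {}" using assms by auto
    fix a assume a: "a \<in> J"
    then have "\<ominus> a = (\<ominus> \<one>) \<otimes> a" using assms(1) l_minus by auto
    then show "\<ominus> a \<in> J" using assms(4)[OF a, of "\<ominus> \<one>"] by simp
  qed (rule assms(3))
  fix a x assume ax: "a \<in> J" "x \<in> carrier R"
  show "x \<otimes> a \<in> J" using assms(4) ax by blast
  then show "a \<otimes> x \<in> J" using ax assms(1) m_comm by (metis subsetD)
qed

lemma (in cring) mem_set_add: "z \<in> J <+> K \<longleftrightarrow> (\<exists>j\<in>J. \<exists>k\<in>K. z = j \<oplus> k)"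
  by (auto simp: set_add_def')

lemma (in cring) set_add_lower:
  assumes "ideal J R" "ideal K R" shows "J \<subseteq> J <+> K" "K \<subseteq> J <+> K"
proof -
  show "J \<subseteq> J <+> K"
  proof
    fix j assume "j \<in> J"
    then show "j \<in> J <+> K" unfolding mem_set_add
      using assms zero_mem_ideal by (intro bexI[of _ j] bexI[of _ \<zero>]) (auto dest: ideal.Icarr)
  qed
  show "K \<subseteq> J <+> K"
  proof
    fix k assume "k \<in> K"
    then show "k \<in> J <+> K" unfolding mem_set_add
      using assms zero_mem_ideal by (intro bexI[of _ \<zero>] bexI[of _ k]) (auto dest: ideal.Icarr)
  qed
qed

lemma (in cring) set_add_least:
  assumes "ideal L R" "J \<subseteq> L" "K \<subseteq> L" shows "J <+> K \<subseteq> L"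
  using assms add_closed_ideal by (fastforce simp: mem_set_add)

text \<open>The ideal \<open>J + C w\<close>. With \<open>C = carrier R\<close> it adjoins the
  generator \<open>w\<close>; a general ideal \<open>C\<close> is transported by multiplication with
  \<open>w\<close>, which relates lengths over \<open>R / C\<close> to those in the cyclic module
  generated by \<open>w\<close> modulo \<open>J\<close>.\<close>

definition (in cring) lin :: "'a set \<Rightarrow> 'a set \<Rightarrow> 'a \<Rightarrow> 'a set" where
  "lin J C w = {j \<oplus> c \<otimes> w | j c. j \<in> J \<and> c \<in> C}"

lemma (in cring) linI: "j \<in> J \<Longrightarrow> c \<in> C \<Longrightarrow> j \<oplus> c \<otimes> w \<in> lin J C w"
  unfolding lin_def by blast

lemma (in cring) linE:
  assumes "z \<in> lin J C w" obtains j c where "j \<in> J" "c \<in> C" "z = j \<oplus> c \<otimes> w"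
  using assms unfolding lin_def by blast

lemma (in cring) lin_ideal:
  assumes J: "ideal J R" and C: "ideal C R" and w: "w \<in> carrier R" shows "ideal (lin J C w) R"
proof (rule idealI_cring)
  note Jc = ideal.Icarr[OF J] and Cc = ideal.Icarr[OF C]
  show "lin J C w \<subseteq> carrier R" using Jc Cc w by (auto simp: lin_def)
  have "\<zero> = \<zero> \<oplus> \<zero> \<otimes> w" using w by simp
  then show "\<zero> \<in> lin J C w" using zero_mem_ideal J C linI by metis
  show "a \<oplus> b \<in> lin J C w" if a: "a \<in> lin J C w" and b: "b \<in> lin J C w" for a b
  proof -
    obtain j c where 1: "j \<in> J" "c \<in> C" "a = j \<oplus> c \<otimes> w" using linE[OF a] by metis
    obtain j' c' where 2: "j' \<in> J" "c' \<in> C" "b = j' \<oplus> c' \<otimes> w" using linE[OF b] by metis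
    have "a \<oplus> b = (j \<oplus> j') \<oplus> (c \<oplus> c') \<otimes> w"
      using 1 2 Jc Cc w by (simp add: l_distr a_ac)
    then show ?thesis using linI add_closed_ideal J C 1 2 by metis
  qed
  show "x \<otimes> a \<in> lin J C w" if a: "a \<in> lin J C w" and x: "x \<in> carrier R" for a x
  proof -
    obtain j c where 1: "j \<in> J" "c \<in> C" "a = j \<oplus> c \<otimes> w" using linE[OF a] by metis
    have "x \<otimes> a = x \<otimes> j \<oplus> (x \<otimes> c) \<otimes> w"
      using 1 x Jc Cc w by (simp add: r_distr m_assoc)
    then show ?thesis using linI ideal.I_l_closed J C 1 x by metis
  qed
qed

lemma (in cring) lin_lower:
  assumes "ideal J R" "ideal C R" "w \<in> carrier R"
  shows "J \<subseteq> lin J C w" "c \<in> C \<Longrightarrow> c \<otimes> w \<in> lin J C w"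
proof -
  show "J \<subseteq> lin J C w"
  proof
    fix j assume j: "j \<in> J"
    have "j = j \<oplus> \<zero> \<otimes> w" using assms j ideal.Icarr by fastforce
    then show "j \<in> lin J C w" using linI[OF j zero_mem_ideal[OF assms(2)]] by metis
  qed
  assume c: "c \<in> C"
  have "c \<otimes> w = \<zero> \<oplus> c \<otimes> w" using assms c ideal.Icarr by fastforce
  then show "c \<otimes> w \<in> lin J C w" using linI[OF zero_mem_ideal[OF assms(1)] c] by metis
qed

lemma (in cring) lin_least:
  assumes "ideal L R" "J \<subseteq> L" "\<And>c. c \<in> C \<Longrightarrow> c \<otimes> w \<in> L" shows "lin J C w \<subseteq> L"
  using assms add_closed_ideal by (fastforce simp: lin_def)

lemma (in cring) generator_mem_lin:
  assumes "ideal J R" "w \<in> carrier R" shows "w \<in> lin J (carrier R) w"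
  using lin_lower(2)[OF assms(1) oneideal assms(2), of \<one>] assms by simp

lemma (in cring) lin_carrier_least:
  assumes "ideal L R" "J \<subseteq> L" "w \<in> L" shows "lin J (carrier R) w \<subseteq> L"
  using assms by (intro lin_least) (auto intro: ideal.I_l_closed)

lemma (in cring) lin_mono: "J \<subseteq> J' \<Longrightarrow> C \<subseteq> C' \<Longrightarrow> lin J C w \<subseteq> lin J' C' w"
  unfolding lin_def by blast

lemma (in cring) Idl_insert:
  assumes "T \<subseteq> carrier R" "y \<in> carrier R"
  shows "Idl (insert y T) = lin (Idl T) (carrier R) y"
proof
  note i = genideal_ideal[OF assms(1)]
  have "insert y T \<subseteq> lin (Idl T) (carrier R) y"
    using lin_lower(1)[OF i oneideal assms(2)] genideal_self[OF assms(1)]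
      generator_mem_lin[OF i assms(2)] by auto
  then show "Idl (insert y T) \<subseteq> lin (Idl T) (carrier R) y"
    using genideal_minimal[OF lin_ideal[OF i oneideal assms(2)]] by blast
  have *: "insert y T \<subseteq> carrier R" using assms by simp
  show "lin (Idl T) (carrier R) y \<subseteq> Idl (insert y T)"
    using genideal_self[OF *] genideal_ideal[OF *] subset_Idl_subset[OF *]
    by (intro lin_carrier_least) auto
qed

lemma (in noetherian_ring) ex_maximal_ideal_in:
  assumes "\<A> \<noteq> {}" "\<And>J. J \<in> \<A> \<Longrightarrow> ideal J R"
  shows "\<exists>M\<in>\<A>. \<forall>J\<in>\<A>. M \<subseteq> J \<longrightarrow> J = M"
proof (rule subset_Zorn_nonempty[OF assms(1)])
  fix \<C> assume C: "\<C> \<noteq> {}" "subset.chain \<A> \<C>"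
  then have "subset.chain {I. ideal I R} \<C>" using assms(2) by (auto simp: subset.chain_def)
  then show "\<Union> \<C> \<in> \<A>" using ideal_chain_is_trivial[OF C(1)] C(2) by (auto simp: subset.chain_def)
qed

section \<open>Localization at \<open>P\<close> in terms of saturated ideals\<close>

locale prime_localization = primeideal P R for P and R (structure)
begin

definition sat :: "'a set \<Rightarrow> 'a set" where
  "sat J = {a \<in> carrier R. \<exists>s\<in>carrier R - P. s \<otimes> a \<in> J}"

definition sat_ideal :: "'a set \<Rightarrow> bool" where
  "sat_ideal J \<longleftrightarrow> ideal J R \<and> sat J \<subseteq> J"

lemma one_not_in: "\<one> \<notin> P" using I_notcarr one_imp_carrier by blast

lemma mult_not_in: "s \<in> carrier R - P \<Longrightarrow> t \<in> carrier R - P \<Longrightarrow> s \<otimes> t \<in> carrier R - P"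
  using I_prime by blast

lemma satI: "a \<in> carrier R \<Longrightarrow> s \<in> carrier R \<Longrightarrow> s \<notin> P \<Longrightarrow> s \<otimes> a \<in> J \<Longrightarrow> a \<in> sat J"
  unfolding sat_def by blast

lemma satE:
  assumes "a \<in> sat J"
  obtains s where "a \<in> carrier R" "s \<in> carrier R" "s \<notin> P" "s \<otimes> a \<in> J"
  using assms unfolding sat_def by blast

lemma sat_upper: assumes "ideal J R" shows "J \<subseteq> sat J"
  using ideal.Icarr[OF assms] one_not_in by (auto intro!: satI[of _ \<one>])

lemma sat_mono: "J \<subseteq> K \<Longrightarrow> sat J \<subseteq> sat K"
  unfolding sat_def by blast

lemma ideal_sat: assumes J: "ideal J R" shows "ideal (sat J) R"
proof (rule idealI_cring)
  show "sat J \<subseteq> carrier R" by (auto simp: sat_def)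
  show "\<zero> \<in> sat J" using sat_upper[OF J] zero_mem_ideal[OF J] by blast
  show "a \<oplus> b \<in> sat J" if a: "a \<in> sat J" and b: "b \<in> sat J" for a b
  proof -
    obtain s where s: "a \<in> carrier R" "s \<in> carrier R" "s \<notin> P" "s \<otimes> a \<in> J" using satE[OF a] .
    obtain t where t: "b \<in> carrier R" "t \<in> carrier R" "t \<notin> P" "t \<otimes> b \<in> J" using satE[OF b] .
    have "(s \<otimes> t) \<otimes> (a \<oplus> b) = t \<otimes> (s \<otimes> a) \<oplus> s \<otimes> (t \<otimes> b)" using s t by algebra
    then show ?thesis using s t J mult_not_in[of s t]
      by (intro satI[of _ "s \<otimes> t"]) (auto intro: ideal_ops)
  qed
  show "x \<otimes> a \<in> sat J" if a: "a \<in> sat J" and x: "x \<in> carrier R" for a x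
  proof -
    obtain s where s: "a \<in> carrier R" "s \<in> carrier R" "s \<notin> P" "s \<otimes> a \<in> J" using satE[OF a] .
    have "s \<otimes> (x \<otimes> a) = x \<otimes> (s \<otimes> a)" using s x by algebra
    then show ?thesis using s x J by (intro satI[of _ s]) (auto intro: ideal_ops)
  qed
qed

lemma sat_sat: assumes "ideal J R" shows "sat (sat J) = sat J"
proof
  show "sat (sat J) \<subseteq> sat J"
  proof
    fix a assume "a \<in> sat (sat J)"
    then obtain s where s: "a \<in> carrier R" "s \<in> carrier R" "s \<notin> P" "s \<otimes> a \<in> sat J" using satE by metis
    then obtain t where t: "t \<in> carrier R" "t \<notin> P" "t \<otimes> (s \<otimes> a) \<in> J" using satE by metis
    then show "a \<in> sat J" using s mult_not_in[of t s]
      by (intro satI[of _ "t \<otimes> s"]) (auto simp: m_assoc)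
  qed
qed (rule sat_upper[OF ideal_sat[OF assms]])

lemma sat_idealI: "ideal J R \<Longrightarrow> sat_ideal (sat J)"
  unfolding sat_ideal_def by (simp add: ideal_sat sat_sat)

lemma sat_ideal_ideal: "sat_ideal J \<Longrightarrow> ideal J R"
  unfolding sat_ideal_def by blast

lemma sat_ideal_eq: "sat_ideal J \<Longrightarrow> sat J = J"
  unfolding sat_ideal_def using sat_upper by blast

lemma sat_least: "sat_ideal K \<Longrightarrow> J \<subseteq> K \<Longrightarrow> sat J \<subseteq> K"
  using sat_mono sat_ideal_eq by blast

lemma sat_idealD: "sat_ideal J \<Longrightarrow> s \<in> carrier R \<Longrightarrow> s \<notin> P \<Longrightarrow> a \<in> carrier R \<Longrightarrow> s \<otimes> a \<in> J \<Longrightarrow> a \<in> J"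
  unfolding sat_ideal_def using satI by blast

lemma sat_ideal_carrier: "sat_ideal (carrier R)"
  unfolding sat_ideal_def by (auto simp: oneideal sat_def)

lemma sat_ideal_Int: "sat_ideal J \<Longrightarrow> sat_ideal K \<Longrightarrow> sat_ideal (J \<inter> K)"
  unfolding sat_ideal_def by (auto intro: i_intersect simp: sat_def)

lemma sat_ideal_prime: assumes "primeideal Q R" "Q \<subseteq> P" shows "sat_ideal Q"
  unfolding sat_ideal_def
  using primeideal.axioms(1)[OF assms(1)] primeideal.I_prime[OF assms(1)] assms(2) by (auto simp: sat_def)

lemma sat_Int: assumes J: "ideal J R" and K: "ideal K R" shows "sat (J \<inter> K) = sat J \<inter> sat K"
proof
  show "sat J \<inter> sat K \<subseteq> sat (J \<inter> K)"
  proof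
    fix a assume "a \<in> sat J \<inter> sat K"
    then obtain s t where s: "a \<in> carrier R" "s \<in> carrier R" "s \<notin> P" "s \<otimes> a \<in> J"
      and t: "t \<in> carrier R" "t \<notin> P" "t \<otimes> a \<in> K" by (auto elim!: satE)
    have "(s \<otimes> t) \<otimes> a = t \<otimes> (s \<otimes> a)" "(s \<otimes> t) \<otimes> a = s \<otimes> (t \<otimes> a)" using s t by algebra+
    then have "(s \<otimes> t) \<otimes> a \<in> J \<inter> K" using s t J K by (metis IntI ideal.I_l_closed)
    then show "a \<in> sat (J \<inter> K)" using s t mult_not_in[of s t] by (intro satI[of _ "s \<otimes> t"]) auto
  qed
qed (auto intro: sat_mono[THEN subsetD])

text \<open>\<open>step J K\<close> says that \<open>K / J\<close>, localized at \<open>P\<close>, is zero or isomorphic to the residue field. Hence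
  \<open>wser n J K\<close> bounds the length of the localization of \<open>K / J\<close> by \<open>n\<close> from above, and \<open>schain n J K\<close> bounds
  it from below.\<close>

definition step :: "'a set \<Rightarrow> 'a set \<Rightarrow> bool" where
  "step J K \<longleftrightarrow> sat_ideal J \<and> sat_ideal K \<and> J \<subseteq> K \<and>
     (\<exists>u\<in>K. (\<forall>c\<in>P. c \<otimes> u \<in> J) \<and>
        (\<forall>z\<in>K. \<exists>s\<in>carrier R - P. \<exists>a\<in>carrier R. s \<otimes> z \<ominus> a \<otimes> u \<in> J))"

inductive wser :: "nat \<Rightarrow> 'a set \<Rightarrow> 'a set \<Rightarrow> bool" where
  refl: "sat_ideal J \<Longrightarrow> wser 0 J J"
| snoc: "wser n J K \<Longrightarrow> step K K' \<Longrightarrow> wser (Suc n) J K'"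

inductive schain :: "nat \<Rightarrow> 'a set \<Rightarrow> 'a set \<Rightarrow> bool" where
  refl: "sat_ideal J \<Longrightarrow> schain 0 J J"
| snoc: "schain n J K \<Longrightarrow> K \<subset> K' \<Longrightarrow> sat_ideal K' \<Longrightarrow> schain (Suc n) J K'"

lemma stepI:
  assumes "sat_ideal J" "sat_ideal K" "J \<subseteq> K" "u \<in> K" "\<And>c. c \<in> P \<Longrightarrow> c \<otimes> u \<in> J"
    and "\<And>z. z \<in> K \<Longrightarrow> \<exists>s a. s \<in> carrier R \<and> s \<notin> P \<and> a \<in> carrier R \<and> s \<otimes> z \<ominus> a \<otimes> u \<in> J"
  shows "step J K"
proof -
  have "\<exists>s\<in>carrier R - P. \<exists>a\<in>carrier R. s \<otimes> z \<ominus> a \<otimes> u \<in> J" if "z \<in> K" for z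
    using assms(6)[OF that] by blast
  then show ?thesis unfolding step_def using assms(1-5) by blast
qed

section \<open>Steps under intersection, sum and multiplication by an element\<close>

lemma stepE:
  assumes "step J K"
  obtains u where "sat_ideal J" "sat_ideal K" "J \<subseteq> K" "u \<in> K" "\<And>c. c \<in> P \<Longrightarrow> c \<otimes> u \<in> J"
    "\<And>z. z \<in> K \<Longrightarrow> \<exists>s a. s \<in> carrier R \<and> s \<notin> P \<and> a \<in> carrier R \<and> s \<otimes> z \<ominus> a \<otimes> u \<in> J"
proof -
  obtain u where u: "u \<in> K" "\<forall>c\<in>P. c \<otimes> u \<in> J"
    "\<forall>z\<in>K. \<exists>s\<in>carrier R - P. \<exists>a\<in>carrier R. s \<otimes> z \<ominus> a \<otimes> u \<in> J"
    using assms unfolding step_def by blast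
  have "\<exists>s a. s \<in> carrier R \<and> s \<notin> P \<and> a \<in> carrier R \<and> s \<otimes> z \<ominus> a \<otimes> u \<in> J" if "z \<in> K" for z
    using u(3) that by blast
  then show ?thesis using that u(1,2) assms unfolding step_def by simp
qed

text \<open>The generator \<open>\<zero>\<close> gives a trivial step; allowing it lets a series be
  carried through operations that collapse some of its factors.\<close>

lemma step_refl: assumes J: "sat_ideal J" shows "step J J"
proof -
  note iJ = sat_ideal_ideal[OF J]
  have "c \<otimes> \<zero> \<in> J" if "c \<in> P" for c using that Icarr zero_mem_ideal[OF iJ] by simp
  moreover have "\<exists>s a. s \<in> carrier R \<and> s \<notin> P \<and> a \<in> carrier R \<and> s \<otimes> z \<ominus> a \<otimes> \<zero> \<in> J" if z: "z \<in> J" for z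
  proof -
    have "\<one> \<otimes> z \<ominus> \<zero> \<otimes> \<zero> \<in> J" using z ideal.Icarr[OF iJ z] by (simp add: minus_eq)
    then show ?thesis using one_not_in by blast
  qed
  ultimately show ?thesis using stepI[OF J J subset_refl zero_mem_ideal[OF iJ]] by simp
qed

text \<open>\<open>(K \<inter> L) / (J \<inter> L)\<close> embeds in \<open>K / J\<close>, which is
  locally zero or simple. So either the intersection adds nothing, or any \<open>v\<close> in
  \<open>K \<inter> L\<close> outside \<open>J\<close> already generates locally.\<close>

lemma step_Int: assumes st: "step J K" and L: "sat_ideal L" shows "step (J \<inter> L) (K \<inter> L)"
proof (cases "K \<inter> L \<subseteq> J")
  case True
  then have "K \<inter> L = J \<inter> L" using st unfolding step_def by blast
  moreover have "sat_ideal (J \<inter> L)" using st L sat_ideal_Int unfolding step_def by blast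
  then have "step (J \<inter> L) (J \<inter> L)" by (rule step_refl)
  ultimately show ?thesis by simp
next
  case False
  then obtain v where v: "v \<in> K" "v \<in> L" "v \<notin> J" by blast
  obtain u where J: "sat_ideal J" and K: "sat_ideal K" and JK: "J \<subseteq> K" and u: "u \<in> K"
    and Pu: "\<And>c. c \<in> P \<Longrightarrow> c \<otimes> u \<in> J"
    and gen: "\<And>z. z \<in> K \<Longrightarrow> \<exists>s a. s \<in> carrier R \<and> s \<notin> P \<and> a \<in> carrier R \<and> s \<otimes> z \<ominus> a \<otimes> u \<in> J"
    by (rule stepE[OF st]) blast
  note iJ = sat_ideal_ideal[OF J] and iK = sat_ideal_ideal[OF K] and iL = sat_ideal_ideal[OF L]
  have uc: "u \<in> carrier R" and vc: "v \<in> carrier R" using u v ideal.Icarr[OF iK] by auto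
  obtain s a where s: "s \<in> carrier R" "s \<notin> P" and a: "a \<in> carrier R" and sv: "s \<otimes> v \<ominus> a \<otimes> u \<in> J"
    using gen[OF v(1)] by blast
  \<comment> \<open>The coefficient \<open>a\<close> is a unit at \<open>P\<close>: otherwise
    \<open>P u \<subseteq> J\<close> would force \<open>s v\<close>, hence \<open>v\<close>, into
    \<open>J\<close>.\<close>
  have aP: "a \<notin> P"
  proof
    assume "a \<in> P"
    then have "(s \<otimes> v \<ominus> a \<otimes> u) \<oplus> a \<otimes> u \<in> J" using Pu sv iJ add_closed_ideal by blast
    moreover have "(s \<otimes> v \<ominus> a \<otimes> u) \<oplus> a \<otimes> u = s \<otimes> v" using s(1) a uc vc by algebra
    ultimately show False using sat_idealD[OF J s vc] v by simp
  qed
  show ?thesis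
  proof (rule stepI[where u = v])
    show "sat_ideal (J \<inter> L)" "sat_ideal (K \<inter> L)" using J K L sat_ideal_Int by auto
    show "J \<inter> L \<subseteq> K \<inter> L" "v \<in> K \<inter> L" using JK v by auto
    show "c \<otimes> v \<in> J \<inter> L" if c: "c \<in> P" for c
    proof
      have cc: "c \<in> carrier R" using Icarr[OF c] .
      have "s \<otimes> (c \<otimes> v) = c \<otimes> (s \<otimes> v \<ominus> a \<otimes> u) \<oplus> a \<otimes> (c \<otimes> u)" using s(1) a uc vc cc by algebra
      then have "s \<otimes> (c \<otimes> v) \<in> J" using sv Pu[OF c] iJ cc a by (simp add: ideal_ops)
      then show "c \<otimes> v \<in> J" using sat_idealD[OF J s, of "c \<otimes> v"] cc vc by simp
      show "c \<otimes> v \<in> L" using iL cc v by (simp add: ideal_ops)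
    qed
    show "\<exists>s a. s \<in> carrier R \<and> s \<notin> P \<and> a \<in> carrier R \<and> s \<otimes> z \<ominus> a \<otimes> v \<in> J \<inter> L" if z: "z \<in> K \<inter> L" for z
    proof -
      have zc: "z \<in> carrier R" using z ideal.Icarr[OF iK] by auto
      obtain t b where t: "t \<in> carrier R" "t \<notin> P" and b: "b \<in> carrier R" and tz: "t \<otimes> z \<ominus> b \<otimes> u \<in> J"
        using gen[of z] z by blast
      have "(a \<otimes> t) \<otimes> z \<ominus> (b \<otimes> s) \<otimes> v = a \<otimes> (t \<otimes> z \<ominus> b \<otimes> u) \<ominus> b \<otimes> (s \<otimes> v \<ominus> a \<otimes> u)"
        using s(1) a t(1) b uc vc zc by algebra
      then have "(a \<otimes> t) \<otimes> z \<ominus> (b \<otimes> s) \<otimes> v \<in> J" using sv tz iJ a b by (simp add: ideal_ops)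
      moreover have "(a \<otimes> t) \<otimes> z \<ominus> (b \<otimes> s) \<otimes> v \<in> L" using z v iL a b s t by (simp add: ideal_ops)
      ultimately show ?thesis using mult_not_in[of a t] a aP t b s by blast
    qed
  qed
qed

text \<open>\<open>L\<close> contributes an element outside \<open>J\<close>, whose coefficient
  along \<open>u\<close> is a unit at \<open>P\<close>; it can replace \<open>u\<close> as the
  generator of \<open>K\<close> over \<open>J\<close>.\<close>

lemma step_simple:
  assumes st: "step J K" and L: "sat_ideal L" and LK: "L \<subseteq> K" and nL: "\<not> L \<subseteq> J"
  shows "sat (J <+> L) = K"
proof
  obtain u where J: "sat_ideal J" and K: "sat_ideal K" and JK: "J \<subseteq> K" and u: "u \<in> K"
    and Pu: "\<And>c. c \<in> P \<Longrightarrow> c \<otimes> u \<in> J"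
    and gen: "\<And>z. z \<in> K \<Longrightarrow> \<exists>s a. s \<in> carrier R \<and> s \<notin> P \<and> a \<in> carrier R \<and> s \<otimes> z \<ominus> a \<otimes> u \<in> J"
    by (rule stepE[OF st]) blast
  note iJ = sat_ideal_ideal[OF J] and iK = sat_ideal_ideal[OF K] and iL = sat_ideal_ideal[OF L]
  show "sat (J <+> L) \<subseteq> K" using sat_least[OF K] set_add_least[OF iK JK LK] by blast
  obtain v where v: "v \<in> L" "v \<notin> J" using nL by blast
  have uc: "u \<in> carrier R" and vc: "v \<in> carrier R" using u v LK ideal.Icarr[OF iK] by auto
  obtain s a where s: "s \<in> carrier R" "s \<notin> P" and a: "a \<in> carrier R" and sv: "s \<otimes> v \<ominus> a \<otimes> u \<in> J"
    using gen[of v] v LK by blast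
  have aP: "a \<notin> P"
  proof
    assume "a \<in> P"
    then have "(s \<otimes> v \<ominus> a \<otimes> u) \<oplus> a \<otimes> u \<in> J" using Pu sv iJ add_closed_ideal by blast
    moreover have "(s \<otimes> v \<ominus> a \<otimes> u) \<oplus> a \<otimes> u = s \<otimes> v" using s(1) a uc vc by algebra
    ultimately show False using sat_idealD[OF J s vc] v by simp
  qed
  show "K \<subseteq> sat (J <+> L)"
  proof
    fix z assume z: "z \<in> K"
    have zc: "z \<in> carrier R" using z ideal.Icarr[OF iK] by auto
    obtain t b where t: "t \<in> carrier R" "t \<notin> P" and b: "b \<in> carrier R" and tz: "t \<otimes> z \<ominus> b \<otimes> u \<in> J"
      using gen[OF z] by blast
    have "(a \<otimes> t) \<otimes> z = (a \<otimes> (t \<otimes> z \<ominus> b \<otimes> u) \<ominus> b \<otimes> (s \<otimes> v \<ominus> a \<otimes> u)) \<oplus> (b \<otimes> s) \<otimes> v"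
      using s(1) a t(1) b uc vc zc by algebra
    moreover have "a \<otimes> (t \<otimes> z \<ominus> b \<otimes> u) \<ominus> b \<otimes> (s \<otimes> v \<ominus> a \<otimes> u) \<in> J"
      using sv tz iJ a b by (simp add: ideal_ops)
    moreover have "(b \<otimes> s) \<otimes> v \<in> L" using v iL b s by (simp add: ideal_ops)
    ultimately have "(a \<otimes> t) \<otimes> z \<in> J <+> L" unfolding mem_set_add by blast
    then show "z \<in> sat (J <+> L)" using mult_not_in[of a t] a aP t zc
      by (intro satI[of _ "a \<otimes> t"]) auto
  qed
qed

text \<open>\<open>(K + L) / (J + L)\<close> is a quotient of \<open>K / J\<close>, so the same
  \<open>u\<close> generates it.\<close>

lemma step_join:
  assumes st: "step J K" and L: "ideal L R" shows "step (sat (J <+> L)) (sat (K <+> L))"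
proof -
  obtain u where J: "sat_ideal J" and K: "sat_ideal K" and JK: "J \<subseteq> K" and u: "u \<in> K"
    and Pu: "\<And>c. c \<in> P \<Longrightarrow> c \<otimes> u \<in> J"
    and gen: "\<And>z. z \<in> K \<Longrightarrow> \<exists>s a. s \<in> carrier R \<and> s \<notin> P \<and> a \<in> carrier R \<and> s \<otimes> z \<ominus> a \<otimes> u \<in> J"
    by (rule stepE[OF st]) blast
  note iJ = sat_ideal_ideal[OF J] and iK = sat_ideal_ideal[OF K]
  have uc: "u \<in> carrier R" using u ideal.Icarr[OF iK] by auto
  note iJL = add_ideals[OF iJ L] and iKL = add_ideals[OF iK L]
  have JL: "J \<subseteq> sat (J <+> L)" using set_add_lower(1)[OF iJ L] sat_upper[OF iJL] by blast
  show ?thesis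
  proof (rule stepI[where u = u])
    show "sat_ideal (sat (J <+> L))" "sat_ideal (sat (K <+> L))" using sat_idealI iJL iKL by auto
    show "sat (J <+> L) \<subseteq> sat (K <+> L)" using JK by (intro sat_mono) (auto simp: mem_set_add, blast)
    show "u \<in> sat (K <+> L)" using u set_add_lower(1)[OF iK L] sat_upper[OF iKL] by blast
    show "c \<otimes> u \<in> sat (J <+> L)" if "c \<in> P" for c using Pu that JL by blast
    fix z assume "z \<in> sat (K <+> L)"
    then obtain t where zc: "z \<in> carrier R" and t: "t \<in> carrier R" "t \<notin> P" "t \<otimes> z \<in> K <+> L"
      using satE by metis
    then obtain k l where k: "k \<in> K" and l: "l \<in> L" and tz: "t \<otimes> z = k \<oplus> l" by (auto simp: mem_set_add)
    have kc: "k \<in> carrier R" and lc: "l \<in> carrier R" using ideal.Icarr[OF iK k] ideal.Icarr[OF L l] by auto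
    obtain s a where s: "s \<in> carrier R" "s \<notin> P" and a: "a \<in> carrier R" and sk: "s \<otimes> k \<ominus> a \<otimes> u \<in> J"
      using gen[OF k] by blast
    have "(s \<otimes> t) \<otimes> z \<ominus> a \<otimes> u = s \<otimes> (k \<oplus> l) \<ominus> a \<otimes> u"
      using s(1) t(1) zc by (simp add: m_assoc flip: tz)
    also have "\<dots> = (s \<otimes> k \<ominus> a \<otimes> u) \<oplus> s \<otimes> l" using s(1) a uc kc lc by algebra
    finally have "(s \<otimes> t) \<otimes> z \<ominus> a \<otimes> u \<in> J <+> L"
      using sk l L s by (auto simp: mem_set_add intro: ideal_ops)
    then show "\<exists>s a. s \<in> carrier R \<and> s \<notin> P \<and> a \<in> carrier R \<and> s \<otimes> z \<ominus> a \<otimes> u \<in> sat (J <+> L)"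
      using mult_not_in[of s t] s t a sat_upper[OF iJL] by blast
  qed
qed

text \<open>Multiplication by \<open>w\<close> maps \<open>D / C\<close> onto the new factor, with
  generator \<open>u \<otimes> w\<close>; where this kills the factor, the step becomes
  trivial.\<close>

lemma step_lin:
  assumes st: "step C D" and J: "ideal J R" and w: "w \<in> carrier R"
  shows "step (sat (lin J C w)) (sat (lin J D w))"
proof -
  obtain u where C: "sat_ideal C" and D: "sat_ideal D" and CD: "C \<subseteq> D" and u: "u \<in> D"
    and Pu: "\<And>c. c \<in> P \<Longrightarrow> c \<otimes> u \<in> C"
    and gen: "\<And>z. z \<in> D \<Longrightarrow> \<exists>s a. s \<in> carrier R \<and> s \<notin> P \<and> a \<in> carrier R \<and> s \<otimes> z \<ominus> a \<otimes> u \<in> C"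
    by (rule stepE[OF st]) blast
  note iC = sat_ideal_ideal[OF C] and iD = sat_ideal_ideal[OF D]
  have uc: "u \<in> carrier R" using u ideal.Icarr[OF iD] by auto
  note lC = lin_ideal[OF J iC w] and lD = lin_ideal[OF J iD w]
  show ?thesis
  proof (rule stepI[where u = "u \<otimes> w"])
    show "sat_ideal (sat (lin J C w))" "sat_ideal (sat (lin J D w))" using sat_idealI lC lD by auto
    show "sat (lin J C w) \<subseteq> sat (lin J D w)" using CD by (intro sat_mono lin_mono) auto
    show "u \<otimes> w \<in> sat (lin J D w)" using lin_lower(2)[OF J iD w] u sat_upper[OF lD] by blast
    show "c \<otimes> (u \<otimes> w) \<in> sat (lin J C w)" if "c \<in> P" for c
      using lin_lower(2)[OF J iC w, of "c \<otimes> u"] Pu[OF that] sat_upper[OF lC] that Icarr uc w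
      by (auto simp: m_assoc)
    fix z assume "z \<in> sat (lin J D w)"
    then obtain t where zc: "z \<in> carrier R" and t: "t \<in> carrier R" "t \<notin> P" "t \<otimes> z \<in> lin J D w"
      using satE by metis
    then obtain j d where j: "j \<in> J" and d: "d \<in> D" and tz: "t \<otimes> z = j \<oplus> d \<otimes> w" by (auto elim: linE)
    have jc: "j \<in> carrier R" and dc: "d \<in> carrier R" using ideal.Icarr[OF iD d] ideal.Icarr[OF J j] by auto
    obtain s a where s: "s \<in> carrier R" "s \<notin> P" and a: "a \<in> carrier R" and sd: "s \<otimes> d \<ominus> a \<otimes> u \<in> C"
      using gen[OF d] by blast
    have "(s \<otimes> t) \<otimes> z \<ominus> a \<otimes> (u \<otimes> w) = s \<otimes> (j \<oplus> d \<otimes> w) \<ominus> a \<otimes> (u \<otimes> w)"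
      using s(1) t(1) zc by (simp add: m_assoc flip: tz)
    also have "\<dots> = s \<otimes> j \<oplus> (s \<otimes> d \<ominus> a \<otimes> u) \<otimes> w" using s(1) a uc jc dc w by algebra
    finally have "(s \<otimes> t) \<otimes> z \<ominus> a \<otimes> (u \<otimes> w) \<in> lin J C w"
      using linI[of "s \<otimes> j" J "s \<otimes> d \<ominus> a \<otimes> u" C w] sd j J s by (simp add: ideal_ops)
    then show "\<exists>s a. s \<in> carrier R \<and> s \<notin> P \<and> a \<in> carrier R \<and> s \<otimes> z \<ominus> a \<otimes> (u \<otimes> w) \<in> sat (lin J C w)"
      using mult_not_in[of s t] s t a sat_upper[OF lC] by blast
  qed
qed

section \<open>Composition series and the comparison of lengths\<close>

lemma step_sat_ideal: "step J K \<Longrightarrow> sat_ideal J \<and> sat_ideal K \<and> J \<subseteq> K"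
  unfolding step_def by blast

lemma wser_sat_ideal: "wser n J K \<Longrightarrow> sat_ideal J \<and> sat_ideal K \<and> J \<subseteq> K"
  by (induction rule: wser.induct) (auto dest: step_sat_ideal)

lemma schain_sat_ideal: "schain n J K \<Longrightarrow> sat_ideal J \<and> sat_ideal K \<and> J \<subseteq> K"
  by (induction rule: schain.induct) auto

lemma wser_trans: "wser n K L \<Longrightarrow> wser m J K \<Longrightarrow> wser (m + n) J L"
proof (induction rule: wser.induct)
  case (snoc n K L L')
  then show ?case using wser.snoc[of "m + n" J L L'] by simp
qed simp

lemma schain_trans: "schain n K L \<Longrightarrow> schain m J K \<Longrightarrow> schain (m + n) J L"
proof (induction rule: schain.induct)
  case (snoc n K L L')
  then show ?case using schain.snoc[of "m + n" J L L'] by simp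
qed simp

lemma wser_map:
  assumes "wser n J K" "\<And>J K. step J K \<Longrightarrow> step (f J) (f K)" "sat_ideal (f J)"
  shows "wser n (f J) (f K)"
  using assms(1,3)
proof (induction rule: wser.induct)
  case (snoc n J K K')
  show ?case by (rule wser.snoc[OF snoc.IH[OF snoc.prems] assms(2)[OF snoc.hyps(2)]])
qed (rule wser.refl)

text \<open>Refinement of the series by one ideal: intersecting with \<open>L\<close> gives the
  lower part, joining with \<open>L\<close> the upper part. Simplicity of the factors lets each step
  be counted in exactly one of the two, so the lengths add up to \<open>n\<close>.\<close>

lemma wser_split:
  assumes "wser n J K" "J \<subseteq> L" "L \<subseteq> K" "sat_ideal L"
  shows "\<exists>a b. a + b = n \<and> wser a J L \<and> wser b L K"
  using assms
proof (induction arbitrary: L rule: wser.induct)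
  case (refl J)
  then have "L = J" by blast
  then show ?case using wser.refl[OF refl.prems(3)] by (intro exI[of _ 0]) simp
next
  case (snoc n J K K' L)
  have K: "sat_ideal K" "sat_ideal K'" "K \<subseteq> K'" using step_sat_ideal[OF snoc.hyps(2)] by auto
  have JK: "J \<subseteq> K" using wser_sat_ideal[OF snoc.hyps(1)] by blast
  obtain a b where ab: "a + b = n" "wser a J (K \<inter> L)" "wser b (K \<inter> L) K"
    using snoc.IH[of "K \<inter> L"] JK snoc.prems(1) sat_ideal_Int[OF K(1) snoc.prems(3)] by blast
  show ?case
  proof (cases "L \<subseteq> K")
    case True
    then have "K \<inter> L = L" by blast
    then have "wser (Suc b) L K'" using wser.snoc[OF ab(3) snoc.hyps(2)] by simp
    moreover have "wser a J L" "a + Suc b = Suc n" using ab \<open>K \<inter> L = L\<close> by auto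
    ultimately show ?thesis by blast
  next
    case False
    note iL = sat_ideal_ideal[OF snoc.prems(3)] and iK = sat_ideal_ideal[OF K(1)]
    \<comment> \<open>Here the last step goes into the lower part. The upper part gains nothing: as
      \<open>L\<close> is not inside \<open>K\<close>, joining \<open>K\<close> with
      \<open>L\<close> already gives \<open>K'\<close>.\<close>
    have "K' \<inter> L = L" using snoc.prems by blast
    then have 1: "wser (Suc a) J L"
      using wser.snoc[OF ab(2) step_Int[OF snoc.hyps(2) snoc.prems(3)]] by simp
    have "wser b (sat ((K \<inter> L) <+> L)) (sat (K <+> L))"
      using wser_map[OF ab(3), of "\<lambda>J. sat (J <+> L)"] step_join iL iK
      by (simp add: sat_idealI add_ideals i_intersect)
    moreover have "(K \<inter> L) <+> L = L"
      using set_add_lower(2)[OF i_intersect[OF iK iL] iL] set_add_least[OF iL, of "K \<inter> L" L] by blast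
    moreover have "sat (K <+> L) = K'"
      using step_simple[OF snoc.hyps(2) snoc.prems(3) snoc.prems(2) False] .
    ultimately have "wser b L K'" using sat_ideal_eq snoc.prems(3) by simp
    moreover have "Suc a + b = Suc n" using ab(1) by simp
    ultimately show ?thesis using 1 by blast
  qed
qed

text \<open>Half of the Jordan--Hoelder theorem: when the series is cut at the members of the strict
  chain, every strict inclusion uses at least one step.\<close>

lemma schain_le_wser: "schain k J K \<Longrightarrow> wser n J K \<Longrightarrow> k \<le> n"
proof (induction arbitrary: n rule: schain.induct)
  case (snoc k J K K')
  have "J \<subseteq> K" "sat_ideal K" using schain_sat_ideal[OF snoc.hyps(1)] by auto
  then obtain a b where ab: "a + b = n" "wser a J K" "wser b K K'"
    using wser_split[OF snoc.prems, of K] snoc.hyps by blast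
  have "b \<noteq> 0" using ab(3) snoc.hyps(2) by (auto elim: wser.cases)
  then show ?case using snoc.IH[OF ab(2)] ab(1) by simp
qed simp

end

section \<open>Lengths and Nakayama\<close>

lemma (in cring) ideal_prod_least:
  assumes "ideal L R" "\<And>i j. i \<in> I \<Longrightarrow> j \<in> J \<Longrightarrow> i \<otimes> j \<in> L" shows "ideal_prod R I J \<subseteq> L"
proof
  fix s assume "s \<in> ideal_prod R I J"
  then show "s \<in> L" by (induction rule: ideal_prod.induct) (auto intro: assms add_closed_ideal)
qed

lemma (in cring) lin_one: assumes "ideal J R" shows "lin J (carrier R) \<one> = carrier R"
  using ideal.one_imp_carrier[OF lin_ideal[OF assms oneideal one_closed] generator_mem_lin[OF assms one_closed]] .

text \<open>\<open>x\<close> is a nonzerodivisor modulo \<open>J\<close>. For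
  \<open>J = carrier R\<close> this holds trivially, which starts the induction in
  \<open>nzd_lin_power\<close>.\<close>

definition (in cring) nzd :: "'a \<Rightarrow> 'a set \<Rightarrow> bool" where
  "nzd x J \<longleftrightarrow> (\<forall>z\<in>carrier R. x \<otimes> z \<in> J \<longrightarrow> z \<in> J)"

lemma (in cring) nzdD: "nzd x J \<Longrightarrow> z \<in> carrier R \<Longrightarrow> x \<otimes> z \<in> J \<Longrightarrow> z \<in> J"
  unfolding nzd_def by blast

lemma (in cring) nzd_pow:
  assumes x: "x \<in> carrier R" and "nzd x J" shows "nzd (x [^] (n::nat)) J"
proof (induction n)
  case (Suc n)
  show ?case unfolding nzd_def
  proof (intro ballI impI)
    fix z assume z: "z \<in> carrier R" "x [^] Suc n \<otimes> z \<in> J"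
    then have "x [^] n \<otimes> (x \<otimes> z) \<in> J" using x by (simp add: m_assoc)
    then have "x \<otimes> z \<in> J" using nzdD[OF Suc.IH] x z by simp
    then show "z \<in> J" using nzdD[OF assms(2)] z by simp
  qed
qed (auto simp: nzd_def)

context prime_localization
begin

lemma step_prime_carrier: "step P (carrier R)"
proof (rule stepI[where u = \<one>])
  show "sat_ideal P" using sat_ideal_prime primeideal by blast
  show "sat_ideal (carrier R)" by (rule sat_ideal_carrier)
  show "P \<subseteq> carrier R" "\<one> \<in> carrier R" using Icarr by auto
  show "c \<otimes> \<one> \<in> P" if "c \<in> P" for c using that Icarr by simp
  show "\<exists>s a. s \<in> carrier R \<and> s \<notin> P \<and> a \<in> carrier R \<and> s \<otimes> z \<ominus> a \<otimes> \<one> \<in> P" if "z \<in> carrier R" for z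
  proof (intro exI conjI)
    have "\<one> \<otimes> z \<ominus> z \<otimes> \<one> = \<zero>" using that by (simp add: minus_eq r_neg)
    then show "\<one> \<otimes> z \<ominus> z \<otimes> \<one> \<in> P" by simp
  qed (use that one_not_in in auto)
qed

lemma wser_prime_carrier: "wser 1 P (carrier R)"
  using wser.snoc[OF wser.refl[OF sat_ideal_prime[OF primeideal subset_refl]] step_prime_carrier] by simp

lemma schain_prime_carrier: "schain 1 P (carrier R)"
proof -
  have "P \<subset> carrier R" using Icarr I_notcarr by auto
  then show ?thesis
    using schain.snoc[OF schain.refl[OF sat_ideal_prime[OF primeideal subset_refl]] _ sat_ideal_carrier]
    by simp
qed

section \<open>Lengths modulo powers of an element\<close>

lemma sat_carrier: "sat (carrier R) = carrier R"
  using sat_ideal_eq[OF sat_ideal_carrier] .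

lemma sat_eqI: "ideal J R \<Longrightarrow> J \<subseteq> sat K \<Longrightarrow> ideal K R \<Longrightarrow> K \<subseteq> sat J \<Longrightarrow> sat J = sat K"
  by (intro subset_antisym sat_least sat_idealI)

text \<open>Multiplication by \<open>y [^] n\<close> keeps \<open>J\<close> inside \<open>J\<close>.
  So the factor between \<open>y [^] Suc n\<close> and \<open>y [^] n\<close> modulo
  \<open>J\<close> is the image of \<open>R / (J + y R)\<close>.\<close>

lemma lin_sat_power:
  assumes J: "ideal J R" and y: "y \<in> carrier R"
  shows "sat (lin J (sat (lin J (carrier R) y)) (y [^] n)) = sat (lin J (carrier R) (y [^] Suc n))"
proof -
  have yn: "y [^] n \<in> carrier R" and yS: "y [^] Suc n \<in> carrier R" using y by auto
  have ySn: "y [^] Suc n = y \<otimes> y [^] n" using y by (simp add: m_comm)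
  note iJ' = lin_ideal[OF J oneideal yS] and iy = lin_ideal[OF J oneideal y]
  note iC = ideal_sat[OF iy]
  note iL = lin_ideal[OF J iC yn]
  have "lin J (sat (lin J (carrier R) y)) (y [^] n) \<subseteq> sat (lin J (carrier R) (y [^] Suc n))"
  proof (rule lin_least[OF ideal_sat[OF iJ']])
    show "J \<subseteq> sat (lin J (carrier R) (y [^] Suc n))"
      using sat_upper[OF iJ'] lin_lower(1)[OF J oneideal yS] by blast
    fix c assume "c \<in> sat (lin J (carrier R) y)"
    then obtain s where c: "c \<in> carrier R" and s: "s \<in> carrier R" "s \<notin> P" "s \<otimes> c \<in> lin J (carrier R) y"
      by (rule satE)
    obtain j r where j: "j \<in> J" and r: "r \<in> carrier R" and sc: "s \<otimes> c = j \<oplus> r \<otimes> y"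
      by (rule linE[OF s(3)])
    have jc: "j \<in> carrier R" using ideal.Icarr[OF J j] .
    have "s \<otimes> (c \<otimes> y [^] n) = (j \<oplus> r \<otimes> y) \<otimes> y [^] n" using s(1) c yn by (simp add: m_assoc flip: sc)
    also have "\<dots> = j \<otimes> y [^] n \<oplus> r \<otimes> y [^] Suc n" unfolding ySn using jc r y yn by algebra
    also have "\<dots> \<in> lin J (carrier R) (y [^] Suc n)"
      using ideal.I_r_closed[OF J j yn] r by (intro linI)
    finally show "c \<otimes> y [^] n \<in> sat (lin J (carrier R) (y [^] Suc n))"
      using s c yn by (intro satI[of _ s]) auto
  qed
  moreover have "lin J (carrier R) (y [^] Suc n) \<subseteq> lin J (sat (lin J (carrier R) y)) (y [^] n)"
  proof (rule lin_carrier_least[OF iL lin_lower(1)[OF J iC yn]])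
    have "y \<in> sat (lin J (carrier R) y)" using sat_upper[OF iy] generator_mem_lin[OF J y] by blast
    then show "y [^] Suc n \<in> lin J (sat (lin J (carrier R) y)) (y [^] n)"
      unfolding ySn using lin_lower(2)[OF J iC yn] by blast
  qed
  ultimately show ?thesis using sat_eqI[OF iL _ iJ'] sat_upper[OF iL] by blast
qed

lemma wser_lin:
  assumes C: "wser n C D" and J: "ideal J R" and w: "w \<in> carrier R"
  shows "wser n (sat (lin J C w)) (sat (lin J D w))"
  using wser_map[OF C, of "\<lambda>C. sat (lin J C w)"] step_lin[OF _ J w]
    sat_idealI[OF lin_ideal[OF J sat_ideal_ideal w]] wser_sat_ideal[OF C] by blast

text \<open>A cyclic module killed by \<open>C\<close> is a quotient of \<open>R / C\<close>. The
  upper bounds for the factors produced by the Frobenius come from this.\<close>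

lemma wser_cyclic:
  assumes C: "wser n C (carrier R)" and J: "ideal J R" and w: "w \<in> carrier R"
    and Cw: "\<And>c. c \<in> C \<Longrightarrow> c \<otimes> w \<in> sat J"
  shows "wser n (sat J) (sat (lin J (carrier R) w))"
proof -
  have iC: "ideal C R" using wser_sat_ideal[OF C] sat_ideal_ideal by blast
  have "lin J C w \<subseteq> sat J" using lin_least[OF ideal_sat[OF J] sat_upper[OF J] Cw] .
  then have "sat (lin J C w) = sat J"
    using sat_eqI[OF lin_ideal[OF J iC w] _ J] lin_lower(1)[OF J iC w] sat_upper[OF lin_ideal[OF J iC w]]
    by blast
  then show ?thesis using wser_lin[OF C J w] by simp
qed

lemma wser_power:
  assumes J: "ideal J R" and y: "y \<in> carrier R" and C: "wser N (sat (lin J (carrier R) y)) (carrier R)"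
  shows "wser (n * N) (sat (lin J (carrier R) (y [^] n))) (carrier R)"
proof (induction n)
  case 0
  then show ?case using wser.refl[OF sat_ideal_carrier] by (simp add: lin_one[OF J] sat_carrier)
next
  case (Suc n)
  have "y [^] n \<in> carrier R" using y by simp
  then have "wser N (sat (lin J (carrier R) (y [^] Suc n))) (sat (lin J (carrier R) (y [^] n)))"
    using wser_lin[OF C J] lin_sat_power[OF J y, of n] by metis
  then show ?case using wser_trans[OF Suc.IH] by simp
qed

text \<open>Multiplication by a nonzerodivisor modulo \<open>J\<close> is injective on
  \<open>R / J\<close>, so distinct saturated ideals above \<open>J\<close> keep distinct
  images.\<close>

lemma schain_lin:
  assumes J: "ideal J R" and w: "w \<in> carrier R" and nz: "nzd w (sat J)"
  shows "schain n C D \<Longrightarrow> J \<subseteq> C \<Longrightarrow> schain n (sat (lin J C w)) (sat (lin J D w))"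
proof (induction rule: schain.induct)
  case (refl C)
  then show ?case by (intro schain.refl sat_idealI lin_ideal J w sat_ideal_ideal)
next
  case (snoc n C D D')
  have D: "sat_ideal D" "C \<subseteq> D" using schain_sat_ideal[OF snoc.hyps(1)] by auto
  then have JD: "J \<subseteq> D" using snoc.prems by blast
  note iD = sat_ideal_ideal[OF D(1)] and iD' = sat_ideal_ideal[OF snoc.hyps(3)]
  note lD' = lin_ideal[OF J iD' w]
  have "sat (lin J D w) \<subset> sat (lin J D' w)"
  proof
    show "sat (lin J D w) \<subseteq> sat (lin J D' w)" using snoc.hyps(2) by (intro sat_mono lin_mono) auto
    obtain d where d: "d \<in> D'" "d \<notin> D" using snoc.hyps(2) by blast
    have dc: "d \<in> carrier R" using ideal.Icarr[OF iD' d(1)] .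
    have "d \<otimes> w \<in> sat (lin J D' w)" using sat_upper[OF lD'] lin_lower(2)[OF J iD' w d(1)] by blast
    moreover have "d \<otimes> w \<notin> sat (lin J D w)"
    proof
      assume "d \<otimes> w \<in> sat (lin J D w)"
      then obtain s where s: "s \<in> carrier R" "s \<notin> P" "s \<otimes> (d \<otimes> w) \<in> lin J D w" by (rule satE)
      obtain j c where j: "j \<in> J" and c: "c \<in> D" and e: "s \<otimes> (d \<otimes> w) = j \<oplus> c \<otimes> w"
        by (rule linE[OF s(3)])
      have jc: "j \<in> carrier R" and cc: "c \<in> carrier R" using ideal.Icarr[OF J j] ideal.Icarr[OF iD c] by auto
      \<comment> \<open>Cancelling \<open>w\<close> puts \<open>s d - c\<close> into
        \<open>sat J \<subseteq> D\<close>, and then \<open>d\<close> into \<open>D\<close>,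
        contrary to its choice.\<close>
      have "w \<otimes> (s \<otimes> d \<ominus> c) = s \<otimes> (d \<otimes> w) \<ominus> c \<otimes> w" using w s(1) dc cc by algebra
      also have "\<dots> = (j \<oplus> c \<otimes> w) \<ominus> c \<otimes> w" unfolding e ..
      also have "\<dots> = j" using jc cc w by algebra
      finally have "w \<otimes> (s \<otimes> d \<ominus> c) \<in> sat J" using j sat_upper[OF J] by auto
      then have "s \<otimes> d \<ominus> c \<in> sat J" using nzdD[OF nz] s dc cc by simp
      then have "s \<otimes> d \<ominus> c \<in> D" using sat_least[OF D(1) JD] by blast
      then have "(s \<otimes> d \<ominus> c) \<oplus> c \<in> D" using add_closed_ideal[OF iD] c by blast
      moreover have "(s \<otimes> d \<ominus> c) \<oplus> c = s \<otimes> d" using s(1) dc cc by algebra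
      ultimately show False using sat_idealD[OF D(1) s(1,2) dc] d by simp
    qed
    ultimately show "sat (lin J D w) \<noteq> sat (lin J D' w)" by blast
  qed
  then show ?case using schain.snoc[OF snoc.IH[OF snoc.prems]] sat_idealI[OF lD'] by blast
qed

text \<open>The lower bound matching \<open>wser_power\<close>: multiplication by
  \<open>y [^] n\<close> copies the whole chain above \<open>J + y R\<close> between two consecutive
  powers of \<open>y\<close>.\<close>

lemma schain_power:
  assumes J: "ideal J R" and y: "y \<in> carrier R" and nz: "nzd y (sat J)"
    and C: "schain N (sat (lin J (carrier R) y)) (carrier R)"
  shows "schain (n * N) (sat (lin J (carrier R) (y [^] n))) (carrier R)"
proof (induction n)
  case 0
  then show ?case using schain.refl[OF sat_ideal_carrier] by (simp add: lin_one[OF J] sat_carrier)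
next
  case (Suc n)
  have yn: "y [^] n \<in> carrier R" using y by simp
  have "J \<subseteq> sat (lin J (carrier R) y)"
    using lin_lower(1)[OF J oneideal y] sat_upper[OF lin_ideal[OF J oneideal y]] by blast
  then have "schain N (sat (lin J (carrier R) (y [^] Suc n))) (sat (lin J (carrier R) (y [^] n)))"
    using schain_lin[OF J yn nzd_pow[OF y nz] C] lin_sat_power[OF J y, of n] by simp
  then show ?case using schain_trans[OF Suc.IH] by simp
qed

text \<open>The regular sequence \<open>y, x\<close> modulo \<open>J\<close> stays regular when
  \<open>y\<close> is replaced by a power. Writing \<open>z = j + r y\<close> locally, one factor
  \<open>y\<close> is cancelled by \<open>nzy\<close>, and the induction hypothesis applies to
  \<open>r\<close> modulo \<open>y [^] n\<close>.\<close>

lemma nzd_lin_power: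
  assumes J: "ideal J R" and x: "x \<in> carrier R" and y: "y \<in> carrier R"
    and nzy: "nzd y (sat J)" and nzx: "nzd x (sat (lin J (carrier R) y))"
  shows "nzd x (sat (lin J (carrier R) (y [^] (n::nat))))"
proof (induction n)
  case 0
  then show ?case using x by (simp add: nzd_def lin_one[OF J] sat_carrier)
next
  case (Suc n)
  have yn: "y [^] n \<in> carrier R" and yS: "y [^] Suc n \<in> carrier R" using y by auto
  have ySn: "y [^] Suc n = y \<otimes> y [^] n" using y by (simp add: m_comm)
  note in' = lin_ideal[OF J oneideal yn] and iS = lin_ideal[OF J oneideal yS] and iy = lin_ideal[OF J oneideal y]
  show ?case unfolding nzd_def
  proof (intro ballI impI)
    fix z assume z: "z \<in> carrier R" and xz: "x \<otimes> z \<in> sat (lin J (carrier R) (y [^] Suc n))"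
    have "lin J (carrier R) (y [^] Suc n) \<subseteq> lin J (carrier R) y"
    proof (rule lin_carrier_least[OF iy lin_lower(1)[OF J oneideal y]])
      show "y [^] Suc n \<in> lin J (carrier R) y"
        using lin_lower(2)[OF J oneideal y yn] by simp
    qed
    then have "z \<in> sat (lin J (carrier R) y)" using nzdD[OF nzx z] xz sat_mono by blast
    then obtain s where s: "s \<in> carrier R" "s \<notin> P" "s \<otimes> z \<in> lin J (carrier R) y" by (rule satE)
    obtain j r where j: "j \<in> J" and r: "r \<in> carrier R" and sz: "s \<otimes> z = j \<oplus> r \<otimes> y" by (rule linE[OF s(3)])
    obtain t where t: "t \<in> carrier R" "t \<notin> P" "t \<otimes> (x \<otimes> z) \<in> lin J (carrier R) (y [^] Suc n)"
      using xz by (rule satE)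
    obtain i q where i: "i \<in> J" and q: "q \<in> carrier R" and txz: "t \<otimes> (x \<otimes> z) = i \<oplus> q \<otimes> y [^] Suc n"
      by (rule linE[OF t(3)])
    have jc: "j \<in> carrier R" and ic: "i \<in> carrier R" using ideal.Icarr[OF J] i j by auto
    have "t \<otimes> (x \<otimes> (s \<otimes> z)) = s \<otimes> (t \<otimes> (x \<otimes> z))" using t(1) s(1) x z by algebra
    then have "t \<otimes> (x \<otimes> (j \<oplus> r \<otimes> y)) = s \<otimes> (i \<oplus> q \<otimes> (y \<otimes> y [^] n))"
      unfolding sz txz ySn .
    then have e: "t \<otimes> x \<otimes> j \<oplus> y \<otimes> (t \<otimes> x \<otimes> r) = s \<otimes> i \<oplus> y \<otimes> (s \<otimes> q \<otimes> y [^] n)"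
      using t(1) s(1) x jc ic r q y yn by (simp add: r_distr m_ac)
    define v where "v = t \<otimes> x \<otimes> r \<ominus> s \<otimes> q \<otimes> y [^] n"
    have vc: "v \<in> carrier R" unfolding v_def using t s x r q yn by simp
    have "y \<otimes> v = (t \<otimes> x \<otimes> j \<oplus> y \<otimes> (t \<otimes> x \<otimes> r)) \<ominus> t \<otimes> x \<otimes> j \<ominus> y \<otimes> (s \<otimes> q \<otimes> y [^] n)"
      unfolding v_def using t(1) s(1) x r q y yn jc by algebra
    also have "\<dots> = s \<otimes> i \<ominus> t \<otimes> x \<otimes> j" unfolding e using t(1) s(1) x q y yn jc ic by algebra
    also have "\<dots> \<in> J" using J i j t(1) s(1) x by (simp add: ideal_ops)
    finally have "v \<in> sat J" using nzdD[OF nzy vc] sat_upper[OF J] by blast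
    then have "v \<in> sat (lin J (carrier R) (y [^] n))"
      using sat_mono[OF lin_lower(1)[OF J oneideal yn]] by blast
    moreover have "(s \<otimes> q) \<otimes> y [^] n \<in> sat (lin J (carrier R) (y [^] n))"
      using lin_lower(2)[OF J oneideal yn, of "s \<otimes> q"] s q sat_upper[OF in'] by blast
    ultimately have "v \<oplus> (s \<otimes> q) \<otimes> y [^] n \<in> sat (lin J (carrier R) (y [^] n))"
      using add_closed_ideal[OF ideal_sat[OF in']] by blast
    moreover have "v \<oplus> (s \<otimes> q) \<otimes> y [^] n = t \<otimes> (x \<otimes> r)" unfolding v_def
      using t(1) s(1) x r q yn by algebra
    ultimately have "t \<otimes> (x \<otimes> r) \<in> sat (lin J (carrier R) (y [^] n))" by simp
    then have "x \<otimes> r \<in> sat (lin J (carrier R) (y [^] n))"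
      using sat_idealD[OF sat_idealI[OF in'] t(1,2)] x r by simp
    then have "r \<in> sat (lin J (carrier R) (y [^] n))" using nzdD[OF Suc.IH r] by blast
    then obtain p where p: "p \<in> carrier R" "p \<notin> P" "p \<otimes> r \<in> lin J (carrier R) (y [^] n)" by (rule satE)
    obtain k l where k: "k \<in> J" and l: "l \<in> carrier R" and pr: "p \<otimes> r = k \<oplus> l \<otimes> y [^] n" by (rule linE[OF p(3)])
    have kc: "k \<in> carrier R" using ideal.Icarr[OF J k] .
    have "(p \<otimes> s) \<otimes> z = p \<otimes> (j \<oplus> r \<otimes> y)" using p(1) s(1) z by (simp add: m_assoc flip: sz)
    also have "\<dots> = p \<otimes> j \<oplus> (p \<otimes> r) \<otimes> y" using p(1) jc r y by algebra
    also have "\<dots> = (p \<otimes> j \<oplus> k \<otimes> y) \<oplus> l \<otimes> y [^] Suc n" unfolding pr ySn using p(1) jc kc l y yn by algebra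
    also have "\<dots> \<in> lin J (carrier R) (y [^] Suc n)"
      using J j k l y p(1) by (intro linI) (auto simp: ideal_ops)
    finally show "z \<in> sat (lin J (carrier R) (y [^] Suc n))"
      using mult_not_in[of p s] p s z by (intro satI[of _ "p \<otimes> s"]) auto
  qed
qed

text \<open>Generators are eliminated one at a time instead of by a determinant. With
  \<open>a\<close> adjoined to \<open>N\<close>, the induction hypothesis handles the others; so
  modulo \<open>N\<close> everything is locally a multiple of \<open>a\<close>, and \<open>a\<close>
  itself satisfies \<open>s a = k + q a\<close> with \<open>q \<in> Q\<close>.\<close>

lemma nakayama_finite:
  assumes Q: "ideal Q R" "Q \<subseteq> P"
  shows "finite Y \<Longrightarrow> Y \<subseteq> carrier R \<Longrightarrow> ideal N R \<Longrightarrow> Y \<subseteq> sat (N <+> ideal_prod R Q (Idl Y)) \<Longrightarrow> Y \<subseteq> sat N"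
proof (induction arbitrary: N rule: finite_induct)
  case (insert a Y)
  have ac: "a \<in> carrier R" and Yc: "Y \<subseteq> carrier R" using insert.prems by auto
  note N = insert.prems(2) and iY = genideal_ideal[OF Yc] and iZ = genideal_ideal[OF insert.prems(1)]
  note iM = lin_ideal[OF N oneideal ac] and iL = lin_ideal[OF N Q(1) ac]
  note iQY = ideal_prod_is_ideal[OF Q(1) iY] and iQZ = ideal_prod_is_ideal[OF Q(1) iZ]
  note iT = add_ideals[OF iM iQY]
  have "N <+> ideal_prod R Q (Idl (insert a Y)) \<subseteq> lin N (carrier R) a <+> ideal_prod R Q (Idl Y)"
  proof (rule set_add_least[OF iT])
    show "N \<subseteq> lin N (carrier R) a <+> ideal_prod R Q (Idl Y)"
      using lin_lower(1)[OF N oneideal ac] set_add_lower(1)[OF iM iQY] by blast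
    show "ideal_prod R Q (Idl (insert a Y)) \<subseteq> lin N (carrier R) a <+> ideal_prod R Q (Idl Y)"
    proof (rule ideal_prod_least[OF iT])
      fix q z assume q: "q \<in> Q" and z: "z \<in> Idl (insert a Y)"
      have qc: "q \<in> carrier R" using ideal.Icarr[OF Q(1) q] .
      obtain y r where y: "y \<in> Idl Y" and r: "r \<in> carrier R" and ze: "z = y \<oplus> r \<otimes> a"
        using z unfolding Idl_insert[OF Yc ac] by (rule linE)
      have yc: "y \<in> carrier R" using ideal.Icarr[OF iY y] .
      have "q \<otimes> z = (q \<otimes> r) \<otimes> a \<oplus> q \<otimes> y" unfolding ze using qc yc r ac by algebra
      then show "q \<otimes> z \<in> lin N (carrier R) a <+> ideal_prod R Q (Idl Y)"
        unfolding mem_set_add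
        using lin_lower(2)[OF N oneideal ac, of "q \<otimes> r"] ideal_prod.prod[OF q y] qc r by blast
    qed
  qed
  then have "Y \<subseteq> sat (lin N (carrier R) a <+> ideal_prod R Q (Idl Y))"
    using insert.prems(3) sat_mono by blast
  then have Ys: "Y \<subseteq> sat (lin N (carrier R) a)" using insert.IH[OF Yc iM] by blast
  moreover have "a \<in> sat (lin N (carrier R) a)" using generator_mem_lin[OF N ac] sat_upper[OF iM] by blast
  ultimately have Zs: "Idl (insert a Y) \<subseteq> sat (lin N (carrier R) a)"
    using genideal_minimal[OF ideal_sat[OF iM]] by blast
  have "N <+> ideal_prod R Q (Idl (insert a Y)) \<subseteq> sat (lin N Q a)"
  proof (rule set_add_least[OF ideal_sat[OF iL]])
    show "N \<subseteq> sat (lin N Q a)" using lin_lower(1)[OF N Q(1) ac] sat_upper[OF iL] by blast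
    show "ideal_prod R Q (Idl (insert a Y)) \<subseteq> sat (lin N Q a)"
    proof (rule ideal_prod_least[OF ideal_sat[OF iL]])
      fix q z assume q: "q \<in> Q" and z: "z \<in> Idl (insert a Y)"
      have qc: "q \<in> carrier R" using ideal.Icarr[OF Q(1) q] .
      from z Zs have "z \<in> sat (lin N (carrier R) a)" by blast
      then obtain s where zc: "z \<in> carrier R" and s: "s \<in> carrier R" "s \<notin> P" "s \<otimes> z \<in> lin N (carrier R) a"
        by (rule satE)
      obtain k r where k: "k \<in> N" and r: "r \<in> carrier R" and sz: "s \<otimes> z = k \<oplus> r \<otimes> a" by (rule linE[OF s(3)])
      have kc: "k \<in> carrier R" using ideal.Icarr[OF N k] .
      have "s \<otimes> (q \<otimes> z) = q \<otimes> (s \<otimes> z)" using s(1) qc zc by algebra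
      also have "\<dots> = q \<otimes> k \<oplus> (q \<otimes> r) \<otimes> a" unfolding sz using qc kc r ac by algebra
      also have "\<dots> \<in> lin N Q a" using N k qc q r Q(1) by (intro linI) (auto simp: ideal_ops)
      finally show "q \<otimes> z \<in> sat (lin N Q a)" using s qc zc by (intro satI[of _ s]) auto
    qed
  qed
  then have "a \<in> sat (sat (lin N Q a))" using insert.prems(3) sat_mono by blast
  then have "a \<in> sat (lin N Q a)" using sat_sat[OF iL] by simp
  then obtain s where s: "s \<in> carrier R" "s \<notin> P" "s \<otimes> a \<in> lin N Q a" by (rule satE)
  obtain k q where k: "k \<in> N" and q: "q \<in> Q" and sa: "s \<otimes> a = k \<oplus> q \<otimes> a" by (rule linE[OF s(3)])
  have kc: "k \<in> carrier R" and qc: "q \<in> carrier R" using ideal.Icarr[OF N k] ideal.Icarr[OF Q(1) q] by auto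
  have "(s \<ominus> q) \<otimes> a = s \<otimes> a \<ominus> q \<otimes> a" using s(1) qc ac by algebra
  also have "\<dots> = k" unfolding sa using kc qc ac by algebra
  finally have 1: "(s \<ominus> q) \<otimes> a \<in> N" using k by simp
  \<comment> \<open>\<open>s\<close> is outside \<open>P\<close> and \<open>q\<close> inside, so
    \<open>s - q\<close> is an admissible denominator: the unit of Nakayama's lemma.\<close>
  have "s \<ominus> q \<notin> P"
  proof
    assume "s \<ominus> q \<in> P"
    then have "(s \<ominus> q) \<oplus> q \<in> P" using q Q(2) by blast
    moreover have "(s \<ominus> q) \<oplus> q = s" using s(1) qc by algebra
    ultimately show False using s by simp
  qed
  then have aN: "a \<in> sat N" using 1 s qc ac by (intro satI[of _ "s \<ominus> q"]) auto
  then have "sat (lin N (carrier R) a) \<subseteq> sat N"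
    using sat_least[OF sat_idealI[OF N] lin_carrier_least[OF ideal_sat[OF N] sat_upper[OF N]]] by blast
  then show ?case using Ys aN by blast
qed simp

end

locale noetherian_localization = prime_localization P R + noetherian_ring R for P and R (structure)
begin

lemma nakayama:
  assumes "ideal Q R" "Q \<subseteq> P" and M: "ideal M R" and N: "ideal N R"
    and sub: "M \<subseteq> sat (N <+> ideal_prod R Q M)"
  shows "M \<subseteq> sat N"
proof -
  obtain Y where Y: "Y \<subseteq> carrier R" "finite Y" "M = Idl Y" using finetely_gen[OF M] by blast
  have "Y \<subseteq> sat N"
    using nakayama_finite[OF assms(1,2) Y(2,1) N] sub genideal_self[OF Y(1)] unfolding Y(3) by blast
  then show ?thesis unfolding Y(3) using genideal_minimal[OF ideal_sat[OF N]] by blast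
qed

text \<open>Locally \<open>P\<close> is the radical of \<open>J\<close>. An ideal maximal among
  those above \<open>J\<close> whose saturation contains no power of \<open>y\<close> is prime and
  lies in \<open>P\<close>; by minimality it equals \<open>P\<close>, which contains
  \<open>y\<close>.\<close>

lemma power_mem_sat:
  assumes J: "ideal J R" and y: "y \<in> carrier R" "y \<in> P"
    and min: "\<And>Q. primeideal Q R \<Longrightarrow> J \<subseteq> Q \<Longrightarrow> Q \<subseteq> P \<Longrightarrow> Q = P"
  shows "\<exists>n::nat. y [^] n \<in> sat J"
proof (rule ccontr)
  assume neg: "\<not> ?thesis"
  define \<A> where "\<A> = {Q. ideal Q R \<and> J \<subseteq> Q \<and> (\<forall>n::nat. y [^] n \<notin> sat Q)}"
  have JA: "J \<in> \<A>" using J neg unfolding \<A>_def by blast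
  have "\<exists>M\<in>\<A>. \<forall>K\<in>\<A>. M \<subseteq> K \<longrightarrow> K = M"
    by (rule ex_maximal_ideal_in) (use JA in \<open>auto simp: \<A>_def\<close>)
  then obtain M where M: "M \<in> \<A>" and max: "\<forall>K\<in>\<A>. M \<subseteq> K \<longrightarrow> K = M" by (rule bexE)
  have iM: "ideal M R" and JM: "J \<subseteq> M" and yM: "\<And>n::nat. y [^] n \<notin> sat M" using M unfolding \<A>_def by auto
  have big: "\<exists>n::nat. y [^] n \<in> sat (lin M (carrier R) a)" if a: "a \<in> carrier R" "a \<notin> M" for a
  proof (rule ccontr)
    assume "\<not> ?thesis"
    then have "lin M (carrier R) a \<in> \<A>"
      unfolding \<A>_def using lin_ideal[OF iM oneideal a(1)] JM lin_lower(1)[OF iM oneideal a(1)] by blast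
    then have "lin M (carrier R) a = M" using max lin_lower(1)[OF iM oneideal a(1)] by blast
    then show False using generator_mem_lin[OF iM a(1)] a by simp
  qed
  have "primeideal M R"
  proof (rule primeidealI[OF iM is_cring])
    show "carrier R \<noteq> M" using yM[of 0] sat_carrier by auto
    fix a b assume a: "a \<in> carrier R" and b: "b \<in> carrier R" and ab: "a \<otimes> b \<in> M"
    show "a \<in> M \<or> b \<in> M"
    proof (rule ccontr)
      assume "\<not> (a \<in> M \<or> b \<in> M)"
      then obtain n n' :: nat where n: "y [^] n \<in> sat (lin M (carrier R) a)"
        and n': "y [^] n' \<in> sat (lin M (carrier R) b)" using big a b by blast
      obtain s where s: "s \<in> carrier R" "s \<notin> P" "s \<otimes> y [^] n \<in> lin M (carrier R) a" using n by (rule satE)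
      obtain t where t: "t \<in> carrier R" "t \<notin> P" "t \<otimes> y [^] n' \<in> lin M (carrier R) b" using n' by (rule satE)
      obtain m r where m: "m \<in> M" "r \<in> carrier R" "s \<otimes> y [^] n = m \<oplus> r \<otimes> a" by (rule linE[OF s(3)])
      obtain m' r' where m': "m' \<in> M" "r' \<in> carrier R" "t \<otimes> y [^] n' = m' \<oplus> r' \<otimes> b" by (rule linE[OF t(3)])
      have mc: "m \<in> carrier R" "m' \<in> carrier R" using ideal.Icarr[OF iM] m m' by auto
      have yc: "y [^] n \<in> carrier R" "y [^] n' \<in> carrier R" using y by auto
      have "(s \<otimes> t) \<otimes> y [^] (n + n') = (s \<otimes> y [^] n) \<otimes> (t \<otimes> y [^] n')"
        using s(1) t(1) y yc by (simp add: nat_pow_mult[symmetric] m_ac)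
      also have "\<dots> = (m \<otimes> (m' \<oplus> r' \<otimes> b) \<oplus> r \<otimes> a \<otimes> m') \<oplus> r \<otimes> r' \<otimes> (a \<otimes> b)"
        unfolding m(3) m'(3) using mc m(2) m'(2) a b by algebra
      also have "\<dots> \<in> M" using iM m m' mc a b ab by (simp add: ideal_ops)
      finally have "y [^] (n + n') \<in> sat M" using mult_not_in[of s t] s t y by (intro satI[of _ "s \<otimes> t"]) auto
      then show False using yM by blast
    qed
  qed
  \<comment> \<open>An element of \<open>M\<close> outside \<open>P\<close> would put
    \<open>\<one> = y [^] 0\<close> into \<open>sat M\<close>.\<close>
  moreover have "M \<subseteq> P"
  proof
    fix a assume "a \<in> M"
    then have "\<one> \<in> sat M" if "a \<notin> P" using that ideal.Icarr[OF iM] by (intro satI[of _ a]) auto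
    then show "a \<in> P" using yM[of 0] by auto
  qed
  ultimately have "M = P" using min JM by blast
  then have "y [^] (1::nat) \<in> sat M" using y sat_upper[OF iM] by auto
  then show False using yM by blast
qed

end

section \<open>Regular sequences and Krull's principal ideal theorem\<close>

lemma (in cring) pow_mem_ideal_mono:
  assumes "ideal K R" "y \<in> carrier R" "y [^] (n::nat) \<in> K" "n \<le> N" shows "y [^] N \<in> K"
proof -
  have "y [^] N = y [^] (N - n) \<otimes> y [^] n" using assms by (simp add: nat_pow_mult)
  then show ?thesis using ideal.I_l_closed[OF assms(1,3)] assms(2) by simp
qed

lemma (in cring) common_power:
  assumes K: "ideal K R"
  shows "finite Y \<Longrightarrow> Y \<subseteq> carrier R \<Longrightarrow> \<forall>y\<in>Y. \<exists>n::nat. y [^] n \<in> K \<Longrightarrow> \<exists>N::nat. \<forall>y\<in>Y. y [^] N \<in> K"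
proof (induction rule: finite_induct)
  case (insert a Y)
  obtain N where N: "\<forall>y\<in>Y. y [^] (N::nat) \<in> K" using insert.IH insert.prems by auto
  obtain n where n: "a [^] (n::nat) \<in> K" using insert.prems by auto
  have "\<forall>y\<in>insert a Y. y [^] (max n N) \<in> K"
    using pow_mem_ideal_mono[OF K] N n insert.prems(1) by (metis insert_iff max.cobounded1 max.cobounded2 subsetD)
  then show ?case by blast
qed simp

context prime_localization
begin

text \<open>Starting from \<open>R / P\<close> of length one, raising one more generator to the
  power \<open>n\<close> multiplies the bound by \<open>n\<close>. This holds for any finite set
  generating \<open>P\<close> locally, and is used in that generality in
  \<open>minimal_prime_wser\<close>.\<close>

lemma wser_generators:
  assumes X: "finite X" "X \<subseteq> carrier R" and gen: "P = sat (Idl X)" and UX: "U \<subseteq> X"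
  shows "wser (n ^ card U) (sat (Idl ((\<lambda>x. x [^] n) ` U \<union> (X - U)))) (carrier R)"
proof -
  have "finite U" using X UX finite_subset by blast
  then show ?thesis using UX
  proof (induction rule: finite_induct)
    case empty
    then show ?case using wser_prime_carrier by (simp flip: gen)
  next
    case (insert y U)
    define T where "T = (\<lambda>x. x [^] n) ` U \<union> (X - insert y U)"
    have T: "T \<subseteq> carrier R" and y: "y \<in> carrier R" "y [^] n \<in> carrier R"
      unfolding T_def using X insert.prems by auto
    have 1: "(\<lambda>x. x [^] n) ` U \<union> (X - U) = insert y T" unfolding T_def using insert by auto
    have 2: "(\<lambda>x. x [^] n) ` (insert y U) \<union> (X - insert y U) = insert (y [^] n) T"
      unfolding T_def using insert by auto
    have "wser (n ^ card U) (sat (lin (Idl T) (carrier R) y)) (carrier R)"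
      using insert.IH insert.prems unfolding 1 Idl_insert[OF T y(1)] by simp
    then show ?case unfolding 2 Idl_insert[OF T y(2)]
      using wser_power[OF genideal_ideal[OF T] y(1), of _ n] insert.hyps by simp
  qed
qed

text \<open>By \<open>nz\<close> the next generator \<open>y\<close> is a nonzerodivisor modulo the
  powers already formed and the other unraised generators; so each exchange multiplies the lower
  bound by \<open>n\<close> as well.\<close>

lemma schain_generators:
  assumes X: "finite X" "X \<subseteq> carrier R" and gen: "P = sat (Idl X)" and UX: "U \<subseteq> X"
    and nz: "\<And>U y. U \<subseteq> X \<Longrightarrow> y \<in> X - U \<Longrightarrow> nzd y (sat (Idl ((\<lambda>x. x [^] n) ` U \<union> (X - insert y U))))"
  shows "schain (n ^ card U) (sat (Idl ((\<lambda>x. x [^] n) ` U \<union> (X - U)))) (carrier R)"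
proof -
  have "finite U" using X UX finite_subset by blast
  then show ?thesis using UX
  proof (induction rule: finite_induct)
    case empty
    then show ?case using schain_prime_carrier by (simp flip: gen)
  next
    case (insert y U)
    define T where "T = (\<lambda>x. x [^] n) ` U \<union> (X - insert y U)"
    have T: "T \<subseteq> carrier R" and y: "y \<in> carrier R" "y [^] n \<in> carrier R"
      unfolding T_def using X insert.prems by auto
    have 1: "(\<lambda>x. x [^] n) ` U \<union> (X - U) = insert y T" unfolding T_def using insert by auto
    have 2: "(\<lambda>x. x [^] n) ` (insert y U) \<union> (X - insert y U) = insert (y [^] n) T"
      unfolding T_def using insert by auto
    have "nzd y (sat (Idl T))" using nz[of U y] insert unfolding T_def by simp
    moreover have "schain (n ^ card U) (sat (lin (Idl T) (carrier R) y)) (carrier R)"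
      using insert.IH insert.prems unfolding 1 Idl_insert[OF T y(1)] by simp
    ultimately show ?case unfolding 2 Idl_insert[OF T y(2)]
      using schain_power[OF genideal_ideal[OF T] y(1), of _ n] insert.hyps by simp
  qed
qed

text \<open>The powers are introduced one generator at a time, starting from the prime ideals \<open>sat (Idl V)\<close>.\<close>

lemma nzd_generators:
  assumes X: "X \<subseteq> carrier R" "finite X"
    and pr: "\<And>V. V \<subseteq> X \<Longrightarrow> primeideal (sat (Idl V)) R"
    and nin: "\<And>V x. V \<subseteq> X \<Longrightarrow> x \<in> X - V \<Longrightarrow> x \<notin> sat (Idl V)"
    and U: "U \<subseteq> X"
  shows "V \<subseteq> X - U \<Longrightarrow> x \<in> X - U - V \<Longrightarrow> nzd x (sat (Idl ((\<lambda>x. x [^] (n::nat)) ` U \<union> V)))"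
proof -
  have "finite U" using X U finite_subset by blast
  then have "U \<subseteq> X \<longrightarrow> (\<forall>V x. V \<subseteq> X - U \<longrightarrow> x \<in> X - U - V \<longrightarrow> nzd x (sat (Idl ((\<lambda>x. x [^] n) ` U \<union> V))))"
  proof (induction rule: finite_induct)
    case empty
    have "nzd x (sat (Idl V))" if V: "V \<subseteq> X" and x: "x \<in> X - V" for V x
      using primeideal.I_prime[OF pr[OF V], of x] nin[OF V x] x X unfolding nzd_def by blast
    then show ?case by simp
  next
    case (insert y U)
    show ?case
    proof (intro impI allI)
      fix V x assume UX: "insert y U \<subseteq> X" and V: "V \<subseteq> X - insert y U" and x: "x \<in> X - insert y U - V"
      define T where "T = (\<lambda>x. x [^] n) ` U \<union> V"
      have T: "T \<subseteq> carrier R" and y: "y \<in> carrier R" "y [^] n \<in> carrier R" and xc: "x \<in> carrier R"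
        unfolding T_def using X UX V x by auto
      have IH: "nzd z (sat (Idl ((\<lambda>x. x [^] n) ` U \<union> W)))" if "W \<subseteq> X - U" "z \<in> X - U - W" for W z
        using insert.IH UX that by blast
      have "nzd y (sat (Idl T))" unfolding T_def using UX V insert.hyps by (intro IH) auto
      moreover have "nzd x (sat (Idl ((\<lambda>x. x [^] n) ` U \<union> insert y V)))"
        using UX V insert.hyps x by (intro IH) auto
      then have "nzd x (sat (lin (Idl T) (carrier R) y))"
        using Idl_insert[OF T y(1)] unfolding T_def by simp
      ultimately have "nzd x (sat (lin (Idl T) (carrier R) (y [^] n)))"
        using nzd_lin_power[OF genideal_ideal[OF T] xc y(1)] by blast
      then show "nzd x (sat (Idl ((\<lambda>x. x [^] n) ` insert y U \<union> V)))"
        using Idl_insert[OF T y(2)] unfolding T_def by simp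
    qed
  qed
  then show "V \<subseteq> X - U \<Longrightarrow> x \<in> X - U - V \<Longrightarrow> nzd x (sat (Idl ((\<lambda>x. x [^] (n::nat)) ` U \<union> V)))"
    using U by blast
qed

lemma schain_descending:
  assumes "\<And>i. sat_ideal (f i)" "\<And>i::nat. f (Suc i) \<subset> f i"
  shows "schain k (f k) (f 0)"
proof (induction k)
  case (Suc k)
  have "schain 1 (f (Suc k)) (f k)"
    using schain.snoc[OF schain.refl[OF assms(1)] assms(2) assms(1)] by simp
  then show ?case using schain_trans[OF Suc.IH] by fastforce
qed (rule schain.refl[OF assms(1)])

lemma wser_above:
  assumes "wser n C (carrier R)" "C \<subseteq> J" "J \<subseteq> K" "sat_ideal J" "sat_ideal K"
  shows "\<exists>m\<le>n. wser m J K"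
proof -
  have Kc: "K \<subseteq> carrier R" using ideal_subset_carrier sat_ideal_ideal assms(5) by blast
  obtain a b where "a + b = n" "wser b J (carrier R)"
    using wser_split[OF assms(1,2) _ assms(4)] assms(3) Kc by blast
  moreover obtain c d where "c + d = b" "wser c J K"
    using wser_split[OF \<open>wser b J (carrier R)\<close> assms(3) Kc assms(5)] by blast
  ultimately show ?thesis by (intro exI[of _ c]) auto
qed

text \<open>Finite length gives the descending chain condition: otherwise \<open>f 0\<close> to
  \<open>f (Suc n)\<close> form a chain of \<open>Suc n\<close> strict inclusions, one more than a
  series of length \<open>n\<close> allows.\<close>

lemma descending_stabilizes:
  assumes C: "wser n C (carrier R)" and f: "\<And>i. sat_ideal (f i)" "\<And>i::nat. f (Suc i) \<subseteq> f i" "\<And>i. C \<subseteq> f i"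
  shows "\<exists>i. f (Suc i) = f i"
proof (rule ccontr)
  assume "\<not> ?thesis"
  then have s: "\<And>i. f (Suc i) \<subset> f i" using f(2) by blast
  have sc: "schain (Suc n) (f (Suc n)) (f 0)" using schain_descending[of f, OF f(1) s] .
  then have "f (Suc n) \<subseteq> f 0" using schain_sat_ideal by blast
  then obtain m where "m \<le> n" "wser m (f (Suc n)) (f 0)" using wser_above[OF C f(3) _ f(1) f(1)] by blast
  then show False using schain_le_wser[OF sc] by fastforce
qed

end

context noetherian_localization
begin

text \<open>Locally at \<open>P\<close>, the ring \<open>R / J\<close> has finite length: some power
  of each generator of \<open>P\<close> lies in \<open>sat J\<close>, and a common exponent gives
  the bound.\<close>

lemma minimal_prime_wser:
  assumes J: "ideal J R" and min: "\<And>Q. primeideal Q R \<Longrightarrow> J \<subseteq> Q \<Longrightarrow> Q \<subseteq> P \<Longrightarrow> Q = P"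
  shows "\<exists>n C. wser n C (carrier R) \<and> C \<subseteq> sat J"
proof -
  obtain Y where Y: "Y \<subseteq> carrier R" "finite Y" "P = Idl Y" using finetely_gen[OF is_ideal] by blast
  have gen: "P = sat (Idl Y)" using sat_ideal_eq[OF sat_ideal_prime[OF primeideal subset_refl]] Y(3) by simp
  have "\<exists>n::nat. y [^] n \<in> sat J" if "y \<in> Y" for y
  proof -
    have "y \<in> P" using that genideal_self[OF Y(1)] Y(3) by blast
    then show ?thesis using power_mem_sat[OF J _ _ min] Icarr by blast
  qed
  then obtain N where N: "\<forall>y\<in>Y. y [^] (N::nat) \<in> sat J" using common_power[OF ideal_sat[OF J] Y(2,1)] by blast
  have "wser (N ^ card Y) (sat (Idl ((\<lambda>x. x [^] N) ` Y))) (carrier R)"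
    using wser_generators[OF Y(2,1) gen subset_refl, of N] by simp
  moreover have "(\<lambda>x. x [^] N) ` Y \<subseteq> sat J" using N by blast
  then have "sat (Idl ((\<lambda>x. x [^] N) ` Y)) \<subseteq> sat J"
    using sat_least[OF sat_idealI[OF J]] genideal_minimal[OF ideal_sat[OF J]] by blast
  ultimately show ?thesis by blast
qed

text \<open>This is Krull's principal ideal theorem; the sets \<open>F n\<close> are the symbolic powers of \<open>P1\<close>
  modulo \<open>P0\<close>.\<close>

lemma prime_chain_through_element:
  assumes P0: "primeideal P0 R" and P1: "primeideal P1 R" and lt: "P0 \<subset> P1" "P1 \<subset> P" and x: "x \<in> P"
  shows "\<exists>Q. primeideal Q R \<and> P0 \<subset> Q \<and> Q \<subset> P \<and> x \<in> Q"
proof (rule ccontr)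
  assume neg: "\<not> ?thesis"
  have xc: "x \<in> carrier R" using x Icarr by blast
  have xP1: "x \<notin> P1" using neg P1 lt by blast
  have xP0: "x \<notin> P0" using xP1 lt by blast
  interpret P1: prime_localization P1 R using P1 by (simp add: prime_localization_def)
  interpret P1: noetherian_localization P1 R by unfold_locales
  note i0 = primeideal.axioms(1)[OF P0] and i1 = primeideal.axioms(1)[OF P1]
  define J where "J = lin P0 (carrier R) x"
  have J: "ideal J R" "P0 \<subseteq> J" "x \<in> J"
    unfolding J_def using lin_ideal[OF i0 oneideal xc] lin_lower(1)[OF i0 oneideal xc]
      generator_mem_lin[OF i0 xc] by auto
  \<comment> \<open>By \<open>neg\<close>, \<open>P\<close> is minimal over
    \<open>J = P0 + (x)\<close>, so \<open>R / J\<close> has finite length at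
    \<open>P\<close>.\<close>
  have "Q = P" if Q: "primeideal Q R" "J \<subseteq> Q" "Q \<subseteq> P" for Q
    using neg Q J xP0 by blast
  then obtain n C where C: "wser n C (carrier R)" "C \<subseteq> sat J" using minimal_prime_wser[OF J(1)] by blast
  define N where "N n = ((ideal_prod R P1) ^^ n) (carrier R)" for n
  have iN: "ideal (N n) R" for n
    unfolding N_def by (induction n) (auto intro: oneideal ideal_prod_is_ideal i1)
  have NS: "N (Suc n) = ideal_prod R P1 (N n)" for n unfolding N_def by simp
  have iNP: "ideal (P0 <+> N n) R" for n using add_ideals[OF i0 iN] .
  define F where "F n = P1.sat (P0 <+> N n)" for n
  have sF: "P1.sat_ideal (F n)" for n unfolding F_def by (rule P1.sat_idealI[OF iNP])
  note iF = P1.sat_ideal_ideal[OF sF]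
  have sub: "P0 <+> N n \<subseteq> F n" for n unfolding F_def by (rule P1.sat_upper[OF iNP])
  have P0F: "P0 \<subseteq> F n" and NF: "N n \<subseteq> F n" for n
    using sub[of n] set_add_lower[OF i0 iN[of n]] by auto
  have "N (Suc n) \<subseteq> N n" for n unfolding NS using ideal_prod_inter[OF i1 iN[of n]] by blast
  then have "P0 <+> N (Suc n) \<subseteq> P0 <+> N n" for n unfolding set_add_def' by blast
  then have dF: "F (Suc n) \<subseteq> F n" for n unfolding F_def by (rule P1.sat_mono)
  note iG = lin_ideal[OF iF oneideal xc]
  \<comment> \<open>Adding \<open>x\<close> puts the symbolic powers above \<open>J\<close>, where
    the descending chain condition at \<open>P\<close> applies.\<close>
  have "\<exists>i. sat (lin (F (Suc i)) (carrier R) x) = sat (lin (F i) (carrier R) x)"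
  proof (rule descending_stabilizes[OF C(1)])
    show "sat_ideal (sat (lin (F i) (carrier R) x))" for i by (rule sat_idealI[OF iG])
    show "sat (lin (F (Suc i)) (carrier R) x) \<subseteq> sat (lin (F i) (carrier R) x)" for i
      using dF by (intro sat_mono lin_mono) auto
    show "C \<subseteq> sat (lin (F i) (carrier R) x)" for i
      using C(2) sat_mono[of J "lin (F i) (carrier R) x"] lin_mono[OF P0F subset_refl]
      unfolding J_def by blast
  qed
  then obtain i where i: "sat (lin (F (Suc i)) (carrier R) x) = sat (lin (F i) (carrier R) x)" ..
  have iX: "ideal (PIdl x) R" using cgenideal_ideal[OF xc] .
  have XP: "PIdl x \<subseteq> P" using cgenideal_minimal[OF is_ideal x] .
  note iXF = ideal_prod_is_ideal[OF iX iF]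
  note iT = add_ideals[OF iF iXF]
  \<comment> \<open>The multiple \<open>x c\<close> that occurs lies in \<open>F i\<close>; since
    \<open>x \<notin> P1\<close> and \<open>F i\<close> is saturated at \<open>P1\<close>, so does
    \<open>c\<close>. Nakayama at \<open>P\<close> then removes the summand
    \<open>x F i\<close>.\<close>
  have "F i \<subseteq> sat (F (Suc i) <+> ideal_prod R (PIdl x) (F i))"
  proof
    fix a assume a: "a \<in> F i"
    then have "a \<in> sat (lin (F (Suc i)) (carrier R) x)"
      using i lin_lower(1)[OF iF oneideal xc] sat_upper[OF iG] by blast
    then obtain s where ac: "a \<in> carrier R" and s: "s \<in> carrier R" "s \<notin> P" "s \<otimes> a \<in> lin (F (Suc i)) (carrier R) x"
      by (rule satE)
    obtain b c where b: "b \<in> F (Suc i)" and c: "c \<in> carrier R" and sa: "s \<otimes> a = b \<oplus> c \<otimes> x"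
      by (rule linE[OF s(3)])
    have bc: "b \<in> carrier R" using ideal.Icarr[OF iF b] .
    have "x \<otimes> c = (b \<oplus> c \<otimes> x) \<ominus> b" using bc c xc by algebra
    also have "\<dots> = s \<otimes> a \<ominus> b" unfolding sa ..
    also have "\<dots> \<in> F i" using iF[of i] a b dF[of i] s(1) ac bc by (meson ideal.I_l_closed minus_closed_ideal subsetD)
    finally have "x \<otimes> c \<in> F i" .
    then have "c \<in> F i" using P1.sat_idealD[OF sF xc xP1 c] by blast
    then have "x \<otimes> c \<in> ideal_prod R (PIdl x) (F i)" using ideal_prod.prod cgenideal_self[OF xc] by metis
    then have "s \<otimes> a \<in> F (Suc i) <+> ideal_prod R (PIdl x) (F i)"
      unfolding sa mem_set_add using b m_comm[OF c xc] by metis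
    then show "a \<in> sat (F (Suc i) <+> ideal_prod R (PIdl x) (F i))" using s ac by (intro satI[of _ s])
  qed
  then have "F i \<subseteq> sat (F (Suc i))" using nakayama[OF iX XP iF iF] by blast
  moreover have "sat (F (Suc i)) \<subseteq> P1.sat (F (Suc i))" unfolding sat_def P1.sat_def using lt(2) by blast
  ultimately have "F i \<subseteq> F (Suc i)" using P1.sat_ideal_eq[OF sF] by blast
  then have "N i \<subseteq> P1.sat (P0 <+> ideal_prod R P1 (N i))" using NF[of i] unfolding F_def NS by blast
  then have "N i \<subseteq> P1.sat P0" using P1.nakayama[OF i1 subset_refl iN i0] by blast
  then have "N i \<subseteq> P0" using P1.sat_ideal_eq[OF P1.sat_ideal_prime[OF P0]] lt(1) by blast
  \<comment> \<open>Primality of \<open>P0\<close> strips the factors \<open>P1\<close> one by one,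
    down to \<open>N 0 = carrier R\<close>.\<close>
  then have "N m \<subseteq> P0 \<Longrightarrow> m \<le> i \<Longrightarrow> carrier R \<subseteq> P0" for m
  proof (induction m)
    case 0
    then show ?case unfolding N_def by simp
  next
    case (Suc m)
    have "\<not> P1 \<subseteq> P0" using lt by blast
    then have "N m \<subseteq> P0" using primeideal_divides_ideal_prod[OF P0 i1 iN] Suc.prems(1) unfolding NS by blast
    then show ?case using Suc by simp
  qed
  then have "carrier R \<subseteq> P0" using \<open>N i \<subseteq> P0\<close> by blast
  then show False using lt Icarr by blast
qed

end

section \<open>Chains of primes\<close>

locale noetherian_cring = cring R + noetherian_ring R for R (structure)
begin

lemma noetherian_localization: "primeideal P R \<Longrightarrow> noetherian_localization P R"
  by (simp add: noetherian_localization_def prime_localization_def noetherian_ring_axioms)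

text \<open>Chains of primes of \<open>R / J\<close> ending in a given top. The bottom prime only
  has to contain \<open>J\<close>, and the top is an argument, because the dimension arguments
  enlarge \<open>J\<close> and keep the top.\<close>

inductive prime_chain :: "'a set \<Rightarrow> nat \<Rightarrow> 'a set \<Rightarrow> bool" for J where
  base: "primeideal P R \<Longrightarrow> J \<subseteq> P \<Longrightarrow> prime_chain J 0 P"
| snoc: "prime_chain J n P \<Longrightarrow> P \<subset> P' \<Longrightarrow> primeideal P' R \<Longrightarrow> prime_chain J (Suc n) P'"

lemma prime_chain_top: "prime_chain J n P \<Longrightarrow> primeideal P R \<and> J \<subseteq> P"
  by (induction rule: prime_chain.induct) auto

lemma prime_chain_SucE:
  assumes "prime_chain J (Suc n) P"
  obtains P' where "prime_chain J n P'" "P' \<subset> P" "primeideal P R"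
  using assms by (rule prime_chain.cases) auto

lemma prime_chain_mono: "prime_chain K n P \<Longrightarrow> J \<subseteq> K \<Longrightarrow> prime_chain J n P"
proof (induction rule: prime_chain.induct)
  case (base P)
  then show ?case by (intro prime_chain.base) auto
next
  case (snoc n P P')
  then show ?case by (intro prime_chain.snoc[of J n P P'])
qed

lemma prime_chain_bottom:
  "prime_chain J n P \<Longrightarrow> \<exists>P0. primeideal P0 R \<and> J \<subseteq> P0 \<and> prime_chain P0 n P"
proof (induction rule: prime_chain.induct)
  case (base P)
  then show ?case using prime_chain.base[OF base(1) subset_refl] by blast
next
  case (snoc n P P')
  then show ?case using prime_chain.snoc by metis
qed

text \<open>Dividing by one more element lowers the dimension by at most one. Krull's theorem
  replaces the prime just below the top by one containing \<open>x\<close>; this pushes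
  \<open>x\<close> down the chain until only the bottom prime is lost.\<close>

lemma prime_chain_lin:
  assumes J: "ideal J R"
  shows "prime_chain J (Suc n) P \<Longrightarrow> x \<in> P \<Longrightarrow> prime_chain (lin J (carrier R) x) n P"
proof (induction n arbitrary: P)
  case 0
  have "primeideal P R" "J \<subseteq> P" using prime_chain_top[OF 0(1)] by auto
  then show ?case
    using lin_carrier_least[OF primeideal.axioms(1)] 0(2) by (intro prime_chain.base) auto
next
  case (Suc n)
  obtain P1 where P1: "prime_chain J (Suc n) P1" "P1 \<subset> P" "primeideal P R"
    using Suc.prems(1) by (rule prime_chain_SucE)
  obtain P0 where P0: "prime_chain J n P0" "P0 \<subset> P1" "primeideal P1 R" using P1(1) by (rule prime_chain_SucE)
  obtain Q where Q: "primeideal Q R" "P0 \<subset> Q" "Q \<subset> P" "x \<in> Q"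
    using noetherian_localization.prime_chain_through_element[OF noetherian_localization[OF P1(3)]
        _ P0(3,2) P1(2) Suc.prems(2)] prime_chain_top[OF P0(1)] by blast
  have "prime_chain (lin J (carrier R) x) n Q"
    using Suc.IH[OF prime_chain.snoc[OF P0(1) Q(2,1)] Q(4)] .
  then show ?case using prime_chain.snoc[OF _ Q(3) P1(3)] by blast
qed

lemma Idl_empty: "Idl {} = {\<zero>}"
  using genideal_minimal[OF zeroideal, of "{}"] zero_mem_ideal[OF genideal_ideal, of "{}"] by auto

lemma prime_chain_Idl:
  "finite V \<Longrightarrow> V \<subseteq> P \<Longrightarrow> prime_chain {\<zero>} (card V + n) P \<Longrightarrow> prime_chain (Idl V) n P"
proof (induction arbitrary: n rule: finite_induct)
  case (insert x V)
  have "P \<subseteq> carrier R" using prime_chain_top[OF insert.prems(2)] ideal_subset_carrier primeideal.axioms(1) by blast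
  then have V: "V \<subseteq> carrier R" "x \<in> carrier R" using insert.prems by auto
  have "prime_chain {\<zero>} (card V + Suc n) P" using insert by simp
  then have "prime_chain (Idl V) (Suc n) P" using insert by simp
  then have "prime_chain (lin (Idl V) (carrier R) x) n P"
    using prime_chain_lin[OF genideal_ideal[OF V(1)]] insert.prems by blast
  then show ?case using Idl_insert[OF V] by simp
qed (simp add: Idl_empty)

lemma set_add_Idl_insert:
  assumes J: "ideal J R" and X: "X \<subseteq> carrier R" "x \<in> carrier R"
  shows "J <+> Idl (insert x X) \<subseteq> lin J (carrier R) x <+> Idl X"
proof (rule set_add_least)
  note i = lin_ideal[OF J oneideal X(2)] and iX = genideal_ideal[OF X(1)]
  show i2: "ideal (lin J (carrier R) x <+> Idl X) R" using add_ideals[OF i iX] .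
  note l = set_add_lower[OF i iX]
  show "J \<subseteq> lin J (carrier R) x <+> Idl X" using lin_lower(1)[OF J oneideal X(2)] l by blast
  show "Idl (insert x X) \<subseteq> lin J (carrier R) x <+> Idl X"
    using generator_mem_lin[OF J X(2)] l genideal_self[OF X(1)] by (intro genideal_minimal[OF i2]) auto
qed

end

context noetherian_localization
begin

sublocale noetherian_cring by unfold_locales

lemma set_add_zero_Idl: assumes "ideal J R" shows "J <+> Idl {} = J"
  using set_add_lower(1)[OF assms zeroideal] set_add_least[OF assms subset_refl, of "{\<zero>}"]
    zero_mem_ideal[OF assms] by (auto simp: Idl_empty)

text \<open>Krull's height theorem.\<close>

lemma prime_chain_le_card:
  "finite X \<Longrightarrow> X \<subseteq> P \<Longrightarrow> ideal J R \<Longrightarrow> prime_chain J n P \<Longrightarrow> P \<subseteq> sat (J <+> Idl X) \<Longrightarrow> n \<le> card X"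
proof (induction arbitrary: J n rule: finite_induct)
  case empty
  show ?case
  proof (cases n)
    case (Suc k)
    obtain P' where P': "prime_chain J k P'" "P' \<subset> P" using empty.prems(3) Suc prime_chain_SucE by metis
    then have "sat J \<subseteq> P'" using sat_least[OF sat_ideal_prime] prime_chain_top by blast
    then show ?thesis using empty.prems(2,4) P'(2) set_add_zero_Idl by auto
  qed simp
next
  case (insert x X)
  show ?case
  proof (cases n)
    case (Suc k)
    have X: "X \<subseteq> carrier R" "x \<in> carrier R" "x \<in> P" using insert.prems Icarr by auto
    have "prime_chain (lin J (carrier R) x) k P"
      using prime_chain_lin[OF insert.prems(2)] insert.prems(3) Suc X(3) by blast
    moreover have "P \<subseteq> sat (lin J (carrier R) x <+> Idl X)"
      using insert.prems(4) sat_mono[OF set_add_Idl_insert[OF insert.prems(2) X(1,2)]] by blast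
    ultimately have "k \<le> card X"
      using insert.IH[of "lin J (carrier R) x" k] insert.prems lin_ideal[OF insert.prems(2) oneideal X(2)] by simp
    then show ?thesis using Suc insert.hyps by simp
  qed simp
qed

lemma prime_chain_prepend:
  assumes Q: "primeideal Q R" "Q \<subset> sat K"
  shows "prime_chain K n P1 \<Longrightarrow> P1 \<subseteq> P \<Longrightarrow> prime_chain Q (Suc n) P1"
proof (induction rule: prime_chain.induct)
  case (base P1)
  have "Q \<subset> P1" using sat_least[OF sat_ideal_prime[OF base(1,3)] base(2)] Q(2) by blast
  then show ?case using prime_chain.snoc[OF prime_chain.base[OF Q(1) subset_refl] _ base(1)] by blast
next
  case (snoc n P1 P2)
  then show ?case using prime_chain.snoc[of Q "Suc n" P1 P2] by blast
qed

text \<open>The heart of the proof that a regular local ring is a domain, applied to \<open>R / J\<close>.\<close>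

lemma prime_sat_if_chain:
  "finite X \<Longrightarrow> card X = n \<Longrightarrow> X \<subseteq> P \<Longrightarrow> ideal J R \<Longrightarrow> prime_chain J n P \<Longrightarrow> P \<subseteq> sat (J <+> Idl X) \<Longrightarrow>
    primeideal (sat J) R"
proof (induction n arbitrary: J X)
  case 0
  have "P \<subseteq> sat J" using 0 set_add_zero_Idl by simp
  moreover have "sat J \<subseteq> P"
    using sat_least[OF sat_ideal_prime[OF primeideal subset_refl]] prime_chain_top[OF 0(5)] by blast
  ultimately show ?case using primeideal by simp
next
  case (Suc n)
  note J = Suc.prems(4)
  obtain P0 where P0: "primeideal P0 R" "J \<subseteq> P0" and ch: "prime_chain P0 (Suc n) P"
    using prime_chain_bottom[OF Suc.prems(5)] by blast
  note i0 = primeideal.axioms(1)[OF P0(1)]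
  obtain P' where "prime_chain P0 n P'" "P' \<subset> P" using ch by (rule prime_chain_SucE)
  then have P0P: "P0 \<subset> P" using prime_chain_top by blast
  have s0: "sat_ideal P0" using sat_ideal_prime[OF P0(1)] P0P by blast
  \<comment> \<open>Some generator leaves the bottom prime. It becomes the element to divide out,
    and the remaining \<open>n\<close> generators feed the induction hypothesis.\<close>
  have "\<not> X \<subseteq> P0"
  proof
    assume "X \<subseteq> P0"
    then have "J <+> Idl X \<subseteq> P0" using set_add_least[OF i0 P0(2) genideal_minimal[OF i0]] by blast
    then have "P \<subseteq> P0" using Suc.prems(6) sat_least[OF s0] by blast
    then show False using P0P by blast
  qed
  then obtain x where x: "x \<in> X" "x \<notin> P0" by blast
  define Y where "Y = X - {x}"
  have Y: "X = insert x Y" "x \<notin> Y" "finite Y" "card Y = n" "Y \<subseteq> P" "x \<in> P" "x \<in> carrier R" "Y \<subseteq> carrier R"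
    unfolding Y_def using x Suc.prems Icarr by auto
  note iJx = lin_ideal[OF J oneideal Y(7)] and i0x = lin_ideal[OF i0 oneideal Y(7)]
  have J0: "lin J (carrier R) x \<subseteq> lin P0 (carrier R) x" using P0(2) by (intro lin_mono) auto
  have PJ: "P \<subseteq> sat (lin J (carrier R) x <+> Idl Y)"
    using Suc.prems(6) sat_mono[OF set_add_Idl_insert[OF J Y(8,7)]] unfolding Y(1) by blast
  have P0': "P \<subseteq> sat (lin P0 (carrier R) x <+> Idl Y)"
    using PJ J0 sat_mono[of "lin J (carrier R) x <+> Idl Y" "lin P0 (carrier R) x <+> Idl Y"]
    unfolding set_add_def' by blast
  have chJ: "prime_chain (lin J (carrier R) x) n P" using prime_chain_lin[OF J Suc.prems(5) Y(6)] .
  have ch0: "prime_chain (lin P0 (carrier R) x) n P" using prime_chain_lin[OF i0 ch Y(6)] .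
  have prJ: "primeideal (sat (lin J (carrier R) x)) R" using Suc.IH[OF Y(3-5) iJx chJ PJ] .
  \<comment> \<open>The left side is prime by induction. Were it strictly smaller, it could be
    prepended to the chain above \<open>P0 + (x)\<close>, giving \<open>Suc n\<close> inclusions
    against only \<open>n\<close> generators.\<close>
  have "sat (lin J (carrier R) x) = sat (lin P0 (carrier R) x)"
  proof (rule ccontr)
    assume "sat (lin J (carrier R) x) \<noteq> sat (lin P0 (carrier R) x)"
    then have "sat (lin J (carrier R) x) \<subset> sat (lin P0 (carrier R) x)" using sat_mono[OF J0] by blast
    then have "prime_chain (sat (lin J (carrier R) x)) (Suc n) P"
      using prime_chain_prepend[OF prJ _ ch0 subset_refl] by blast
    then have "prime_chain (lin J (carrier R) x) (Suc n) P" using prime_chain_mono sat_upper[OF iJx] by blast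
    then show False using prime_chain_le_card[OF Y(3,5) iJx _ PJ] Y(4) by fastforce
  qed
  then have sub: "P0 \<subseteq> sat (lin J (carrier R) x)" using lin_lower(1)[OF i0 oneideal Y(7)] sat_upper[OF i0x] by blast
  have iX: "ideal (PIdl x) R" "PIdl x \<subseteq> P" using cgenideal_ideal[OF Y(7)] cgenideal_minimal[OF is_ideal Y(6)] by auto
  \<comment> \<open>Modulo \<open>J\<close>, an element of \<open>P0\<close> is locally a multiple
    of \<open>x\<close>, and since \<open>x \<notin> P0\<close> the cofactor is again in
    \<open>P0\<close>. Nakayama then yields \<open>P0 \<subseteq> sat J\<close>.\<close>
  have "P0 \<subseteq> sat (J <+> ideal_prod R (PIdl x) P0)"
  proof
    fix a assume a: "a \<in> P0"
    with sub have "a \<in> sat (lin J (carrier R) x)" by blast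
    then obtain s where ac: "a \<in> carrier R" and s: "s \<in> carrier R" "s \<notin> P" "s \<otimes> a \<in> lin J (carrier R) x"
      by (rule satE)
    obtain j r where j: "j \<in> J" and r: "r \<in> carrier R" and sa: "s \<otimes> a = j \<oplus> r \<otimes> x" by (rule linE[OF s(3)])
    have jc: "j \<in> carrier R" using ideal.Icarr[OF J j] .
    have "x \<otimes> r = (j \<oplus> r \<otimes> x) \<ominus> j" using jc r Y(7) by algebra
    also have "\<dots> = s \<otimes> a \<ominus> j" unfolding sa ..
    also have "\<dots> \<in> P0" using i0 a j P0(2) s(1) by (meson ideal.I_l_closed minus_closed_ideal subsetD)
    finally have "r \<in> P0" using primeideal.I_prime[OF P0(1) Y(7) r] x(2) by blast
    then have "x \<otimes> r \<in> ideal_prod R (PIdl x) P0" using ideal_prod.prod cgenideal_self[OF Y(7)] by metis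
    then have "s \<otimes> a \<in> J <+> ideal_prod R (PIdl x) P0"
      unfolding sa mem_set_add using j m_comm[OF r Y(7)] by metis
    then show "a \<in> sat (J <+> ideal_prod R (PIdl x) P0)" using s ac by (intro satI[of _ s])
  qed
  then have "P0 \<subseteq> sat J" using nakayama[OF iX i0 J] by blast
  then have "sat J = P0" using sat_least[OF s0 P0(2)] by blast
  then show ?case using P0(1) by simp
qed

text \<open>\<open>X\<close> has as many elements as the prime chain has inclusions, so every subset
  generates a prime ideal locally, \<open>X\<close> is a regular sequence in any order, and the two
  length bounds agree. The exponent \<open>n\<close> is arbitrary here.\<close>

lemma length_generator_powers:
  assumes X: "finite X" "X \<subseteq> P" and ch: "prime_chain {\<zero>} (card X) P" and gen: "P \<subseteq> sat (Idl X)"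
  shows "wser (n ^ card X) (sat (Idl ((\<lambda>x. x [^] n) ` X))) (carrier R)"
    and "schain (n ^ card X) (sat (Idl ((\<lambda>x. x [^] n) ` X))) (carrier R)"
proof -
  have Xc: "X \<subseteq> carrier R" using X Icarr by auto
  have gen': "P = sat (Idl X)"
    using gen sat_least[OF sat_ideal_prime[OF primeideal subset_refl] genideal_minimal[OF is_ideal X(2)]] by blast
  show "wser (n ^ card X) (sat (Idl ((\<lambda>x. x [^] n) ` X))) (carrier R)"
    using wser_generators[OF X(1) Xc gen' subset_refl, of n] by simp
  \<comment> \<open>Each element of \<open>V\<close> costs at most one inclusion, which leaves one
    for each remaining generator.\<close>
  have chV: "prime_chain (Idl V) (card (X - V)) P" if V: "V \<subseteq> X" for V
  proof -
    have "card V + card (X - V) = card X" using V X(1) by (simp add: card_Diff_subset card_mono finite_subset)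
    then show ?thesis using prime_chain_Idl[of V P] V X ch finite_subset by fastforce
  qed
  have genV: "P \<subseteq> sat (Idl V <+> Idl W)"
    if "V \<subseteq> X" "W \<subseteq> X" "X \<subseteq> sat (Idl V <+> Idl W)" for V W
  proof -
    have "V \<subseteq> carrier R" "W \<subseteq> carrier R" using that Xc by auto
    then have "ideal (Idl V <+> Idl W) R" by (intro add_ideals genideal_ideal)
    then have "sat (Idl X) \<subseteq> sat (Idl V <+> Idl W)"
      using that(3) sat_least[OF sat_idealI] genideal_minimal[OF ideal_sat] by blast
    then show ?thesis using gen by blast
  qed
  have pr: "primeideal (sat (Idl V)) R" if V: "V \<subseteq> X" for V
  proof (rule prime_sat_if_chain[where X = "X - V" and n = "card (X - V)"])
    show "prime_chain (Idl V) (card (X - V)) P" using chV[OF V] .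
    have Vc: "V \<subseteq> carrier R" "X - V \<subseteq> carrier R" using V Xc by auto
    note i = genideal_ideal[OF Vc(1)] genideal_ideal[OF Vc(2)]
    have "X \<subseteq> Idl V <+> Idl (X - V)"
      using genideal_self[OF Vc(1)] genideal_self[OF Vc(2)] set_add_lower[OF i] by blast
    then show "P \<subseteq> sat (Idl V <+> Idl (X - V))" using genV[OF V, of "X - V"] sat_upper[OF add_ideals[OF i]] by blast
  qed (use X V Xc genideal_ideal in auto)
  \<comment> \<open>A redundant \<open>x\<close> would leave fewer generators than the chain above
    \<open>Idl V\<close> has inclusions, against the height theorem.\<close>
  have nin: "x \<notin> sat (Idl V)" if V: "V \<subseteq> X" "x \<in> X - V" for V x
  proof
    assume xs: "x \<in> sat (Idl V)"
    define W where "W = X - V - {x}"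
    have Vc: "V \<subseteq> carrier R" "W \<subseteq> carrier R" using V Xc unfolding W_def by auto
    note i = genideal_ideal[OF Vc(1)] genideal_ideal[OF Vc(2)]
    have "W \<union> V \<subseteq> Idl V <+> Idl W"
      using genideal_self[OF Vc(1)] genideal_self[OF Vc(2)] set_add_lower[OF i] by blast
    then have "X \<subseteq> sat (Idl V <+> Idl W)"
      using xs sat_upper[OF add_ideals[OF i]] sat_mono[OF set_add_lower(1)[OF i]] unfolding W_def by blast
    moreover have W: "W \<subseteq> X" "W \<subseteq> P" "finite W" unfolding W_def using X by auto
    ultimately have "P \<subseteq> sat (Idl V <+> Idl W)" using genV[OF V(1)] by blast
    then have "card (X - V) \<le> card W"
      using prime_chain_le_card[OF W(3,2) i(1) chV[OF V(1)]] by blast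
    moreover have "card W < card (X - V)" unfolding W_def using V(2) X(1) by (intro card_Diff1_less) auto
    ultimately show False by simp
  qed
  have "nzd y (sat (Idl ((\<lambda>x. x [^] n) ` U \<union> (X - insert y U))))" if "U \<subseteq> X" "y \<in> X - U" for U y
    using that by (intro nzd_generators[OF Xc X(1) pr nin that(1)]) auto
  then show "schain (n ^ card X) (sat (Idl ((\<lambda>x. x [^] n) ` X))) (carrier R)"
    using schain_generators[OF X(1) Xc gen' subset_refl, of n] by simp
qed

end

section \<open>The Frobenius\<close>

context cring
begin

section \<open>The binomial theorem, for additivity of the Frobenius\<close>

lemma binomial_theorem:
  assumes a: "a \<in> carrier R" and b: "b \<in> carrier R"
  shows "(a \<oplus> b) [^] n = (\<Oplus>k\<in>{..n}. [(n choose k)] \<cdot> (a [^] k \<otimes> b [^] (n - k)))"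
proof (induction n)
  case (Suc n)
  define g where "g k = [(n choose k)] \<cdot> (a [^] k \<otimes> b [^] (n - k))" for k
  define h where "h k = [(n choose k)] \<cdot> (a [^] k \<otimes> b [^] (Suc n - k))" for k
  have g: "g k \<in> carrier R" and h: "h k \<in> carrier R" for k unfolding g_def h_def using a b by auto
  have hg: "h k = b \<otimes> g k" if "k \<le> n" for k
    unfolding h_def g_def using a b that by (simp add: add_pow_rdistr Suc_diff_le m_ac)
  have h0: "h (Suc n) = \<zero>" unfolding h_def by (simp add: binomial_eq_0)
  have gs: "[(Suc n choose Suc k)] \<cdot> (a [^] Suc k \<otimes> b [^] (Suc n - Suc k)) = a \<otimes> g k \<oplus> h (Suc k)" for k
    unfolding h_def g_def using a b by (simp add: add_pow_rdistr add.nat_pow_mult[symmetric] m_ac)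
  have sh: "(\<Oplus>k\<in>{..n}. h k) = b \<otimes> (\<Oplus>k\<in>{..n}. g k)"
  proof -
    have "(\<Oplus>k\<in>{..n}. h k) = (\<Oplus>k\<in>{..n}. b \<otimes> g k)" using g b hg by (intro finsum_cong') auto
    then show ?thesis using g b by (simp add: finsum_rdistr)
  qed
  have "(\<Oplus>k\<in>{..Suc n}. [(Suc n choose k)] \<cdot> (a [^] k \<otimes> b [^] (Suc n - k)))
      = (\<Oplus>k\<in>{..n}. a \<otimes> g k \<oplus> h (Suc k)) \<oplus> h 0"
    using a b gs by (subst finsum_Suc2) (auto simp: h_def simp del: binomial_Suc_Suc)
  also have "\<dots> = (\<Oplus>k\<in>{..n}. a \<otimes> g k) \<oplus> ((\<Oplus>k\<in>{..n}. h (Suc k)) \<oplus> h 0)"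
    using a g h by (simp add: finsum_addf a_assoc)
  also have "(\<Oplus>k\<in>{..n}. h (Suc k)) \<oplus> h 0 = (\<Oplus>k\<in>{..Suc n}. h k)"
    using h by (subst finsum_Suc2) auto
  also have "\<dots> = b \<otimes> (\<Oplus>k\<in>{..n}. g k)" using h h0 sh b g by simp
  also have "(\<Oplus>k\<in>{..n}. a \<otimes> g k) = a \<otimes> (\<Oplus>k\<in>{..n}. g k)" using a g by (simp add: finsum_rdistr)
  also have "a \<otimes> (\<Oplus>k\<in>{..n}. g k) \<oplus> b \<otimes> (\<Oplus>k\<in>{..n}. g k) = (a \<oplus> b) [^] Suc n"
    using Suc a b g unfolding g_def[symmetric] by (simp add: l_distr m_comm)
  finally show ?case by simp
qed (use a b in simp)

end

locale prime_char_cring = cring R for R (structure) +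
  fixes p :: nat
  assumes prime_p: "Factorial_Ring.prime p" and char_p: "has_characteristic R p"
begin

lemma multiple_eq_zero: assumes "p dvd k" "z \<in> carrier R" shows "[k] \<cdot> z = \<zero>"
proof -
  have "[k] \<cdot> z = ([k] \<cdot> \<one>) \<otimes> z" using assms(2) add_pow_ldistr[of \<one> z k] by simp
  also have "[k] \<cdot> \<one> = \<zero>" using char_p assms(1) unfolding has_characteristic_def by blast
  finally show ?thesis using assms(2) by simp
qed

lemma pow_p_add:
  assumes a: "a \<in> carrier R" and b: "b \<in> carrier R"
  shows "(a \<oplus> b) [^] p = a [^] p \<oplus> b [^] p"
proof -
  obtain r where r: "p = Suc (Suc r)"
    using le_Suc_ex[OF prime_ge_2_nat[OF prime_p]] by auto
  define g where "g k = [(p choose k)] \<cdot> (a [^] k \<otimes> b [^] (p - k))" for k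
  have g: "g k \<in> carrier R" for k unfolding g_def using a b by auto
  have "g (Suc i) = \<zero>" if "i \<le> r" for i
    unfolding g_def using that r a b prime_p by (intro multiple_eq_zero dvd_choose_prime) auto
  then have z: "(\<Oplus>i\<in>{..r}. g (Suc i)) = \<zero>" by (intro add.finprod_one_eqI) auto
  have "(a \<oplus> b) [^] p = (\<Oplus>k\<in>{..p}. g k)" unfolding g_def by (rule binomial_theorem[OF a b])
  also have "\<dots> = g p \<oplus> ((\<Oplus>i\<in>{..r}. g (Suc i)) \<oplus> g 0)"
  proof -
    have "(\<Oplus>k\<in>{..Suc r}. g k) = (\<Oplus>i\<in>{..r}. g (Suc i)) \<oplus> g 0" using g by (intro finsum_Suc2) auto
    then show ?thesis unfolding r using g by simp
  qed
  also have "\<dots> = g p \<oplus> g 0" using z g by simp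
  also have "\<dots> = a [^] p \<oplus> b [^] p" unfolding g_def using a b by simp
  finally show ?thesis .
qed

lemma frob_pos: "0 < p ^ e" using prime_gt_0_nat[OF prime_p] by simp

lemma frob_add:
  assumes a: "a \<in> carrier R" and b: "b \<in> carrier R"
  shows "(a \<oplus> b) [^] (p ^ e) = a [^] (p ^ e) \<oplus> b [^] (p ^ e)"
proof (induction e)
  case (Suc e)
  have "(a \<oplus> b) [^] (p ^ Suc e) = ((a \<oplus> b) [^] (p ^ e)) [^] p"
    using a b by (simp add: nat_pow_pow mult.commute)
  also have "\<dots> = (a [^] (p ^ e)) [^] p \<oplus> (b [^] (p ^ e)) [^] p"
    using Suc pow_p_add a b by simp
  finally show ?case using a b by (simp add: nat_pow_pow mult.commute)
qed (use a b in simp)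

lemma frob_zero: "\<zero> [^] (p ^ e) = \<zero>"
  using frob_pos[of e] by (simp add: nat_pow_zero)

section \<open>Frobenius powers of ideals\<close>

abbreviation frob :: "nat \<Rightarrow> 'a set \<Rightarrow> 'a set" where
  "frob e J \<equiv> frobenius_power R p e J"

lemma frob_carrier: "J \<subseteq> carrier R \<Longrightarrow> {f [^] (p ^ e) | f. f \<in> J} \<subseteq> carrier R" by auto

lemma ideal_frob: "J \<subseteq> carrier R \<Longrightarrow> ideal (frob e J) R"
  unfolding frobenius_power_def by (rule genideal_ideal[OF frob_carrier])

lemma frob_mem: "J \<subseteq> carrier R \<Longrightarrow> f \<in> J \<Longrightarrow> f [^] (p ^ e) \<in> frob e J"
  unfolding frobenius_power_def using genideal_self[OF frob_carrier[of J e]] by blast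

lemma frob_least:
  assumes "ideal L R" "\<And>f. f \<in> J \<Longrightarrow> f [^] (p ^ e) \<in> L" shows "frob e J \<subseteq> L"
  unfolding frobenius_power_def by (rule genideal_minimal[OF assms(1)]) (use assms(2) in auto)

lemma frob_mono: "K \<subseteq> carrier R \<Longrightarrow> J \<subseteq> K \<Longrightarrow> frob e J \<subseteq> frob e K"
  using frob_mem by (intro frob_least ideal_frob) auto

text \<open>The Frobenius respects sums and products, so preimages of ideals are ideals; inclusions
  of Frobenius powers can therefore be tested on any generating set.\<close>

lemma ideal_frob_preimage:
  assumes L: "ideal L R" shows "ideal {z \<in> carrier R. z [^] (p ^ e) \<in> L} R"
proof (rule idealI_cring)
  show "a \<oplus> b \<in> {z \<in> carrier R. z [^] (p ^ e) \<in> L}"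
    if "a \<in> {z \<in> carrier R. z [^] (p ^ e) \<in> L}" "b \<in> {z \<in> carrier R. z [^] (p ^ e) \<in> L}" for a b
    using that add_closed_ideal[OF L] by (simp add: frob_add)
  show "x \<otimes> a \<in> {z \<in> carrier R. z [^] (p ^ e) \<in> L}"
    if "a \<in> {z \<in> carrier R. z [^] (p ^ e) \<in> L}" "x \<in> carrier R" for a x
    using that ideal.I_l_closed[OF L] by (simp add: nat_pow_distrib)
qed (use zero_mem_ideal[OF L] frob_zero in auto)

lemma frob_Idl_least:
  assumes T: "T \<subseteq> carrier R" and L: "ideal L R" and TL: "\<And>t. t \<in> T \<Longrightarrow> t [^] (p ^ e) \<in> L"
  shows "frob e (Idl T) \<subseteq> L"
proof (rule frob_least[OF L])
  have "Idl T \<subseteq> {z \<in> carrier R. z [^] (p ^ e) \<in> L}"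
    using T TL by (intro genideal_minimal[OF ideal_frob_preimage[OF L]]) auto
  then show "f [^] (p ^ e) \<in> L" if "f \<in> Idl T" for f using that by blast
qed

lemma frob_set_add:
  assumes J: "ideal J R" and K: "ideal K R"
  shows "frob e (J <+> K) \<subseteq> frob e J <+> frob e K"
proof (rule frob_least)
  have c: "J \<subseteq> carrier R" "K \<subseteq> carrier R" using ideal_subset_carrier J K by auto
  show "ideal (frob e J <+> frob e K) R" using c by (intro add_ideals ideal_frob)
  fix f assume "f \<in> J <+> K"
  then obtain j k where jk: "j \<in> J" "k \<in> K" "f = j \<oplus> k" unfolding mem_set_add by blast
  then have "f [^] (p ^ e) = j [^] (p ^ e) \<oplus> k [^] (p ^ e)" using frob_add c by blast
  then show "f [^] (p ^ e) \<in> frob e J <+> frob e K"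
    unfolding mem_set_add using frob_mem[OF c(1) jk(1)] frob_mem[OF c(2) jk(2)] by blast
qed

lemma frob_frob: assumes J: "J \<subseteq> carrier R" shows "frob e (frob e' J) \<subseteq> frob (e + e') J"
  unfolding frobenius_power_def[of R p e' J]
proof (rule frob_Idl_least[OF frob_carrier[OF J] ideal_frob[OF J]])
  fix t assume "t \<in> {f [^] (p ^ e') | f. f \<in> J}"
  then obtain f where f: "f \<in> J" "t = f [^] (p ^ e')" by blast
  then have "t [^] (p ^ e) = f [^] (p ^ (e + e'))" using J by (auto simp: nat_pow_pow power_add mult.commute)
  then show "t [^] (p ^ e) \<in> frob (e + e') J" using frob_mem[OF J f(1)] by simp
qed

lemma frob_antimono: assumes J: "ideal J R" and "e \<le> e'" shows "frob e' J \<subseteq> frob e J"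
proof (rule frob_least)
  have c: "J \<subseteq> carrier R" using ideal_subset_carrier J .
  show "ideal (frob e J) R" using ideal_frob[OF c] .
  fix f assume f: "f \<in> J"
  have fc: "f \<in> carrier R" using f c by blast
  obtain m where "p ^ e' = p ^ e + m"
    using le_Suc_ex[OF power_increasing[OF assms(2), of p]] prime_gt_0_nat[OF prime_p] by auto
  then have "f [^] (p ^ e') = f [^] (p ^ e) \<otimes> f [^] m" using fc by (simp add: nat_pow_mult)
  then show "f [^] (p ^ e') \<in> frob e J"
    using frob_mem[OF c f] ideal.I_r_closed[OF ideal_frob[OF c]] fc by simp
qed

text \<open>Colon ideals extend a multiplicative inclusion from generators to the ideal they
  generate.\<close>

lemma ideal_colon:
  assumes L: "ideal L R" and w: "w \<in> carrier R" shows "ideal {z \<in> carrier R. z \<otimes> w \<in> L} R"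
proof (rule idealI_cring)
  show "a \<oplus> b \<in> {z \<in> carrier R. z \<otimes> w \<in> L}"
    if "a \<in> {z \<in> carrier R. z \<otimes> w \<in> L}" "b \<in> {z \<in> carrier R. z \<otimes> w \<in> L}" for a b
    using that w add_closed_ideal[OF L] by (simp add: l_distr)
  show "x \<otimes> a \<in> {z \<in> carrier R. z \<otimes> w \<in> L}"
    if "a \<in> {z \<in> carrier R. z \<otimes> w \<in> L}" "x \<in> carrier R" for a x
    using that w ideal.I_l_closed[OF L] by (simp add: m_assoc)
qed (use zero_mem_ideal[OF L] w in auto)

end

locale char_localization = noetherian_localization P R + prime_char_cring R p
  for P and R (structure) and p
begin

lemma Pc: "P \<subseteq> carrier R" using Icarr by blast

lemma pow_not_in: "s \<in> carrier R \<Longrightarrow> s \<notin> P \<Longrightarrow> s [^] (n::nat) \<notin> P"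
proof (induction n)
  case 0
  then show ?case using one_not_in by simp
next
  case (Suc n)
  then show ?case using mult_not_in[of "s [^] n" s] by simp
qed

lemma frob_sat:
  assumes J: "ideal J R" shows "frob e (sat J) \<subseteq> sat (frob e J)"
proof (rule frob_least)
  have c: "J \<subseteq> carrier R" using ideal_subset_carrier J .
  show "ideal (sat (frob e J)) R" using ideal_sat ideal_frob[OF c] .
  fix f assume "f \<in> sat J"
  then obtain s where s: "f \<in> carrier R" "s \<in> carrier R" "s \<notin> P" "s \<otimes> f \<in> J" by (rule satE)
  have "s [^] (p ^ e) \<otimes> f [^] (p ^ e) \<in> frob e J" using frob_mem[OF c s(4)] s by (simp add: nat_pow_distrib)
  then show "f [^] (p ^ e) \<in> sat (frob e J)" using s pow_not_in by (intro satI[of _ "s [^] (p ^ e)"]) auto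
qed

lemma sat_frob_sat: assumes J: "ideal J R" shows "sat (frob e (sat J)) = sat (frob e J)"
proof
  have c: "J \<subseteq> carrier R" "sat J \<subseteq> carrier R" using ideal_subset_carrier J ideal_sat by auto
  show "sat (frob e (sat J)) \<subseteq> sat (frob e J)"
    using sat_least[OF sat_idealI[OF ideal_frob[OF c(1)]] frob_sat[OF J]] .
  show "sat (frob e J) \<subseteq> sat (frob e (sat J))" by (rule sat_mono[OF frob_mono[OF c(2) sat_upper[OF J]]])
qed

end

text \<open>The later arguments use regularity at \<open>P\<close> only through these two bounds:
  the quotient by the Frobenius power of \<open>P\<close> has local length exactly
  \<open>(p ^ e) ^ d\<close>, with one \<open>d\<close> for all \<open>e\<close>.\<close>

locale frobenius_localization = char_localization P R p
  for P and R (structure) and p +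
  fixes d :: nat
  assumes length_frob: "wser ((p ^ e) ^ d) (sat (frobenius_power R p e P)) (carrier R)"
    "schain ((p ^ e) ^ d) (sat (frobenius_power R p e P)) (carrier R)"
begin

text \<open>The easy half of the colon identity. Raising \<open>f u \<in> J\<close> to the power
  \<open>p ^ e\<close> settles the generators; a colon ideal and the saturation extend this to
  \<open>c\<close>.\<close>

lemma frob_prime_mult:
  assumes J: "ideal J R" and u: "u \<in> carrier R" and Pu: "\<And>c. c \<in> P \<Longrightarrow> c \<otimes> u \<in> J"
    and c: "c \<in> sat (frob e P)"
  shows "c \<otimes> u [^] (p ^ e) \<in> sat (frob e J)"
proof -
  have Jc: "J \<subseteq> carrier R" using ideal_subset_carrier J .
  have uq: "u [^] (p ^ e) \<in> carrier R" using u by simp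
  have "frob e P \<subseteq> {z \<in> carrier R. z \<otimes> u [^] (p ^ e) \<in> frob e J}"
  proof (rule frob_least[OF ideal_colon[OF ideal_frob[OF Jc] uq]])
    fix f assume f: "f \<in> P"
    then have "(f \<otimes> u) [^] (p ^ e) \<in> frob e J" using Pu frob_mem[OF Jc] by blast
    then show "f [^] (p ^ e) \<in> {z \<in> carrier R. z \<otimes> u [^] (p ^ e) \<in> frob e J}"
      using f Icarr u by (simp add: nat_pow_distrib)
  qed
  moreover obtain s where s: "c \<in> carrier R" "s \<in> carrier R" "s \<notin> P" "s \<otimes> c \<in> frob e P"
    using c by (rule satE)
  ultimately have "(s \<otimes> c) \<otimes> u [^] (p ^ e) \<in> frob e J" by blast
  then show ?thesis using s uq by (intro satI[of _ s]) (auto simp: m_assoc)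
qed

text \<open>Locally \<open>K = J + R u\<close>. As the Frobenius is additive, the power of
  \<open>K\<close> is generated over that of \<open>J\<close> by the power of \<open>u\<close>
  alone.\<close>

lemma sat_frob_step:
  assumes J: "sat_ideal J" and K: "sat_ideal K" and JK: "J \<subseteq> K" and u: "u \<in> K"
    and gen: "\<And>z. z \<in> K \<Longrightarrow> \<exists>s a. s \<in> carrier R \<and> s \<notin> P \<and> a \<in> carrier R \<and> s \<otimes> z \<ominus> a \<otimes> u \<in> J"
  shows "sat (frob e K) = sat (lin (frob e J) (carrier R) (u [^] (p ^ e)))"
proof
  have c: "J \<subseteq> carrier R" "K \<subseteq> carrier R" using ideal_subset_carrier sat_ideal_ideal J K by auto
  have uc: "u \<in> carrier R" "u [^] (p ^ e) \<in> carrier R" using u c by auto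
  note iL = lin_ideal[OF ideal_frob[OF c(1)] oneideal uc(2)]
  have "frob e K \<subseteq> sat (lin (frob e J) (carrier R) (u [^] (p ^ e)))"
  proof (rule frob_least[OF ideal_sat[OF iL]])
    fix z assume z: "z \<in> K"
    have zc: "z \<in> carrier R" using z c by blast
    obtain s a where s: "s \<in> carrier R" "s \<notin> P" and a: "a \<in> carrier R" and sz: "s \<otimes> z \<ominus> a \<otimes> u \<in> J"
      using gen[OF z] by blast
    have "s \<otimes> z = (s \<otimes> z \<ominus> a \<otimes> u) \<oplus> a \<otimes> u" using s(1) a zc uc(1) by algebra
    then have "(s \<otimes> z) [^] (p ^ e) = (s \<otimes> z \<ominus> a \<otimes> u) [^] (p ^ e) \<oplus> (a \<otimes> u) [^] (p ^ e)"
      using frob_add s a zc uc by (metis m_closed minus_closed)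
    then have "s [^] (p ^ e) \<otimes> z [^] (p ^ e) = (s \<otimes> z \<ominus> a \<otimes> u) [^] (p ^ e) \<oplus> a [^] (p ^ e) \<otimes> u [^] (p ^ e)"
      using s a zc uc by (simp add: nat_pow_distrib)
    also have "\<dots> \<in> lin (frob e J) (carrier R) (u [^] (p ^ e))" using frob_mem[OF c(1) sz] a by (intro linI) auto
    finally show "z [^] (p ^ e) \<in> sat (lin (frob e J) (carrier R) (u [^] (p ^ e)))"
      using s zc pow_not_in by (intro satI[of _ "s [^] (p ^ e)"]) auto
  qed
  then show "sat (frob e K) \<subseteq> sat (lin (frob e J) (carrier R) (u [^] (p ^ e)))"
    using sat_least[OF sat_idealI[OF iL]] by blast
  show "sat (lin (frob e J) (carrier R) (u [^] (p ^ e))) \<subseteq> sat (frob e K)"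
    using lin_carrier_least[OF ideal_frob[OF c(2)] frob_mono[OF c(2) JK] frob_mem[OF c(2) u]] by (rule sat_mono)
qed

text \<open>The new factor is cyclic, generated by the power of \<open>u\<close>, and killed by the
  Frobenius power of \<open>P\<close>; so \<open>length_frob\<close> bounds its length.\<close>

lemma wser_frob_step: assumes st: "step J K" shows "wser ((p ^ e) ^ d) (sat (frob e J)) (sat (frob e K))"
proof -
  obtain u where J: "sat_ideal J" and K: "sat_ideal K" and JK: "J \<subseteq> K" and u: "u \<in> K"
    and Pu: "\<And>c. c \<in> P \<Longrightarrow> c \<otimes> u \<in> J"
    and gen: "\<And>z. z \<in> K \<Longrightarrow> \<exists>s a. s \<in> carrier R \<and> s \<notin> P \<and> a \<in> carrier R \<and> s \<otimes> z \<ominus> a \<otimes> u \<in> J"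
    by (rule stepE[OF st]) blast
  note iJ = sat_ideal_ideal[OF J] and iK = sat_ideal_ideal[OF K]
  have uc: "u \<in> carrier R" "u [^] (p ^ e) \<in> carrier R" using ideal.Icarr[OF iK u] by auto
  have "sat (frob e K) = sat (lin (frob e J) (carrier R) (u [^] (p ^ e)))"
    by (rule sat_frob_step[OF J K JK u gen])
  moreover have "c \<otimes> u [^] (p ^ e) \<in> sat (frob e J)" if "c \<in> sat (frob e P)" for c
    by (rule frob_prime_mult[OF iJ uc(1) Pu that])
  ultimately show ?thesis
    using wser_cyclic[OF length_frob(1) ideal_frob[OF ideal_subset_carrier[OF iJ]] uc(2)] by simp
qed

lemma wser_frob:
  assumes "wser n J K" shows "wser (n * (p ^ e) ^ d) (sat (frob e J)) (sat (frob e K))"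
  using assms
proof (induction rule: wser.induct)
  case (refl J)
  have "J \<subseteq> carrier R" using ideal_subset_carrier sat_ideal_ideal refl by blast
  then show ?case using wser.refl sat_idealI ideal_frob by simp
next
  case (snoc n J K K')
  show ?case using wser_trans[OF wser_frob_step[OF snoc.hyps(2)] snoc.IH] by (simp add: add.commute)
qed

lemma step_lin_carrier:
  assumes J: "sat_ideal J" and u: "u \<in> carrier R" and Pu: "\<And>c. c \<in> P \<Longrightarrow> c \<otimes> u \<in> J"
  shows "step J (sat (lin J (carrier R) u))"
proof -
  note iJ = sat_ideal_ideal[OF J]
  note iL = lin_ideal[OF iJ oneideal u]
  show ?thesis
  proof (rule stepI[where u = u])
    show "sat_ideal J" "sat_ideal (sat (lin J (carrier R) u))" using J sat_idealI[OF iL] by auto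
    show "J \<subseteq> sat (lin J (carrier R) u)" using lin_lower(1)[OF iJ oneideal u] sat_upper[OF iL] by blast
    show "u \<in> sat (lin J (carrier R) u)" using generator_mem_lin[OF iJ u] sat_upper[OF iL] by blast
    show "c \<otimes> u \<in> J" if "c \<in> P" for c using Pu that .
    fix z assume "z \<in> sat (lin J (carrier R) u)"
    then obtain s where s: "s \<in> carrier R" "s \<notin> P" "s \<otimes> z \<in> lin J (carrier R) u" by (rule satE)
    obtain j a where j: "j \<in> J" and a: "a \<in> carrier R" and sz: "s \<otimes> z = j \<oplus> a \<otimes> u" by (rule linE[OF s(3)])
    have jc: "j \<in> carrier R" using ideal.Icarr[OF iJ j] .
    have "s \<otimes> z \<ominus> a \<otimes> u = j" unfolding sz using jc a u by algebra
    then show "\<exists>s a. s \<in> carrier R \<and> s \<notin> P \<and> a \<in> carrier R \<and> s \<otimes> z \<ominus> a \<otimes> u \<in> J" using s a j by metis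
  qed
qed

text \<open>Applying the Frobenius to a composition series from \<open>P\<^bsup>[q']\<^esup>\<close> through \<open>J\<close> to \<open>R\<close> replaces each
  step by a cyclic module of length at most \<open>q\<^sup>d\<close>. The total length is exactly \<open>(q q')\<^sup>d\<close>, so no step can
  be shorter.\<close>

lemma frob_colon_socle:
  assumes J: "sat_ideal J" and PJ: "sat (frob e' P) \<subseteq> J" and u: "u \<in> carrier R" "u \<notin> J"
    and Pu: "\<And>c. c \<in> P \<Longrightarrow> c \<otimes> u \<in> J"
    and a: "a \<in> carrier R" "a \<otimes> u [^] (p ^ e) \<in> sat (frob e J)"
  shows "a \<in> sat (frob e P)"
proof (rule ccontr)
  assume na: "a \<notin> sat (frob e P)"
  define K where "K = sat (lin J (carrier R) u)"
  note iJ = sat_ideal_ideal[OF J]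
  note iLJ = lin_ideal[OF iJ oneideal u(1)]
  have st: "step J K" unfolding K_def using step_lin_carrier[OF J u(1) Pu] .
  have K: "sat_ideal K" "J \<subseteq> K" using step_sat_ideal[OF st] by auto
  have uK: "u \<in> K" unfolding K_def using generator_mem_lin[OF iJ u(1)] sat_upper[OF iLJ] by blast
  have Jc: "J \<subseteq> carrier R" and Kc: "K \<subseteq> carrier R" using ideal_subset_carrier sat_ideal_ideal J K by auto
  have uq: "u [^] (p ^ e) \<in> carrier R" using u by simp
  obtain k1 k2 where k: "k1 + k2 = (p ^ e') ^ d" "wser k1 (sat (frob e' P)) J" "wser k2 J (carrier R)"
    using wser_split[OF length_frob(1) PJ Jc J] by blast
  obtain k3 k4 where k': "k3 + k4 = k2" "wser k3 J K" "wser k4 K (carrier R)"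
    using wser_split[OF k(3) K(2) Kc K(1)] by blast
  have "k3 \<noteq> 0" using k'(2) uK u(2) by (auto elim: wser.cases)
  define C where "C = sat (frob e P)"
  have iP: "ideal (frob e P) R" using ideal_frob[OF Pc] .
  have iC: "ideal C R" unfolding C_def using ideal_sat[OF iP] .
  note iL = lin_ideal[OF iC oneideal a(1)]
  \<comment> \<open>As \<open>a \<notin> C\<close>, the ideal \<open>L\<close> is strictly larger
    than \<open>C\<close>, yet it still multiplies the power of \<open>u\<close> into the saturated
    Frobenius power of \<open>J\<close>. So the factor from \<open>J\<close> to \<open>K\<close>
    will be too short.\<close>
  define L where "L = sat (lin C (carrier R) a)"
  have L: "C \<subseteq> L" "sat_ideal L" "a \<in> L" "L \<subseteq> carrier R"
    unfolding L_def using lin_lower(1)[OF iC oneideal a(1)] sat_upper[OF iL] sat_idealI[OF iL]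
      generator_mem_lin[OF iC a(1)] ideal_subset_carrier[OF ideal_sat[OF iL]] by auto
  obtain b1 b2 where b: "b1 + b2 = (p ^ e) ^ d" "wser b1 C L" "wser b2 L (carrier R)"
    using wser_split[OF length_frob(1)[of e, folded C_def] L(1,4,2)] by blast
  have "b1 \<noteq> 0" using b(2) L(3) na unfolding C_def by (auto elim: wser.cases)
  have "lin C (carrier R) a \<subseteq> {z \<in> carrier R. z \<otimes> u [^] (p ^ e) \<in> sat (frob e J)}"
  proof (rule lin_carrier_least[OF ideal_colon[OF ideal_sat[OF ideal_frob[OF Jc]] uq]])
    show "C \<subseteq> {z \<in> carrier R. z \<otimes> u [^] (p ^ e) \<in> sat (frob e J)}"
    proof
      fix z assume z: "z \<in> C"
      have "z \<otimes> u [^] (p ^ e) \<in> sat (frob e J)"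
        by (rule frob_prime_mult[OF iJ u(1) Pu z[unfolded C_def]])
      then show "z \<in> {z \<in> carrier R. z \<otimes> u [^] (p ^ e) \<in> sat (frob e J)}" using ideal.Icarr[OF iC z] by blast
    qed
  qed (use a in blast)
  then have colon: "z \<otimes> u [^] (p ^ e) \<in> sat (frob e J)" if "z \<in> lin C (carrier R) a" for z using that by blast
  have Lu: "z \<otimes> u [^] (p ^ e) \<in> sat (frob e J)" if "z \<in> L" for z
  proof -
    obtain s where s: "z \<in> carrier R" "s \<in> carrier R" "s \<notin> P" "s \<otimes> z \<in> lin C (carrier R) a"
      using \<open>z \<in> L\<close> unfolding L_def by (rule satE)
    then have "s \<otimes> (z \<otimes> u [^] (p ^ e)) \<in> sat (frob e J)" using colon[OF s(4)] uq by (simp add: m_assoc)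
    then show ?thesis using sat_idealD[OF sat_idealI[OF ideal_frob[OF Jc]] s(2,3)] s(1) uq by blast
  qed
  have gen: "\<exists>s a. s \<in> carrier R \<and> s \<notin> P \<and> a \<in> carrier R \<and> s \<otimes> z \<ominus> a \<otimes> u \<in> J" if z: "z \<in> K" for z
  proof -
    obtain s where s: "s \<in> carrier R" "s \<notin> P" "s \<otimes> z \<in> lin J (carrier R) u"
      using z unfolding K_def by (rule satE)
    obtain j a where j: "j \<in> J" and a: "a \<in> carrier R" and sz: "s \<otimes> z = j \<oplus> a \<otimes> u" by (rule linE[OF s(3)])
    have jc: "j \<in> carrier R" using ideal.Icarr[OF iJ j] .
    have "s \<otimes> z \<ominus> a \<otimes> u = j" unfolding sz using jc a u by algebra
    then show ?thesis using s a j by metis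
  qed
  have 1: "wser b2 (sat (frob e J)) (sat (frob e K))"
  proof -
    have "sat (frob e K) = sat (lin (frob e J) (carrier R) (u [^] (p ^ e)))"
      by (rule sat_frob_step[OF J K uK gen])
    then show ?thesis using wser_cyclic[OF b(3) ideal_frob[OF Jc] uq Lu] by simp
  qed
  have 2: "wser (k1 * (p ^ e) ^ d) (sat (frob e (sat (frob e' P)))) (sat (frob e J))" using wser_frob[OF k(2)] .
  have "frob e (carrier R) = carrier R"
    using ideal.one_imp_carrier[OF ideal_frob[OF subset_refl]] frob_mem[OF subset_refl one_closed, of e]
    by simp
  then have 3: "wser (k4 * (p ^ e) ^ d) (sat (frob e K)) (carrier R)"
    using wser_frob[OF k'(3), of e] sat_carrier by simp
  \<comment> \<open>Length of the transformed series: \<open>k1\<close> and \<open>k4\<close> steps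
    at the full bound, and the factor from \<open>J\<close> to \<open>K\<close> counted with
    \<open>b2\<close> only.\<close>
  define n where "n = k1 * (p ^ e) ^ d + (b2 + k4 * (p ^ e) ^ d)"
  have w: "wser n (sat (frob e (sat (frob e' P)))) (carrier R)"
    unfolding n_def using wser_trans[OF wser_trans[OF 3 1] 2] .
  have sub: "sat (frob e (sat (frob e' P))) \<subseteq> sat (frob (e + e') P)"
    unfolding sat_frob_sat[OF ideal_frob[OF Pc]] by (rule sat_mono[OF frob_frob[OF Pc]])
  note iee = ideal_frob[OF Pc, of "e + e'"]
  obtain m where m: "m \<le> n" "wser m (sat (frob (e + e') P)) (carrier R)"
    using wser_above[OF w sub ideal_subset_carrier[OF ideal_sat[OF iee]] sat_idealI[OF iee] sat_ideal_carrier] by blast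
  have "(p ^ (e + e')) ^ d \<le> n" using schain_le_wser[OF length_frob(2) m(2)] m(1) by simp
  moreover have "(p ^ (e + e')) ^ d = (p ^ e') ^ d * (p ^ e) ^ d"
    by (simp add: power_add power_mult_distrib mult.commute)
  \<comment> \<open>\<open>b1 \<noteq> 0\<close> makes \<open>b2\<close> smaller than a full step,
    and \<open>k3 \<noteq> 0\<close> gives \<open>k1 + 1 + k4 \<le> (p ^ e') ^ d\<close>; this
    contradicts the lower bound on the total length.\<close>
  moreover have "n < (k1 + 1 + k4) * (p ^ e) ^ d" unfolding n_def using b(1) \<open>b1 \<noteq> 0\<close> by (simp add: algebra_simps)
  moreover have "(k1 + 1 + k4) * (p ^ e) ^ d \<le> (p ^ e') ^ d * (p ^ e) ^ d"
    using k(1) k'(1) \<open>k3 \<noteq> 0\<close> by (intro mult_right_mono) auto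
  ultimately show False by linarith
qed

end

section \<open>Intersections at a prime\<close>

context frobenius_localization
begin

text \<open>As also \<open>D \<subseteq> J\<close>, the conditions say
  \<open>D = J \<inter> K\<close>, and they persist when \<open>J\<close> shrinks. The induction
  runs down a composition series from \<open>J\<close> to \<open>D\<close> and lowers the membership
  of \<open>z\<close> from one member to the next.\<close>

lemma frob_Int_primary:
  assumes K: "sat_ideal K" and z: "z \<in> sat (frob e K)"
  shows "wser n D J \<Longrightarrow> J \<inter> K \<subseteq> D \<Longrightarrow> D \<subseteq> K \<Longrightarrow> z \<in> sat (frob e J) \<Longrightarrow>
    sat (frob e' P) \<subseteq> D \<Longrightarrow> z \<in> sat (frob e D)"
proof (induction rule: wser.induct)
  case (snoc n D J1 J2)
  have DJ: "D \<subseteq> J1" "sat_ideal J1" using wser_sat_ideal[OF snoc.hyps(1)] by auto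
  obtain u where J1: "sat_ideal J1" and J2: "sat_ideal J2" and J12: "J1 \<subseteq> J2" and u: "u \<in> J2"
    and Pu: "\<And>c. c \<in> P \<Longrightarrow> c \<otimes> u \<in> J1"
    and gen: "\<And>z. z \<in> J2 \<Longrightarrow> \<exists>s a. s \<in> carrier R \<and> s \<notin> P \<and> a \<in> carrier R \<and> s \<otimes> z \<ominus> a \<otimes> u \<in> J1"
    by (rule stepE[OF snoc.hyps(2)]) blast
  note i1 = sat_ideal_ideal[OF J1] and i2 = sat_ideal_ideal[OF J2] and iK = sat_ideal_ideal[OF K]
  have uc: "u \<in> carrier R" "u [^] (p ^ e) \<in> carrier R" using ideal.Icarr[OF i2 u] by auto
  have c1: "J1 \<subseteq> carrier R" and c2: "J2 \<subseteq> carrier R" and cK: "K \<subseteq> carrier R"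
    using ideal_subset_carrier i1 i2 iK by auto
  note f1 = ideal_frob[OF c1, of e]
  have eq: "sat (frob e J2) = sat (lin (frob e J1) (carrier R) (u [^] (p ^ e)))"
    by (rule sat_frob_step[OF J1 J2 J12 u gen])
  have "z \<in> sat (frob e J1)"
  proof (cases "u \<in> J1")
    case True
    then have "lin (frob e J1) (carrier R) (u [^] (p ^ e)) \<subseteq> frob e J1"
      using frob_mem[OF c1] by (intro lin_carrier_least f1) auto
    then show ?thesis using snoc.prems(3) sat_mono unfolding eq by blast
  next
    case False
    \<comment> \<open>The multiple of the power of \<open>u\<close> is known to lie in the Frobenius
      power only for an ideal above both \<open>K\<close> and \<open>J1\<close>, so the colon
      identity is applied to \<open>K1 = K + J1\<close> instead of \<open>J1\<close>.\<close>
    define K1 where "K1 = sat (K <+> J1)"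
    note iKJ = add_ideals[OF iK i1]
    have K1: "sat_ideal K1" "K \<subseteq> K1" "J1 \<subseteq> K1"
      unfolding K1_def using sat_idealI[OF iKJ] set_add_lower[OF iK i1] sat_upper[OF iKJ] by auto
    note iK1 = sat_ideal_ideal[OF K1(1)]
    have cK1: "K1 \<subseteq> carrier R" using ideal_subset_carrier[OF iK1] .
    \<comment> \<open>If \<open>s u = k + j\<close>, then
      \<open>k \<in> J2 \<inter> K \<subseteq> D \<subseteq> J1\<close>, so \<open>u\<close> would
      lie in \<open>J1\<close>.\<close>
    have uK1: "u \<notin> K1"
    proof
      assume "u \<in> K1"
      then obtain s where s: "s \<in> carrier R" "s \<notin> P" "s \<otimes> u \<in> K <+> J1" unfolding K1_def by (rule satE)
      then obtain k j where k: "k \<in> K" and j: "j \<in> J1" and su: "s \<otimes> u = k \<oplus> j" unfolding mem_set_add by blast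
      have kj: "k \<in> carrier R" "j \<in> carrier R" using k j cK c1 by auto
      have "k = (k \<oplus> j) \<ominus> j" using kj by algebra
      also have "\<dots> = s \<otimes> u \<ominus> j" unfolding su ..
      also have "\<dots> \<in> J2" using i2 u j J12 s(1) by (meson ideal.I_l_closed minus_closed_ideal subsetD)
      finally have "k \<in> J1" using k snoc.prems(1) DJ(1) by blast
      then have "s \<otimes> u \<in> J1" unfolding su using add_closed_ideal[OF i1] j by blast
      then show False using sat_idealD[OF J1 s(1,2) uc(1)] False by blast
    qed
    have "z \<in> sat (lin (frob e J1) (carrier R) (u [^] (p ^ e)))" using snoc.prems(3) unfolding eq .
    then obtain s where zc: "z \<in> carrier R" and s: "s \<in> carrier R" "s \<notin> P"
      "s \<otimes> z \<in> lin (frob e J1) (carrier R) (u [^] (p ^ e))" by (rule satE)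
    obtain j a where j: "j \<in> frob e J1" and a: "a \<in> carrier R" and sz: "s \<otimes> z = j \<oplus> a \<otimes> u [^] (p ^ e)"
      by (rule linE[OF s(3)])
    have jc: "j \<in> carrier R" using ideal.Icarr[OF f1 j] .
    note iF = ideal_sat[OF ideal_frob[OF cK1, of e]]
    have "z \<in> sat (frob e K1)" using z sat_mono[OF frob_mono[OF cK1 K1(2)]] by blast
    then have "s \<otimes> z \<in> sat (frob e K1)" using ideal.I_l_closed[OF iF] s by blast
    moreover have "j \<in> sat (frob e K1)"
      using j frob_mono[OF cK1 K1(3)] sat_upper[OF ideal_frob[OF cK1]] by blast
    ultimately have "s \<otimes> z \<ominus> j \<in> sat (frob e K1)" using minus_closed_ideal[OF iF] by blast
    moreover have "s \<otimes> z \<ominus> j = a \<otimes> u [^] (p ^ e)" unfolding sz using jc a uc(2) by algebra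
    ultimately have au: "a \<otimes> u [^] (p ^ e) \<in> sat (frob e K1)" by simp
    have PuK: "c \<otimes> u \<in> K1" if "c \<in> P" for c using Pu[OF that] K1(3) by blast
    have "sat (frob e' P) \<subseteq> K1" using snoc.prems(2,4) K1(2) by blast
    then have "a \<in> sat (frob e P)" using frob_colon_socle[OF K1(1) _ uc(1) uK1 PuK a au] by blast
    then have "a \<otimes> u [^] (p ^ e) \<in> sat (frob e J1)" by (rule frob_prime_mult[OF i1 uc(1) Pu, rotated -1])
    then have "s \<otimes> z \<in> sat (frob e J1)"
      unfolding sz using add_closed_ideal[OF ideal_sat[OF f1]] j sat_upper[OF f1] by blast
    then show ?thesis using sat_idealD[OF sat_idealI[OF f1] s(1,2) zc] by blast
  qed
  then show ?case using snoc.IH snoc.prems J12 by blast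
qed simp

text \<open>A weak form of the Artin--Rees lemma, proved without Rees algebras. The
  Frobenius powers of \<open>P\<close> merely serve as a descending sequence cofinal with the powers of \<open>P\<close>.\<close>

lemma weak_Artin_Rees:
  assumes T: "ideal T R" and K: "ideal K R" and TK: "T \<subseteq> K"
  shows "\<exists>e'\<ge>e. (T <+> frob e' P) \<inter> K \<subseteq> T <+> ideal_prod R (frob e P) K"
proof -
  note iF = ideal_frob[OF Pc]
  note iFK = ideal_prod_is_ideal[OF iF K]
  define W where "W = T <+> ideal_prod R (frob e P) K"
  have iW: "ideal W R" unfolding W_def using add_ideals[OF T iFK] .
  have FKW: "ideal_prod R (frob e P) K \<subseteq> W" "T \<subseteq> W" unfolding W_def using set_add_lower[OF T iFK] by auto
  \<comment> \<open>A maximal \<open>L\<close> with \<open>L \<inter> K \<subseteq> W\<close> will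
    turn out to contain a power of each generator of \<open>P\<close>, hence a Frobenius power of
    \<open>P\<close>.\<close>
  define \<A> where "\<A> = {L. ideal L R \<and> W \<subseteq> L \<and> L \<inter> K \<subseteq> W}"
  have "W \<in> \<A>" using iW unfolding \<A>_def by blast
  then have "\<exists>M\<in>\<A>. \<forall>K\<in>\<A>. M \<subseteq> K \<longrightarrow> K = M"
    by (intro ex_maximal_ideal_in) (auto simp: \<A>_def)
  then obtain L where L: "L \<in> \<A>" and max: "\<forall>K\<in>\<A>. L \<subseteq> K \<longrightarrow> K = L" by (rule bexE)
  have iL: "ideal L R" and WL: "W \<subseteq> L" and LK: "L \<inter> K \<subseteq> W" using L unfolding \<A>_def by auto
  obtain Y where Y: "Y \<subseteq> carrier R" "finite Y" "P = Idl Y" using finetely_gen[OF is_ideal] by blast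
  have "\<exists>j::nat. x [^] j \<in> L" if x: "x \<in> Y" for x
  proof -
    have xP: "x \<in> P" and xc: "x \<in> carrier R" using x Y genideal_self[OF Y(1)] by auto
    \<comment> \<open>The ascending colon ideals of \<open>L\<close> by \<open>x [^] j\<close>
      become stationary. The shift by \<open>p ^ e\<close> is the relevant one, because
      \<open>x [^] (p ^ e)\<close> multiplies \<open>K\<close> into \<open>W\<close>.\<close>
    define C where "C j = {z \<in> carrier R. z \<otimes> x [^] (j::nat) \<in> L}" for j
    have iC: "ideal (C j) R" for j unfolding C_def using ideal_colon[OF iL] xc by simp
    have "\<exists>M\<in>range C. \<forall>J\<in>range C. M \<subseteq> J \<longrightarrow> J = M" by (rule ex_maximal_ideal_in) (use iC in auto)
    then obtain M where M: "M \<in> range C" "\<forall>J\<in>range C. M \<subseteq> J \<longrightarrow> J = M" by (rule bexE)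
    obtain j where "M = C j" using M(1) by (rule rangeE)
    then have j: "\<forall>i. C j \<subseteq> C i \<longrightarrow> C i = C j" using M(2) by simp
    have "C j \<subseteq> C (j + p ^ e)"
    proof
      fix z assume z: "z \<in> C j"
      then have "z \<otimes> x [^] j \<otimes> x [^] (p ^ e) \<in> L" using ideal.I_r_closed[OF iL] xc unfolding C_def by simp
      then show "z \<in> C (j + p ^ e)" using z xc unfolding C_def by (simp add: m_assoc nat_pow_mult)
    qed
    then have Cj: "C (j + p ^ e) = C j" using j by blast
    have xj: "x [^] j \<in> carrier R" using xc by simp
    note iL' = lin_ideal[OF iL oneideal xj]
    \<comment> \<open>So \<open>lin L (carrier R) (x [^] j)\<close> still competes with
      \<open>L\<close>, and maximality gives \<open>x [^] j \<in> L\<close>.\<close>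
    have "lin L (carrier R) (x [^] j) \<inter> K \<subseteq> W"
    proof
      fix y assume "y \<in> lin L (carrier R) (x [^] j) \<inter> K"
      then have yl: "y \<in> lin L (carrier R) (x [^] j)" and yK: "y \<in> K" by auto
      obtain l a where l: "l \<in> L" and a: "a \<in> carrier R" and y: "y = l \<oplus> a \<otimes> x [^] j" by (rule linE[OF yl])
      have lc: "l \<in> carrier R" and yc: "y \<in> carrier R" and xq: "x [^] (p ^ e) \<in> carrier R"
        using ideal.Icarr[OF iL l] ideal.Icarr[OF K yK] xc by auto
      have "x [^] (p ^ e) \<otimes> y \<in> L"
        using ideal_prod.prod[OF frob_mem[OF Pc xP] yK] FKW WL by blast
      then have "x [^] (p ^ e) \<otimes> y \<ominus> x [^] (p ^ e) \<otimes> l \<in> L"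
        using minus_closed_ideal[OF iL] ideal.I_l_closed[OF iL l xq] by blast
      moreover have "x [^] (p ^ e) \<otimes> y \<ominus> x [^] (p ^ e) \<otimes> l = a \<otimes> (x [^] j \<otimes> x [^] (p ^ e))"
        unfolding y using lc a xj xq by algebra
      ultimately have "a \<in> C (j + p ^ e)" unfolding C_def using a xc by (simp add: nat_pow_mult)
      then have "a \<in> C j" using Cj by simp
      then have "a \<otimes> x [^] j \<in> L" by (simp add: C_def)
      then have "y \<in> L" unfolding y using add_closed_ideal[OF iL l] by blast
      then show "y \<in> W" using yK LK by blast
    qed
    moreover have "L \<subseteq> lin L (carrier R) (x [^] j)" using lin_lower(1)[OF iL oneideal xj] .
    ultimately have "lin L (carrier R) (x [^] j) = L" using max iL' WL unfolding \<A>_def by blast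
    then show ?thesis using generator_mem_lin[OF iL xj] by auto
  qed
  then obtain N where N: "\<forall>y\<in>Y. y [^] (N::nat) \<in> L" using common_power[OF iL Y(2,1)] by blast
  define e' where "e' = max e N"
  have "N < p ^ N" using prime_gt_1_nat[OF prime_p] by (simp add: power_gt_expt)
  also have "p ^ N \<le> p ^ e'" unfolding e'_def using prime_gt_0_nat[OF prime_p] by (intro power_increasing) auto
  finally have "N \<le> p ^ e'" by simp
  then have "frob e' P \<subseteq> L" unfolding Y(3) using N Y(1) pow_mem_ideal_mono[OF iL]
    by (intro frob_Idl_least[OF Y(1) iL]) blast
  then have "T <+> frob e' P \<subseteq> L" using set_add_least[OF iL] FKW(2) WL by blast
  then show ?thesis using LK unfolding W_def e'_def by (intro exI[of _ "max e N"]) auto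
qed

text \<open>Two representations \<open>u = j + a = k + b\<close> put \<open>j - k\<close> into a
  deep Frobenius power of \<open>P\<close> and into \<open>J + K\<close>. Weak Artin--Rees splits it
  as \<open>x + y\<close> with \<open>x \<in> J\<close> and \<open>y \<in> K\<close>, where
  \<open>x\<close> also lies in the shallower power; then \<open>j - x = k + y\<close> is the common
  part of \<open>u\<close>.\<close>

lemma Int_approximation:
  assumes J: "ideal J R" and K: "ideal K R"
  shows "\<exists>e'\<ge>e. (J <+> frob e' P) \<inter> (K <+> frob e' P) \<subseteq> (J \<inter> K) <+> frob e P"
proof -
  note iF = ideal_frob[OF Pc] and iJK = add_ideals[OF J K]
  have "{\<zero>} \<subseteq> J <+> K" using zero_mem_ideal[OF iJK] by blast
  then obtain e' where e': "e' \<ge> e"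
    and AR: "({\<zero>} <+> frob e' P) \<inter> (J <+> K) \<subseteq> {\<zero>} <+> ideal_prod R (frob e P) (J <+> K)"
    using weak_Artin_Rees[OF zeroideal iJK] by blast
  have "u \<in> (J \<inter> K) <+> frob e P" if u: "u \<in> J <+> frob e' P" "u \<in> K <+> frob e' P" for u
  proof -
    obtain j a where j: "j \<in> J" and a: "a \<in> frob e' P" and uj: "u = j \<oplus> a" using u(1) unfolding mem_set_add by blast
    obtain k b where k: "k \<in> K" and b: "b \<in> frob e' P" and uk: "u = k \<oplus> b" using u(2) unfolding mem_set_add by blast
    have c: "j \<in> carrier R" "a \<in> carrier R" "k \<in> carrier R" "b \<in> carrier R"
      using j a k b ideal.Icarr[OF J] ideal.Icarr[OF K] ideal.Icarr[OF iF] by auto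
    have "j \<ominus> k = (j \<oplus> a) \<ominus> k \<ominus> a" using c by algebra
    also have "\<dots> = (k \<oplus> b) \<ominus> k \<ominus> a" using uj uk by simp
    also have "\<dots> = b \<ominus> a" using c by algebra
    finally have jk: "j \<ominus> k = b \<ominus> a" .
    then have "j \<ominus> k \<in> frob e' P" using minus_closed_ideal[OF iF b a] by simp
    then have "j \<ominus> k \<in> {\<zero>} <+> frob e' P" using set_add_lower(2)[OF zeroideal iF] by blast
    moreover have "j \<ominus> k \<in> J <+> K"
      using set_add_lower[OF J K] j k by (intro minus_closed_ideal[OF iJK]) auto
    ultimately have "j \<ominus> k \<in> {\<zero>} <+> ideal_prod R (frob e P) (J <+> K)" using AR by blast
    moreover have "{\<zero>} <+> ideal_prod R (frob e P) (J <+> K) \<subseteq> ideal_prod R (frob e P) (J <+> K)"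
      using ideal_prod_is_ideal[OF iF iJK] zero_mem_ideal by (intro set_add_least) auto
    ultimately have "j \<ominus> k \<in> ideal_prod R (frob e P) J <+> ideal_prod R (frob e P) K"
      using ideal_prod_distr(1)[OF iF J K] by blast
    then obtain x y where x: "x \<in> ideal_prod R (frob e P) J" and y: "y \<in> ideal_prod R (frob e P) K"
      and xy: "j \<ominus> k = x \<oplus> y" unfolding mem_set_add by blast
    have x': "x \<in> frob e P" "x \<in> J" and y': "y \<in> K"
      using x y ideal_prod_inter[OF iF[of e] J] ideal_prod_inter[OF iF[of e] K] by auto
    have xyc: "x \<in> carrier R" "y \<in> carrier R" using ideal.Icarr[OF J x'(2)] ideal.Icarr[OF K y'] by auto
    have "j \<ominus> x = (j \<ominus> k) \<oplus> k \<ominus> x" using c xyc by algebra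
    also have "\<dots> = (x \<oplus> y) \<oplus> k \<ominus> x" unfolding xy ..
    also have "\<dots> = k \<oplus> y" using c xyc by algebra
    finally have "j \<ominus> x \<in> J \<inter> K" using minus_closed_ideal[OF J j x'(2)] add_closed_ideal[OF K k y'] by simp
    moreover have "a \<in> frob e P" using a frob_antimono[OF is_ideal e'] by blast
    then have "x \<oplus> a \<in> frob e P" using add_closed_ideal[OF iF x'(1)] by blast
    moreover have "u = (j \<ominus> x) \<oplus> (x \<oplus> a)" unfolding uj using c xyc by algebra
    ultimately show ?thesis unfolding mem_set_add by blast
  qed
  then show ?thesis using e' by blast
qed

text \<open>Weak Artin--Rees for \<open>T \<subseteq> T + R z\<close> at exponent \<open>0\<close>
  gives \<open>s z = t + c z\<close> with \<open>c \<in> P\<close>, and \<open>s - c\<close> is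
  outside \<open>P\<close>.\<close>

lemma Krull_intersection:
  assumes T: "ideal T R" and z: "\<And>e. z \<in> sat (T <+> frob e P)"
  shows "z \<in> sat T"
proof -
  note iF = ideal_frob[OF Pc]
  have zc: "z \<in> carrier R" using z[of 0] unfolding sat_def by blast
  note iZ = lin_ideal[OF T oneideal zc]
  note TZ = lin_lower(1)[OF T oneideal zc]
  obtain e where AR: "(T <+> frob e P) \<inter> lin T (carrier R) z \<subseteq> T <+> ideal_prod R (frob 0 P) (lin T (carrier R) z)"
    using weak_Artin_Rees[OF T iZ TZ, of 0] by blast
  obtain s where s: "s \<in> carrier R" "s \<notin> P" "s \<otimes> z \<in> T <+> frob e P" using z[of e] by (rule satE)
  have "s \<otimes> z \<in> lin T (carrier R) z" using lin_lower(2)[OF T oneideal zc s(1)] .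
  then have sz: "s \<otimes> z \<in> T <+> ideal_prod R (frob 0 P) (lin T (carrier R) z)" using AR s by blast
  note iL = lin_ideal[OF T is_ideal zc]
  have "frob 0 P \<subseteq> P" by (rule frob_least[OF is_ideal]) (use Icarr in simp)
  then have "q \<otimes> w \<in> lin T P z" if q: "q \<in> frob 0 P" and w: "w \<in> lin T (carrier R) z" for q w
  proof -
    have qP: "q \<in> P" "q \<in> carrier R" using q \<open>frob 0 P \<subseteq> P\<close> Icarr by auto
    obtain t r where t: "t \<in> T" and r: "r \<in> carrier R" and w: "w = t \<oplus> r \<otimes> z" by (rule linE[OF w])
    have tc: "t \<in> carrier R" using ideal.Icarr[OF T t] .
    have "q \<otimes> w = q \<otimes> t \<oplus> (q \<otimes> r) \<otimes> z" unfolding w using qP(2) tc r zc by algebra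
    then show ?thesis using linI[of "q \<otimes> t" T "q \<otimes> r" P z] ideal.I_l_closed[OF T t qP(2)] qP(1) r I_r_closed by simp
  qed
  then have "ideal_prod R (frob 0 P) (lin T (carrier R) z) \<subseteq> lin T P z" by (rule ideal_prod_least[OF iL])
  then have "s \<otimes> z \<in> lin T P z" using sz set_add_least[OF iL lin_lower(1)[OF T is_ideal zc]] by blast
  then obtain t c where t: "t \<in> T" and c: "c \<in> P" and e: "s \<otimes> z = t \<oplus> c \<otimes> z" by (rule linE)
  have tc: "t \<in> carrier R" and cc: "c \<in> carrier R" using ideal.Icarr[OF T t] c Icarr by auto
  have "(s \<ominus> c) \<otimes> z = s \<otimes> z \<ominus> c \<otimes> z" using s(1) cc zc by algebra
  also have "\<dots> = t" unfolding e using tc cc zc by algebra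
  finally have 1: "(s \<ominus> c) \<otimes> z \<in> T" using t by simp
  have "s \<ominus> c \<notin> P"
  proof
    assume "s \<ominus> c \<in> P"
    then have "(s \<ominus> c) \<oplus> c \<in> P" using c by blast
    moreover have "(s \<ominus> c) \<oplus> c = s" using s(1) cc by algebra
    ultimately show False using s by simp
  qed
  then show ?thesis using 1 s(1) cc zc by (intro satI[of _ "s \<ominus> c"]) auto
qed

text \<open>Adding a Frobenius power of \<open>P\<close> brings \<open>J\<close> and
  \<open>K\<close> into the range of \<open>frob_Int_primary\<close>. The error in the intersection
  is absorbed by \<open>frob n P\<close>, and Krull's intersection theorem removes it as
  \<open>n\<close> varies.\<close>

lemma frob_Int_local:
  assumes J: "ideal J R" and K: "ideal K R" and z: "z \<in> frob e J" "z \<in> frob e K"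
  shows "z \<in> sat (frob e (J \<inter> K))"
proof (rule Krull_intersection)
  have iJK: "ideal (J \<inter> K) R" using i_intersect[OF J K] .
  have c: "J \<inter> K \<subseteq> carrier R" using ideal_subset_carrier[OF iJK] .
  show "ideal (frob e (J \<inter> K)) R" using ideal_frob[OF c] .
  note iF = ideal_frob[OF Pc]
  fix n
  obtain e' where e': "(J <+> frob e' P) \<inter> (K <+> frob e' P) \<subseteq> (J \<inter> K) <+> frob n P"
    using Int_approximation[OF J K] by blast
  note iJ' = add_ideals[OF J iF, of e'] and iK' = add_ideals[OF K iF, of e']
  define J' where "J' = sat (J <+> frob e' P)"
  define K' where "K' = sat (K <+> frob e' P)"
  have J': "sat_ideal J'" "J \<subseteq> J'" "sat (frob e' P) \<subseteq> J'" "J' \<subseteq> carrier R"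
    unfolding J'_def using sat_idealI[OF iJ'] set_add_lower[OF J iF, of e'] sat_upper[OF iJ']
      sat_mono[OF set_add_lower(2)[OF J iF, of e']] ideal_subset_carrier[OF ideal_sat[OF iJ']] by auto
  have K': "sat_ideal K'" "K \<subseteq> K'" "sat (frob e' P) \<subseteq> K'" "K' \<subseteq> carrier R"
    unfolding K'_def using sat_idealI[OF iK'] set_add_lower[OF K iF, of e'] sat_upper[OF iK']
      sat_mono[OF set_add_lower(2)[OF K iF, of e']] ideal_subset_carrier[OF ideal_sat[OF iK']] by auto
  have D: "sat_ideal (J' \<inter> K')" "sat (frob e' P) \<subseteq> J' \<inter> K'" using sat_ideal_Int[OF J'(1) K'(1)] J'(3) K'(3) by auto
  have z': "z \<in> sat (frob e J')" "z \<in> sat (frob e K')"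
    using z frob_mono[OF J'(4,2), of e] frob_mono[OF K'(4,2), of e]
      sat_upper[OF ideal_frob[OF J'(4)], of e] sat_upper[OF ideal_frob[OF K'(4)], of e] by auto
  obtain m where m: "wser m (J' \<inter> K') J'"
    using wser_above[OF length_frob(1) D(2) Int_lower1 D(1) J'(1)] by blast
  have "z \<in> sat (frob e (J' \<inter> K'))"
    using frob_Int_primary[OF K'(1) z'(2) m _ _ z'(1) D(2)] by blast
  moreover have "J' \<inter> K' = sat ((J <+> frob e' P) \<inter> (K <+> frob e' P))"
    unfolding J'_def K'_def using sat_Int[OF iJ' iK'] by simp
  moreover note iI = i_intersect[OF iJ' iK']
  ultimately have "z \<in> sat (frob e ((J <+> frob e' P) \<inter> (K <+> frob e' P)))" using sat_frob_sat[OF iI] by simp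
  moreover have "frob e ((J <+> frob e' P) \<inter> (K <+> frob e' P)) \<subseteq> frob e ((J \<inter> K) <+> frob n P)"
    by (rule frob_mono[OF ideal_subset_carrier[OF add_ideals[OF iJK iF]] e'])
  moreover have "\<dots> \<subseteq> frob e (J \<inter> K) <+> frob n P"
  proof -
    \<comment> \<open>A crude bound suffices, since \<open>n\<close> is arbitrary.\<close>
    have fn: "frob e (frob n P) \<subseteq> frob n P"
    proof (rule frob_least[OF iF])
      fix f assume f: "f \<in> frob n P"
      have fc: "f \<in> carrier R" using ideal.Icarr[OF iF f] .
      have "f [^] (1::nat) \<in> frob n P" using f fc by simp
      then show "f [^] (p ^ e) \<in> frob n P" 
        by (rule pow_mem_ideal_mono[OF iF fc]) (use frob_pos[of e] in linarith)
    qed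
    then have "frob e (J \<inter> K) <+> frob e (frob n P) \<subseteq> frob e (J \<inter> K) <+> frob n P" unfolding set_add_def' by blast
    then show ?thesis using frob_set_add[OF iJK iF] by blast
  qed
  ultimately show "z \<in> sat (frob e (J \<inter> K) <+> frob n P)" using sat_mono by blast
qed

end

section \<open>Descent from the localization\<close>

context prime_localization
begin

section \<open>Arithmetic of fractions\<close>

abbreviation S :: "'a set" where "S \<equiv> carrier R - P"
abbreviation frac :: "'a \<Rightarrow> 'a \<Rightarrow> ('a \<times> 'a) set" where "frac r s \<equiv> fraction R S r s"
abbreviation RP :: "('a \<times> 'a) set ring" where "RP \<equiv> localization R S"

lemma one_S: "\<one> \<in> S" using one_not_in by simp

lemma frac_eqI:
  assumes r: "r \<in> carrier R" "s \<in> S" and r': "r' \<in> carrier R" "s' \<in> S"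
    and t: "t \<in> S" "t \<otimes> (r \<otimes> s') = t \<otimes> (r' \<otimes> s)"
  shows "frac r s = frac r' s'"
proof -
  have sub: "frac r s \<subseteq> frac r' s'"
    if r: "r \<in> carrier R" "s \<in> S" and r': "r' \<in> carrier R" "s' \<in> S"
      and t: "t \<in> S" "t \<otimes> (r \<otimes> s') = t \<otimes> (r' \<otimes> s)" for r s r' s'
  proof
    fix x assume "x \<in> frac r s"
    then obtain a b v where x: "x = (a, b)" and a: "a \<in> carrier R" "b \<in> S" "v \<in> S"
      and v: "v \<otimes> (r \<otimes> b) = v \<otimes> (a \<otimes> s)" unfolding fraction_def by blast
    have c: "s \<in> carrier R" "s' \<in> carrier R" "t \<in> carrier R" "b \<in> carrier R" "v \<in> carrier R"
      using r r' t a by auto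
    have "(v \<otimes> t \<otimes> s) \<otimes> (r' \<otimes> b) = v \<otimes> b \<otimes> (t \<otimes> (r' \<otimes> s))" using c r(1) r'(1) a(1) by algebra
    also have "\<dots> = v \<otimes> b \<otimes> (t \<otimes> (r \<otimes> s'))" using t(2) by simp
    also have "\<dots> = t \<otimes> s' \<otimes> (v \<otimes> (r \<otimes> b))" using c r(1) r'(1) a(1) by algebra
    also have "\<dots> = t \<otimes> s' \<otimes> (v \<otimes> (a \<otimes> s))" using v by simp
    also have "\<dots> = (v \<otimes> t \<otimes> s) \<otimes> (a \<otimes> s')" using c r(1) r'(1) a(1) by algebra
    finally have "(v \<otimes> t \<otimes> s) \<otimes> (r' \<otimes> b) = (v \<otimes> t \<otimes> s) \<otimes> (a \<otimes> s')" .
    moreover have "v \<otimes> t \<otimes> s \<in> S" using mult_not_in a(3) t(1) r(2) by blast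
    ultimately show "x \<in> frac r' s'" unfolding x fraction_def using a by blast
  qed
  show ?thesis using sub[OF r r' t] sub[OF r' r t(1) t(2)[symmetric]] by blast
qed

lemma frac_self: "r \<in> carrier R \<Longrightarrow> s \<in> S \<Longrightarrow> (r, s) \<in> frac r s"
  unfolding fraction_def using one_S by blast

lemma mem_fracD:
  assumes "(a, b) \<in> frac r s"
  obtains t where "a \<in> carrier R" "b \<in> S" "t \<in> S" "t \<otimes> (r \<otimes> b) = t \<otimes> (a \<otimes> s)"
  using assms unfolding fraction_def by blast

lemma frac_eqD:
  assumes "frac r s = frac r' s'" "r \<in> carrier R" "s \<in> S"
  obtains t where "t \<in> S" "t \<otimes> (r' \<otimes> s) = t \<otimes> (r \<otimes> s')"
proof -
  have "(r, s) \<in> frac r' s'" using frac_self[OF assms(2,3)] assms(1) by simp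
  then show ?thesis using that by (rule mem_fracD)
qed

text \<open>The union in the definition runs over all representatives; each contributes the same
  class, and \<open>frac_self\<close> makes the union nonempty.\<close>

lemma RP_mult:
  assumes r: "r \<in> carrier R" "s \<in> S" "r' \<in> carrier R" "s' \<in> S"
  shows "frac r s \<otimes>\<^bsub>RP\<^esub> frac r' s' = frac (r \<otimes> r') (s \<otimes> s')"
proof -
  have "frac (a \<otimes> a') (b \<otimes> b') = frac (r \<otimes> r') (s \<otimes> s')"
    if ab: "(a, b) \<in> frac r s" and ab': "(a', b') \<in> frac r' s'" for a b a' b'
  proof -
    obtain t where t: "a \<in> carrier R" "b \<in> S" "t \<in> S" "t \<otimes> (r \<otimes> b) = t \<otimes> (a \<otimes> s)" using ab by (rule mem_fracD)
    obtain t' where t': "a' \<in> carrier R" "b' \<in> S" "t' \<in> S" "t' \<otimes> (r' \<otimes> b') = t' \<otimes> (a' \<otimes> s')"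
      using ab' by (rule mem_fracD)
    have c: "b \<in> carrier R" "b' \<in> carrier R" "t \<in> carrier R" "t' \<in> carrier R" "s \<in> carrier R" "s' \<in> carrier R"
      using t t' r by auto
    have "(t \<otimes> t') \<otimes> ((a \<otimes> a') \<otimes> (s \<otimes> s')) = (t \<otimes> (a \<otimes> s)) \<otimes> (t' \<otimes> (a' \<otimes> s'))"
      using c t(1) t'(1) by algebra
    also have "\<dots> = (t \<otimes> (r \<otimes> b)) \<otimes> (t' \<otimes> (r' \<otimes> b'))" using t(4) t'(4) by simp
    also have "\<dots> = (t \<otimes> t') \<otimes> ((r \<otimes> r') \<otimes> (b \<otimes> b'))" using c r(1,3) by algebra
    finally have e: "(t \<otimes> t') \<otimes> ((a \<otimes> a') \<otimes> (s \<otimes> s')) = (t \<otimes> t') \<otimes> ((r \<otimes> r') \<otimes> (b \<otimes> b'))" .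
    have m: "t \<otimes> t' \<in> S" "b \<otimes> b' \<in> S" "s \<otimes> s' \<in> S" using mult_not_in t(2,3) t'(2,3) r(2,4) by blast+
    show ?thesis using t t' r m e by (intro frac_eqI) auto
  qed
  then have "(\<Union>(a, b)\<in>frac r s. \<Union>(a', b')\<in>frac r' s'. frac (a \<otimes> a') (b \<otimes> b')) = frac (r \<otimes> r') (s \<otimes> s')"
    using frac_self[OF r(1,2)] frac_self[OF r(3,4)] by fast
  then show ?thesis by (simp add: localization_def)
qed

lemma RP_add:
  assumes r: "r \<in> carrier R" "s \<in> S" "r' \<in> carrier R" "s' \<in> S"
  shows "frac r s \<oplus>\<^bsub>RP\<^esub> frac r' s' = frac (r \<otimes> s' \<oplus> r' \<otimes> s) (s \<otimes> s')"
proof -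
  have "frac (a \<otimes> b' \<oplus> a' \<otimes> b) (b \<otimes> b') = frac (r \<otimes> s' \<oplus> r' \<otimes> s) (s \<otimes> s')"
    if ab: "(a, b) \<in> frac r s" and ab': "(a', b') \<in> frac r' s'" for a b a' b'
  proof -
    obtain t where t: "a \<in> carrier R" "b \<in> S" "t \<in> S" "t \<otimes> (r \<otimes> b) = t \<otimes> (a \<otimes> s)" using ab by (rule mem_fracD)
    obtain t' where t': "a' \<in> carrier R" "b' \<in> S" "t' \<in> S" "t' \<otimes> (r' \<otimes> b') = t' \<otimes> (a' \<otimes> s')"
      using ab' by (rule mem_fracD)
    have c: "b \<in> carrier R" "b' \<in> carrier R" "t \<in> carrier R" "t' \<in> carrier R" "s \<in> carrier R" "s' \<in> carrier R"
      using t t' r by auto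
    have "(t \<otimes> t') \<otimes> ((a \<otimes> b' \<oplus> a' \<otimes> b) \<otimes> (s \<otimes> s'))
        = (t \<otimes> (a \<otimes> s)) \<otimes> (t' \<otimes> b' \<otimes> s') \<oplus> (t' \<otimes> (a' \<otimes> s')) \<otimes> (t \<otimes> b \<otimes> s)"
      using c t(1) t'(1) by algebra
    also have "\<dots> = (t \<otimes> (r \<otimes> b)) \<otimes> (t' \<otimes> b' \<otimes> s') \<oplus> (t' \<otimes> (r' \<otimes> b')) \<otimes> (t \<otimes> b \<otimes> s)"
      using t(4) t'(4) by simp
    also have "\<dots> = (t \<otimes> t') \<otimes> ((r \<otimes> s' \<oplus> r' \<otimes> s) \<otimes> (b \<otimes> b'))" using c r(1,3) by algebra
    finally have e: "(t \<otimes> t') \<otimes> ((a \<otimes> b' \<oplus> a' \<otimes> b) \<otimes> (s \<otimes> s')) = (t \<otimes> t') \<otimes> ((r \<otimes> s' \<oplus> r' \<otimes> s) \<otimes> (b \<otimes> b'))" .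
    have m: "t \<otimes> t' \<in> S" "b \<otimes> b' \<in> S" "s \<otimes> s' \<in> S" using mult_not_in t(2,3) t'(2,3) r(2,4) by blast+
    show ?thesis using t t' r m e by (intro frac_eqI) auto
  qed
  then have "(\<Union>(a, b)\<in>frac r s. \<Union>(a', b')\<in>frac r' s'. frac (a \<otimes> b' \<oplus> a' \<otimes> b) (b \<otimes> b'))
      = frac (r \<otimes> s' \<oplus> r' \<otimes> s) (s \<otimes> s')"
    using frac_self[OF r(1,2)] frac_self[OF r(3,4)] by fast
  then show ?thesis by (simp add: localization_def)
qed

lemma RP_one: "\<one>\<^bsub>RP\<^esub> = frac \<one> \<one>" and RP_zero: "\<zero>\<^bsub>RP\<^esub> = frac \<zero> \<one>"
  by (simp_all add: localization_def)

lemma frac_carrier: "r \<in> carrier R \<Longrightarrow> s \<in> S \<Longrightarrow> frac r s \<in> carrier RP"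
  unfolding localization_def by auto

lemma RP_carrierE:
  assumes "u \<in> carrier RP" obtains r s where "r \<in> carrier R" "s \<in> S" "u = frac r s"
  using assms unfolding localization_def by auto

lemma frac_unit: assumes "s \<in> S" shows "frac s s = \<one>\<^bsub>RP\<^esub>"
  unfolding RP_one using assms one_S by (intro frac_eqI[of _ _ _ _ \<one>]) auto

lemma frac_split:
  assumes "r \<in> carrier R" "s \<in> S"
  shows "frac r \<one> = frac r s \<otimes>\<^bsub>RP\<^esub> frac s \<one>" "frac r s = frac r \<one> \<otimes>\<^bsub>RP\<^esub> frac \<one> s"
proof -
  have s: "s \<in> carrier R" using assms by simp
  have "frac r s \<otimes>\<^bsub>RP\<^esub> frac s \<one> = frac (r \<otimes> s) s" using assms s one_S by (simp add: RP_mult)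
  also have "\<dots> = frac r \<one>" using assms s one_S by (intro frac_eqI[of _ _ _ _ \<one>]) (auto simp: m_ac)
  finally show "frac r \<one> = frac r s \<otimes>\<^bsub>RP\<^esub> frac s \<one>" by simp
  show "frac r s = frac r \<one> \<otimes>\<^bsub>RP\<^esub> frac \<one> s" using assms s one_S by (simp add: RP_mult)
qed

section \<open>Extension and contraction of ideals\<close>

definition extension :: "'a set \<Rightarrow> ('a \<times> 'a) set set" where
  "extension J = {frac r s | r s. r \<in> J \<and> s \<in> S}"

definition contraction :: "('a \<times> 'a) set set \<Rightarrow> 'a set" where
  "contraction Q = {r \<in> carrier R. frac r \<one> \<in> Q}"

text \<open>The ring axioms for \<open>RP\<close> are a hypothesis, supplied later by
  \<open>regular_local_ring\<close>; what remains is closure of the set of fractions.\<close>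

lemma ideal_extension:
  assumes RP: "cring RP" and J: "ideal J R" shows "ideal (extension J) RP"
proof -
  interpret RP: cring RP by (rule RP)
  note Jc = ideal.Icarr[OF J]
  show ?thesis
  proof (rule RP.idealI_cring)
    show "extension J \<subseteq> carrier RP" unfolding extension_def using frac_carrier Jc by auto
    show "\<zero>\<^bsub>RP\<^esub> \<in> extension J" unfolding extension_def RP_zero using zero_mem_ideal[OF J] one_S by blast
    show "a \<oplus>\<^bsub>RP\<^esub> b \<in> extension J" if a: "a \<in> extension J" and b: "b \<in> extension J" for a b
    proof -
      obtain r s where rs: "r \<in> J" "s \<in> S" "a = frac r s" using a unfolding extension_def by blast
      obtain r' s' where rs': "r' \<in> J" "s' \<in> S" "b = frac r' s'" using b unfolding extension_def by blast
      have c: "s \<in> carrier R" "s' \<in> carrier R" using rs rs' by auto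
      have "a \<oplus>\<^bsub>RP\<^esub> b = frac (r \<otimes> s' \<oplus> r' \<otimes> s) (s \<otimes> s')"
        unfolding rs(3) rs'(3) using rs rs' Jc by (intro RP_add) auto
      moreover have "r \<otimes> s' \<oplus> r' \<otimes> s \<in> J" using rs(1) rs'(1) c J by (simp add: ideal_ops)
      moreover have "s \<otimes> s' \<in> S" using mult_not_in rs(2) rs'(2) by blast
      ultimately show ?thesis unfolding extension_def by blast
    qed
    show "x \<otimes>\<^bsub>RP\<^esub> a \<in> extension J" if a: "a \<in> extension J" and x: "x \<in> carrier RP" for a x
    proof -
      obtain r s where rs: "r \<in> J" "s \<in> S" "a = frac r s" using a unfolding extension_def by blast
      obtain r' s' where rs': "r' \<in> carrier R" "s' \<in> S" "x = frac r' s'" using x by (rule RP_carrierE)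
      have "x \<otimes>\<^bsub>RP\<^esub> a = frac (r' \<otimes> r) (s' \<otimes> s)"
        unfolding rs(3) rs'(3) using rs rs' Jc by (intro RP_mult) auto
      moreover have "r' \<otimes> r \<in> J" using rs(1) rs'(1) J by (simp add: ideal_ops)
      moreover have "s' \<otimes> s \<in> S" using mult_not_in rs(2) rs'(2) by blast
      ultimately show ?thesis unfolding extension_def by blast
    qed
  qed
qed

lemma frac_mem_extensionD:
  assumes J: "ideal J R" and r: "r \<in> carrier R" and "frac r \<one> \<in> extension J" shows "r \<in> sat J"
proof -
  obtain j s where j: "j \<in> J" "s \<in> S" "frac r \<one> = frac j s" using assms(3) unfolding extension_def by blast
  obtain t where t: "t \<in> S" "t \<otimes> (j \<otimes> \<one>) = t \<otimes> (r \<otimes> s)" using frac_eqD[OF j(3) r one_S] .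
  have jc: "j \<in> carrier R" using ideal.Icarr[OF J j(1)] .
  have "(t \<otimes> s) \<otimes> r = t \<otimes> (r \<otimes> s)" using t(1) j(2) r by (simp add: m_ac)
  also have "\<dots> = t \<otimes> j" using t(2) jc by simp
  also have "\<dots> \<in> J" using ideal.I_l_closed[OF J j(1)] t(1) by simp
  finally show ?thesis using mult_not_in[OF t(1) j(2)] r by (intro satI[of _ "t \<otimes> s"]) auto
qed

text \<open>If the numerator were outside \<open>P\<close>, the fraction \<open>s / r\<close> would
  be an inverse, and the ideal would not be proper.\<close>

lemma frac_mem_ideal_imp_prime:
  assumes Q: "ideal Q RP" "Q \<noteq> carrier RP" and r: "r \<in> carrier R" "s \<in> S" "frac r s \<in> Q"
  shows "r \<in> P"
proof (rule ccontr)
  assume "r \<notin> P"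
  then have rS: "r \<in> S" using r by simp
  have sc: "s \<in> carrier R" using r by simp
  interpret Q: ideal Q RP by (rule Q(1))
  have "frac r s \<otimes>\<^bsub>RP\<^esub> frac s r = frac (r \<otimes> s) (r \<otimes> s)" using r rS sc by (simp add: RP_mult m_comm)
  also have "\<dots> = \<one>\<^bsub>RP\<^esub>" by (rule frac_unit[OF mult_not_in[OF rS r(2)]])
  finally have "\<one>\<^bsub>RP\<^esub> \<in> Q" using Q.I_r_closed[OF r(3) frac_carrier[OF sc rS]] by simp
  then show False using Q.one_imp_carrier Q(2) by blast
qed

lemma contraction_prime:
  assumes Q: "primeideal Q RP" shows "primeideal (contraction Q) R" "contraction Q \<subseteq> P"
proof -
  interpret Q: primeideal Q RP by (rule Q)
  have iQ: "ideal Q RP" "Q \<noteq> carrier RP" using Q.is_ideal Q.I_notcarr by auto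
  show "contraction Q \<subseteq> P"
    using frac_mem_ideal_imp_prime[OF iQ _ one_S] unfolding contraction_def by blast
  then have one: "\<one> \<notin> contraction Q" using one_not_in by blast
  have mult: "frac (a \<otimes> b) \<one> = frac a \<one> \<otimes>\<^bsub>RP\<^esub> frac b \<one>" if "a \<in> carrier R" "b \<in> carrier R" for a b
    using that one_S by (simp add: RP_mult)
  show "primeideal (contraction Q) R"
  proof (rule primeidealI)
    show "ideal (contraction Q) R"
    proof (rule idealI_cring)
      show "contraction Q \<subseteq> carrier R" unfolding contraction_def by blast
      show "\<zero> \<in> contraction Q" unfolding contraction_def using Q.zero_mem_ideal[OF Q.is_ideal] RP_zero by simp
      show "a \<oplus> b \<in> contraction Q" if "a \<in> contraction Q" "b \<in> contraction Q" for a b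
      proof -
        have ab: "a \<in> carrier R" "b \<in> carrier R" using that unfolding contraction_def by auto
        have "frac a \<one> \<oplus>\<^bsub>RP\<^esub> frac b \<one> = frac (a \<oplus> b) \<one>" using ab one_S by (simp add: RP_add)
        then have "frac (a \<oplus> b) \<one> \<in> Q"
          using Q.add_closed_ideal[OF Q.is_ideal] that unfolding contraction_def by (metis (lifting) mem_Collect_eq)
        then show ?thesis using ab unfolding contraction_def by simp
      qed
      show "x \<otimes> a \<in> contraction Q" if "a \<in> contraction Q" "x \<in> carrier R" for a x
        using that mult[of x a] Q.I_l_closed frac_carrier[OF _ one_S] unfolding contraction_def by simp
    qed
    show "cring R" by (rule is_cring)
    show "carrier R \<noteq> contraction Q" using one by blast
    show "a \<in> contraction Q \<or> b \<in> contraction Q"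
      if "a \<in> carrier R" "b \<in> carrier R" "a \<otimes> b \<in> contraction Q" for a b
      using that mult[of a b] Q.I_prime[of "frac a \<one>" "frac b \<one>"] frac_carrier[OF _ one_S]
      unfolding contraction_def by simp
  qed
qed

lemma contraction_strict:
  assumes Q: "ideal Q RP" and Q': "ideal Q' RP" and lt: "Q \<subset> Q'"
  shows "contraction Q \<subset> contraction Q'"
proof -
  obtain u where u: "u \<in> Q'" "u \<notin> Q" using lt by blast
  obtain r s where rs: "r \<in> carrier R" "s \<in> S" "u = frac r s"
    using ideal.Icarr[OF Q' u(1)] by (rule RP_carrierE)
  have sc: "s \<in> carrier R" using rs by simp
  have "frac r \<one> \<in> Q'"
    using ideal.I_r_closed[OF Q' u(1) frac_carrier[OF sc one_S]] frac_split(1)[OF rs(1,2)] rs(3) by simp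
  moreover have "frac r \<one> \<notin> Q"
    using ideal.I_r_closed[OF Q _ frac_carrier[OF one_closed rs(2)]] frac_split(2)[OF rs(1,2)] rs(3) u(2) by metis
  ultimately have "r \<in> contraction Q'" "r \<notin> contraction Q" unfolding contraction_def using rs by auto
  then show ?thesis using lt unfolding contraction_def by blast
qed

text \<open>The numerators of the given generators will do. By maximality the given ideal is the
  extension of \<open>P\<close>, and contracting back gives the saturation. Two generators may share
  a numerator, hence only \<open>card X \<le> card X'\<close>.\<close>

lemma maximal_ideal_generators:
  assumes RP: "cring RP" and X': "X' \<subseteq> carrier RP" "finite X'" and max: "maximalideal (Idl\<^bsub>RP\<^esub> X') RP"
  shows "\<exists>X. finite X \<and> X \<subseteq> P \<and> card X \<le> card X' \<and> P \<subseteq> sat (Idl X)"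
proof -
  interpret RP: cring RP by (rule RP)
  interpret M: maximalideal "Idl\<^bsub>RP\<^esub> X'" RP by (rule max)
  have "\<forall>u\<in>X'. \<exists>r. r \<in> carrier R \<and> (\<exists>s\<in>S. u = frac r s)"
  proof
    fix u assume "u \<in> X'"
    then have "u \<in> carrier RP" using X'(1) by blast
    then obtain r s where "r \<in> carrier R" "s \<in> S" "u = frac r s" by (rule RP_carrierE)
    then show "\<exists>r. r \<in> carrier R \<and> (\<exists>s\<in>S. u = frac r s)" by blast
  qed
  then obtain n where "\<forall>u\<in>X'. n u \<in> carrier R \<and> (\<exists>s\<in>S. u = frac (n u) s)" by (rule bchoice[THEN exE])
  then have n: "\<And>u. u \<in> X' \<Longrightarrow> n u \<in> carrier R" "\<And>u. u \<in> X' \<Longrightarrow> \<exists>s\<in>S. u = frac (n u) s" by auto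
  have nP: "n u \<in> P" if u: "u \<in> X'" for u
  proof -
    obtain s where s: "s \<in> S" "u = frac (n u) s" using n(2)[OF u] by blast
    have "u \<in> Idl\<^bsub>RP\<^esub> X'" using RP.genideal_self[OF X'(1)] u by blast
    then show ?thesis
      using frac_mem_ideal_imp_prime[OF M.is_ideal _ n(1)[OF u] s(1)] M.I_notcarr s(2) by metis
  qed
  define X where "X = n ` X'"
  have X: "X \<subseteq> P" "X \<subseteq> carrier R" unfolding X_def using nP Icarr by auto
  note iX = genideal_ideal[OF X(2)]
  have sub: "Idl\<^bsub>RP\<^esub> X' \<subseteq> extension J" if J: "ideal J R" "X \<subseteq> J" for J
  proof (rule RP.genideal_minimal[OF ideal_extension[OF RP J(1)]])
    show "X' \<subseteq> extension J"
    proof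
      fix u assume u: "u \<in> X'"
      obtain s where "s \<in> S" "u = frac (n u) s" using n(2)[OF u] by blast
      moreover have "n u \<in> J" using J(2) u unfolding X_def by blast
      ultimately show "u \<in> extension J" unfolding extension_def by blast
    qed
  qed
  have "\<one>\<^bsub>RP\<^esub> \<notin> extension P"
    using frac_mem_extensionD[OF is_ideal one_closed] sat_ideal_eq[OF sat_ideal_prime[OF primeideal subset_refl]]
      one_not_in unfolding RP_one by blast
  then have "extension P \<noteq> carrier RP" using RP.one_closed by blast
  then have ext: "Idl\<^bsub>RP\<^esub> X' = extension P"
    using M.I_maximal[OF ideal_extension[OF RP is_ideal] sub[OF is_ideal X(1)]]
      ideal.Icarr[OF ideal_extension[OF RP is_ideal]] by blast
  have "P \<subseteq> sat (Idl X)"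
  proof
    fix a assume a: "a \<in> P"
    then have "frac a \<one> \<in> extension P" unfolding extension_def using one_S by blast
    then have "frac a \<one> \<in> extension (Idl X)" using sub[OF iX genideal_self[OF X(2)]] ext by blast
    then show "a \<in> sat (Idl X)" using frac_mem_extensionD[OF iX] a Icarr by blast
  qed
  moreover have "card X \<le> card X'" unfolding X_def by (rule card_image_le[OF X'(2)])
  moreover have "finite X" unfolding X_def using X'(2) by simp
  ultimately show ?thesis using X(1) by blast
qed

end

text \<open>A finite nonzero supremum in \<open>enat\<close> is attained. The assumed prime covers
  \<open>d = 0\<close>, a value that the empty supremum takes too.\<close>

lemma krull_dim_attained:
  assumes dim: "krull_dim A = enat d" and ex: "\<exists>M. primeideal M A"
  shows "\<exists>Q :: nat \<Rightarrow> 'a set. (\<forall>i\<le>d. primeideal (Q i) A) \<and> (\<forall>i<d. Q i \<subset> Q (Suc i))"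
proof (cases d)
  case 0
  then show ?thesis using ex by auto
next
  case (Suc k)
  show ?thesis
  proof (rule ccontr)
    assume no: "\<not> ?thesis"
    have "krull_dim A \<le> enat k"
      unfolding krull_dim_def
    proof (rule Sup_least)
      fix x assume x: "x \<in> {enat n | n. \<exists>P :: nat \<Rightarrow> 'a set. (\<forall>i\<le>n. primeideal (P i) A) \<and> (\<forall>i<n. P i \<subset> P (Suc i))}"
      then obtain n and Q :: "nat \<Rightarrow> 'a set" where n: "x = enat n" and
        Q: "\<forall>i\<le>n. primeideal (Q i) A" "\<forall>i<n. Q i \<subset> Q (Suc i)" by blast
      have "x \<le> krull_dim A" unfolding krull_dim_def using x by (rule Sup_upper)
      then have "n \<le> d" using n dim by simp
      moreover have "n \<noteq> d" using no Q by blast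
      ultimately show "x \<le> enat k" using n Suc by simp
    qed
    then show False using dim Suc by simp
  qed
qed

context noetherian_localization
begin

text \<open>Shortens the chain while keeping its top: adjoining the element \<open>\<zero>\<close>
  has the sole effect that \<open>prime_chain_lin\<close> gives up one inclusion.\<close>

lemma prime_chain_drop: assumes "prime_chain {\<zero>} (Suc n) Q" shows "prime_chain {\<zero>} n Q"
proof -
  have Q: "primeideal Q R" "{\<zero>} \<subseteq> Q" using prime_chain_top[OF assms] by auto
  have "prime_chain (lin {\<zero>} (carrier R) \<zero>) n Q" using prime_chain_lin[OF zeroideal assms] Q(2) by blast
  then show ?thesis using prime_chain_mono lin_lower(1)[OF zeroideal oneideal zero_closed] by blast
qed

lemma prime_chain_of_localization:
  assumes pr: "\<forall>i\<le>n. primeideal (Q i) RP" and lt: "\<forall>i<n. Q i \<subset> Q (Suc i)"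
  shows "prime_chain {\<zero>} n P"
proof -
  have "k \<le> n \<Longrightarrow> prime_chain {\<zero>} k (contraction (Q k))" for k
  proof (induction k)
    case 0
    have p: "primeideal (contraction (Q 0)) R" using contraction_prime(1) pr by blast
    then show ?case using zero_mem_ideal[OF primeideal.axioms(1)[OF p]] by (intro prime_chain.base) auto
  next
    case (Suc k)
    have "primeideal (contraction (Q (Suc k))) R" using contraction_prime(1) pr Suc.prems by blast
    moreover have "contraction (Q k) \<subset> contraction (Q (Suc k))"
      using contraction_strict primeideal.axioms(1) pr lt Suc.prems by (metis Suc_leD Suc_le_lessD)
    ultimately show ?case using prime_chain.snoc Suc by (metis Suc_leD)
  qed
  then have ch: "prime_chain {\<zero>} n (contraction (Q n))" by simp
  have "contraction (Q n) \<subseteq> P" using contraction_prime(2) pr by blast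
  \<comment> \<open>If the contracted top is strictly below \<open>P\<close>, then \<open>P\<close>
    is appended and one inclusion dropped again.\<close>
  then show ?thesis
    using ch prime_chain_drop[OF prime_chain.snoc[OF ch _ primeideal]] by (cases "contraction (Q n) = P") auto
qed

text \<open>Numerators give at most as many generators as the dimension of \<open>RP\<close>, and a
  longest prime chain of \<open>RP\<close> contracts to one of the same length ending in
  \<open>P\<close>; the height theorem forces the two numbers to agree.\<close>

lemma regular_generators:
  assumes "regular_local_ring RP"
  shows "\<exists>X. finite X \<and> X \<subseteq> P \<and> prime_chain {\<zero>} (card X) P \<and> P \<subseteq> sat (Idl X)"
proof -
  obtain X' where RP: "cring RP" and X': "X' \<subseteq> carrier RP" "finite X'" "enat (card X') = krull_dim RP"
    and max: "maximalideal (Idl\<^bsub>RP\<^esub> X') RP"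
    using assms unfolding regular_local_ring_def local_ring_def by blast
  obtain X where X: "finite X" "X \<subseteq> P" "card X \<le> card X'" "P \<subseteq> sat (Idl X)"
    using maximal_ideal_generators[OF RP X'(1,2) max] by blast
  have "\<exists>M. primeideal M RP" using cring.maximalideal_prime[OF RP max] by blast
  then obtain Q :: "nat \<Rightarrow> ('a \<times> 'a) set set" where Q: "\<forall>i\<le>card X'. primeideal (Q i) RP" "\<forall>i<card X'. Q i \<subset> Q (Suc i)"
    using krull_dim_attained[OF X'(3)[symmetric]] by blast
  have ch: "prime_chain {\<zero>} (card X') P" using prime_chain_of_localization[OF Q] .
  have Xc: "X \<subseteq> carrier R" using X(2) Icarr by blast
  note iX = genideal_ideal[OF Xc]
  have "P \<subseteq> sat ({\<zero>} <+> Idl X)" using X(4) sat_mono[OF set_add_lower(2)[OF zeroideal iX]] by blast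
  then have "card X' \<le> card X" using prime_chain_le_card[OF X(1,2) zeroideal ch] by blast
  then have "card X' = card X" using X(3) by simp
  then show ?thesis using X ch by auto
qed

end

context char_localization
begin

text \<open>Locally the Frobenius power of \<open>P\<close> is generated by the powers of the
  generators, so \<open>d\<close> is the number of generators.\<close>

lemma regular_frobenius_localization:
  assumes "regular_local_ring RP" shows "\<exists>d. frobenius_localization P R p d"
proof -
  obtain X where X: "finite X" "X \<subseteq> P" "prime_chain {\<zero>} (card X) P" "P \<subseteq> sat (Idl X)"
    using regular_generators[OF assms] by blast
  have Xc: "X \<subseteq> carrier R" using X(2) Pc by blast
  note iX = genideal_ideal[OF Xc]
  have gen: "P = sat (Idl X)"
    using X(4) sat_least[OF sat_ideal_prime[OF primeideal subset_refl] genideal_minimal[OF is_ideal X(2)]] by blast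
  have "sat (frob e P) = sat (Idl ((\<lambda>x. x [^] (p ^ e)) ` X))" for e
  proof -
    have qc: "(\<lambda>x. x [^] (p ^ e)) ` X \<subseteq> carrier R" using Xc by auto
    have c: "Idl X \<subseteq> carrier R" using ideal_subset_carrier[OF iX] .
    have "frob e (Idl X) = Idl ((\<lambda>x. x [^] (p ^ e)) ` X)"
    proof
      show "frob e (Idl X) \<subseteq> Idl ((\<lambda>x. x [^] (p ^ e)) ` X)"
        using genideal_self[OF qc] by (intro frob_Idl_least[OF Xc genideal_ideal[OF qc]]) auto
      show "Idl ((\<lambda>x. x [^] (p ^ e)) ` X) \<subseteq> frob e (Idl X)"
        using frob_mem[OF c] genideal_self[OF Xc] by (intro genideal_minimal[OF ideal_frob[OF c]]) auto
    qed
    moreover have "sat (frob e (sat (Idl X))) = sat (frob e (Idl X))" using sat_frob_sat[OF iX] .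
    ultimately show ?thesis using gen by simp
  qed
  then have "wser ((p ^ e) ^ card X) (sat (frob e P)) (carrier R)"
    "schain ((p ^ e) ^ card X) (sat (frob e P)) (carrier R)" for e
    using length_generator_powers[OF X, of "p ^ e"] by simp_all
  then have "frobenius_localization P R p (card X)" by unfold_locales
  then show ?thesis by blast
qed

end

locale noetherian_prime_char = noetherian_cring R + prime_char_cring R p for R (structure) and p
begin

lemma ex_prime_above:
  assumes C: "ideal C R" "C \<noteq> carrier R" shows "\<exists>M. primeideal M R \<and> C \<subseteq> M"
proof -
  define \<A> where "\<A> = {L. ideal L R \<and> C \<subseteq> L \<and> L \<noteq> carrier R}"
  have "\<exists>M\<in>\<A>. \<forall>K\<in>\<A>. M \<subseteq> K \<longrightarrow> K = M"
    by (rule ex_maximal_ideal_in) (use C in \<open>auto simp: \<A>_def\<close>)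
  then obtain M where M: "M \<in> \<A>" and max: "\<forall>K\<in>\<A>. M \<subseteq> K \<longrightarrow> K = M" by (rule bexE)
  have M': "ideal M R" "C \<subseteq> M" "M \<noteq> carrier R" using M unfolding \<A>_def by auto
  have "maximalideal M R"
  proof (rule maximalidealI[OF M'(1)])
    show "carrier R \<noteq> M" using M'(3) by blast
    show "J = M \<or> J = carrier R" if "ideal J R" "M \<subseteq> J" "J \<subseteq> carrier R" for J
      using max that M'(2) unfolding \<A>_def by blast
  qed
  then show ?thesis using maximalideal_prime M'(2) by blast
qed

text \<open>Local to global: the elements multiplying \<open>z\<close> into the right-hand side form
  an ideal. If it were proper it would lie in a prime \<open>M\<close>, but the inclusion at
  \<open>M\<close> provides such an element outside \<open>M\<close>.\<close>

lemma frob_Int: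
  assumes reg: "regular_ring R" and J: "ideal J R" and K: "ideal K R"
  shows "frob e J \<inter> frob e K \<subseteq> frob e (J \<inter> K)"
proof
  fix z assume z: "z \<in> frob e J \<inter> frob e K"
  have iJK: "ideal (J \<inter> K) R" using i_intersect[OF J K] .
  note iT = ideal_frob[OF ideal_subset_carrier[OF iJK], of e]
  have zc: "z \<in> carrier R" using z ideal.Icarr[OF ideal_frob[OF ideal_subset_carrier[OF J]]] by blast
  define C where "C = {r \<in> carrier R. r \<otimes> z \<in> frob e (J \<inter> K)}"
  have iC: "ideal C R" unfolding C_def by (rule ideal_colon[OF iT zc])
  have "C = carrier R"
  proof (rule ccontr)
    assume "C \<noteq> carrier R"
    then obtain M where M: "primeideal M R" "C \<subseteq> M" using ex_prime_above[OF iC] by blast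
    interpret M: char_localization M R p
      using noetherian_localization[OF M(1)] prime_char_cring_axioms by (rule char_localization.intro)
    obtain d where "frobenius_localization M R p d"
      using M.regular_frobenius_localization reg M(1) unfolding regular_ring_def by blast
    then interpret M: frobenius_localization M R p d .
    have "z \<in> M.sat (frob e (J \<inter> K))" using M.frob_Int_local[OF J K] z by blast
    then obtain s where s: "s \<in> carrier R" "s \<notin> M" "s \<otimes> z \<in> frob e (J \<inter> K)" by (rule M.satE)
    then show False using M(2) unfolding C_def by blast
  qed
  then have "\<one> \<otimes> z \<in> frob e (J \<inter> K)" unfolding C_def by blast
  then show "z \<in> frob e (J \<inter> K)" using zc by simp
qed

end

section \<open>Filtrations\<close>

context cring
begin

lemma ideal_prod_mono:
  assumes "ideal I' R" "ideal J' R" "I \<subseteq> I'" "J \<subseteq> J'" shows "ideal_prod R I J \<subseteq> ideal_prod R I' J'"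
  using ideal_prod_least[OF ideal_prod_is_ideal[OF assms(1,2)]] ideal_prod.prod assms(3,4) by (metis subsetD)

lemma ideal_prod_exchange:
  assumes "ideal A R" "ideal B R" "ideal C R" "ideal D R"
  shows "ideal_prod R (ideal_prod R A B) (ideal_prod R C D) = ideal_prod R (ideal_prod R A C) (ideal_prod R B D)"
proof -
  have "ideal_prod R (ideal_prod R A B) (ideal_prod R C D) = ideal_prod R A (ideal_prod R (ideal_prod R B C) D)"
    using assms by (simp add: ideal_prod_assoc ideal_prod_is_ideal)
  also have "ideal_prod R B C = ideal_prod R C B" using assms by (simp add: ideal_prod_commute)
  also have "ideal_prod R A (ideal_prod R (ideal_prod R C B) D) = ideal_prod R (ideal_prod R A C) (ideal_prod R B D)"
    using assms by (simp add: ideal_prod_assoc ideal_prod_is_ideal)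
  finally show ?thesis .
qed

abbreviation ideal_sum :: "('c \<Rightarrow> 'a set) \<Rightarrow> 'c set \<Rightarrow> 'a set" where
  "ideal_sum f A \<equiv> finsum (ideals_set R) f A"

text \<open>The sum in the semiring of ideals is the least ideal above the summands; later arguments
  use only this description.\<close>

lemma ideal_sum_props:
  assumes "finite A" and f: "\<And>i. ideal (f i) R"
  shows "ideal (ideal_sum f A) R \<and> (\<forall>i\<in>A. f i \<subseteq> ideal_sum f A) \<and>
    (\<forall>L. ideal L R \<longrightarrow> (\<forall>i\<in>A. f i \<subseteq> L) \<longrightarrow> ideal_sum f A \<subseteq> L)"
  using assms(1)
proof (induction rule: finite_induct)
  interpret S: semiring "ideals_set R" by (rule ideals_set_is_semiring)
  case empty
  have "ideal_sum f {} = \<zero>\<^bsub>ideals_set R\<^esub>" by (rule S.finsum_empty)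
  then have "ideal_sum f {} = {\<zero>}" by (simp add: ideals_set_def)
  then show ?case using zeroideal zero_mem_ideal by simp
next
  interpret S: semiring "ideals_set R" by (rule ideals_set_is_semiring)
  case (insert a A)
  have "ideal_sum f (insert a A) = f a \<oplus>\<^bsub>ideals_set R\<^esub> ideal_sum f A"
    using insert.hyps f by (intro S.finsum_insert) (auto simp: ideals_set_def)
  then have e: "ideal_sum f (insert a A) = f a <+> ideal_sum f A" by (simp add: ideals_set_def)
  have i: "ideal (ideal_sum f A) R" using insert.IH by blast
  have "f a <+> ideal_sum f A \<subseteq> L" if "ideal L R" "\<forall>i\<in>insert a A. f i \<subseteq> L" for L
  proof (rule set_add_least[OF that(1)])
    show "f a \<subseteq> L" "ideal_sum f A \<subseteq> L" using that insert.IH by simp_all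
  qed
  moreover have "f i \<subseteq> f a <+> ideal_sum f A" if "i \<in> insert a A" for i
  proof (cases "i = a")
    case False
    then have "f i \<subseteq> ideal_sum f A" using that insert.IH by simp
    then show ?thesis using set_add_lower(2)[OF f[of a] i] by (rule subset_trans)
  qed (use set_add_lower(1)[OF f[of a] i] in simp)
  ultimately show ?case unfolding e using add_ideals[OF f[of a] i] by simp
qed

lemma ideal_ideal_sum:
  assumes "finite A" "\<And>i. ideal (f i) R" shows "ideal (ideal_sum f A) R"
  using ideal_sum_props[of A f, OF assms] by simp

lemma ideal_sum_upper:
  assumes "finite A" "\<And>i. ideal (f i) R" "i \<in> A" shows "f i \<subseteq> ideal_sum f A"
  using ideal_sum_props[of A f, OF assms(1,2)] assms(3) by simp

lemma ideal_sum_least: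
  assumes "finite A" "\<And>i. ideal (f i) R" "ideal L R" "\<And>i. i \<in> A \<Longrightarrow> f i \<subseteq> L"
  shows "ideal_sum f A \<subseteq> L"
  using ideal_sum_props[of A f, OF assms(1,2)] assms(3,4) by simp

end

lemma ideal_filtration_antimono:
  assumes "ideal_filtration R \<aa>" "m \<le> n" shows "\<aa> n \<subseteq> \<aa> m"
proof (rule lift_Suc_antimono_le[OF _ assms(2)])
  show "\<aa> (Suc i) \<subseteq> \<aa> i" for i using assms(1) unfolding ideal_filtration_def by simp
qed

lemma filtration_at_antimono:
  assumes "ideal_filtration R \<aa>" "i \<le> j" shows "filtration_at R \<aa> j \<subseteq> filtration_at R \<aa> i"
proof -
  have "\<aa> (nat j) \<subseteq> \<aa> 0" "\<aa> (nat j) \<subseteq> \<aa> (nat i)"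
    using ideal_filtration_antimono[OF assms(1)] assms(2) by (simp_all add: nat_mono)
  moreover have "\<aa> 0 = carrier R" using assms(1) unfolding ideal_filtration_def by simp
  ultimately show ?thesis using assms(2) unfolding filtration_at_def by simp
qed

context noetherian_prime_char
begin

lemma ideal_filtration_at: "ideal_filtration R \<aa> \<Longrightarrow> ideal (filtration_at R \<aa> i) R"
  unfolding filtration_at_def ideal_filtration_def using oneideal by simp

lemma frob_carrier_eq: "frob e (carrier R) = carrier R"
  using ideal.one_imp_carrier[OF ideal_frob[OF subset_refl]] frob_mem[OF subset_refl one_closed, of e] by simp

text \<open>On generators this is multiplicativity of the Frobenius; colon ideals extend it to the
  second factor and then to the first.\<close>

lemma frob_prod:
  assumes A: "ideal A R" and B: "ideal B R"
  shows "ideal_prod R (frob e A) (frob e B) \<subseteq> frob e (ideal_prod R A B)"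
proof -
  have c: "A \<subseteq> carrier R" "B \<subseteq> carrier R" "ideal_prod R A B \<subseteq> carrier R"
    using ideal_subset_carrier A B ideal_prod_is_ideal[OF A B] by auto
  note iL = ideal_frob[OF c(3), of e] and iA = ideal_frob[OF c(1), of e] and iB = ideal_frob[OF c(2), of e]
  have 1: "g \<otimes> f [^] (p ^ e) \<in> frob e (ideal_prod R A B)" if f: "f \<in> A" and g: "g \<in> frob e B" for f g
  proof -
    have fc: "f \<in> carrier R" "f [^] (p ^ e) \<in> carrier R" using f c by auto
    have "frob e B \<subseteq> {z \<in> carrier R. z \<otimes> f [^] (p ^ e) \<in> frob e (ideal_prod R A B)}"
    proof (rule frob_least[OF ideal_colon[OF iL fc(2)]])
      fix b assume b: "b \<in> B"
      then have bc: "b \<in> carrier R" using c by blast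
      have "(f \<otimes> b) [^] (p ^ e) \<in> frob e (ideal_prod R A B)"
        by (rule frob_mem[OF c(3) ideal_prod.prod[OF f b]])
      then show "b [^] (p ^ e) \<in> {z \<in> carrier R. z \<otimes> f [^] (p ^ e) \<in> frob e (ideal_prod R A B)}"
        using fc bc by (simp add: nat_pow_distrib m_comm)
    qed
    then show ?thesis using g by blast
  qed
  show ?thesis
  proof (rule ideal_prod_least[OF iL])
    fix x y assume x: "x \<in> frob e A" and y: "y \<in> frob e B"
    have yc: "y \<in> carrier R" using ideal.Icarr[OF iB y] .
    have "frob e A \<subseteq> {z \<in> carrier R. z \<otimes> y \<in> frob e (ideal_prod R A B)}"
    proof (rule frob_least[OF ideal_colon[OF iL yc]])
      fix f assume f: "f \<in> A"
      then have "f \<in> carrier R" using c by blast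
      then show "f [^] (p ^ e) \<in> {z \<in> carrier R. z \<otimes> y \<in> frob e (ideal_prod R A B)}"
        using 1[OF f y] yc by (simp add: m_comm)
    qed
    then show "x \<otimes> y \<in> frob e (ideal_prod R A B)" using x by blast
  qed
qed

definition frob_bound :: "(nat \<Rightarrow> 'a set) \<Rightarrow> int \<Rightarrow> int \<Rightarrow> bool" where
  "frob_bound \<aa> h c \<longleftrightarrow>
     (\<forall>m e. filtration_at R \<aa> ((h + int m) * int (p ^ e) + c) \<subseteq> frob e (\<aa> (m + 1)))"

lemma admissible_filtration_iff:
  "admissible_filtration R I p \<aa> \<longleftrightarrow>
     ideal_filtration R \<aa> \<and> (\<exists>k. \<aa> k \<subseteq> I) \<and> (\<exists>h c. h > 0 \<and> frob_bound \<aa> h c)"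
  unfolding admissible_filtration_def frob_bound_def ..

text \<open>Larger constants only raise the index on the left, so two filtrations can share the
  maxima of theirs.\<close>

lemma frob_bound_mono:
  assumes a: "ideal_filtration R \<aa>" "frob_bound \<aa> h c" and le: "h \<le> h'" "c \<le> c'"
  shows "frob_bound \<aa> h' c'"
  unfolding frob_bound_def
proof (intro allI)
  fix m e
  have "(h + int m) * int (p ^ e) \<le> (h' + int m) * int (p ^ e)" using le by (intro mult_right_mono) auto
  then have "(h + int m) * int (p ^ e) + c \<le> (h' + int m) * int (p ^ e) + c'" using le by linarith
  then show "filtration_at R \<aa> ((h' + int m) * int (p ^ e) + c') \<subseteq> frob e (\<aa> (m + 1))"
    using filtration_at_antimono[OF a(1)] a(2) unfolding frob_bound_def by blast
qed

lemma admissible_prod: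
  assumes A: "admissible_filtration R I p \<aa>" and B: "admissible_filtration R I p \<bb>"
  shows "admissible_filtration R I p (\<lambda>n. ideal_prod R (\<aa> n) (\<bb> n))"
proof -
  obtain h1 c1 k where a: "ideal_filtration R \<aa>" "\<aa> k \<subseteq> I" "h1 > 0" "frob_bound \<aa> h1 c1"
    using A unfolding admissible_filtration_iff by blast
  obtain h2 c2 where b: "ideal_filtration R \<bb>" "h2 > 0" "frob_bound \<bb> h2 c2"
    using B unfolding admissible_filtration_iff by blast
  have ia: "ideal (\<aa> n) R" and ib: "ideal (\<bb> n) R" for n using a(1) b(1) unfolding ideal_filtration_def by auto
  have "ideal_filtration R (\<lambda>n. ideal_prod R (\<aa> n) (\<bb> n))"
    unfolding ideal_filtration_def
  proof (intro conjI allI)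
    show "ideal (ideal_prod R (\<aa> i) (\<bb> i)) R" for i using ideal_prod_is_ideal[OF ia ib] .
    show "ideal_prod R (\<aa> 0) (\<bb> 0) = carrier R"
      using a(1) b(1) ideal_prod_one[OF oneideal] unfolding ideal_filtration_def by simp
    show "ideal_prod R (\<aa> (Suc i)) (\<bb> (Suc i)) \<subseteq> ideal_prod R (\<aa> i) (\<bb> i)" for i
      using a(1) b(1) unfolding ideal_filtration_def by (intro ideal_prod_mono) auto
    show "ideal_prod R (ideal_prod R (\<aa> i) (\<bb> i)) (ideal_prod R (\<aa> j) (\<bb> j)) \<subseteq> ideal_prod R (\<aa> (i + j)) (\<bb> (i + j))" for i j
      unfolding ideal_prod_exchange[OF ia ib ia ib]
      using a(1) b(1) unfolding ideal_filtration_def by (intro ideal_prod_mono) auto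
  qed
  moreover have "ideal_prod R (\<aa> k) (\<bb> k) \<subseteq> I" using ideal_prod_inter[OF ia ib] a(2) by blast
  moreover have "frob_bound (\<lambda>n. ideal_prod R (\<aa> n) (\<bb> n)) (max h1 h2) (max c1 c2)"
    unfolding frob_bound_def
  proof (intro allI)
    fix m e
    define N where "N = (max h1 h2 + int m) * int (p ^ e) + max c1 c2"
    have "filtration_at R \<aa> N \<subseteq> frob e (\<aa> (m + 1))" "filtration_at R \<bb> N \<subseteq> frob e (\<bb> (m + 1))"
      using frob_bound_mono[OF a(1,4), of "max h1 h2" "max c1 c2"]
        frob_bound_mono[OF b(1,3), of "max h1 h2" "max c1 c2"] unfolding frob_bound_def N_def by auto
    then have "ideal_prod R (filtration_at R \<aa> N) (filtration_at R \<bb> N) \<subseteq> ideal_prod R (frob e (\<aa> (m + 1))) (frob e (\<bb> (m + 1)))"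
      using ideal_subset_carrier ia ib by (intro ideal_prod_mono ideal_frob) auto
    moreover have "filtration_at R (\<lambda>n. ideal_prod R (\<aa> n) (\<bb> n)) N = ideal_prod R (filtration_at R \<aa> N) (filtration_at R \<bb> N)"
      unfolding filtration_at_def using ideal_prod_one[OF oneideal] by simp
    ultimately show "filtration_at R (\<lambda>n. ideal_prod R (\<aa> n) (\<bb> n)) N \<subseteq> frob e (ideal_prod R (\<aa> (m + 1)) (\<bb> (m + 1)))"
      using frob_prod[OF ia ib] by blast
  qed
  moreover have "max h1 h2 > 0" using a(3) by simp
  ultimately show ?thesis unfolding admissible_filtration_iff by blast
qed

lemma admissible_Int:
  assumes reg: "regular_ring R"
    and A: "admissible_filtration R I p \<aa>" and B: "admissible_filtration R I p \<bb>"
  shows "admissible_filtration R I p (\<lambda>n. \<aa> n \<inter> \<bb> n)"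
proof -
  obtain h1 c1 k where a: "ideal_filtration R \<aa>" "\<aa> k \<subseteq> I" "h1 > 0" "frob_bound \<aa> h1 c1"
    using A unfolding admissible_filtration_iff by blast
  obtain h2 c2 where b: "ideal_filtration R \<bb>" "h2 > 0" "frob_bound \<bb> h2 c2"
    using B unfolding admissible_filtration_iff by blast
  have ia: "ideal (\<aa> n) R" and ib: "ideal (\<bb> n) R" for n using a(1) b(1) unfolding ideal_filtration_def by auto
  have "ideal_filtration R (\<lambda>n. \<aa> n \<inter> \<bb> n)"
    unfolding ideal_filtration_def
  proof (intro conjI allI)
    show "ideal (\<aa> i \<inter> \<bb> i) R" for i using i_intersect[OF ia ib] .
    show "\<aa> 0 \<inter> \<bb> 0 = carrier R" using a(1) b(1) unfolding ideal_filtration_def by simp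
    show "\<aa> (Suc i) \<inter> \<bb> (Suc i) \<subseteq> \<aa> i \<inter> \<bb> i" for i
      using a(1) b(1) unfolding ideal_filtration_def by blast
    show "ideal_prod R (\<aa> i \<inter> \<bb> i) (\<aa> j \<inter> \<bb> j) \<subseteq> \<aa> (i + j) \<inter> \<bb> (i + j)" for i j
    proof -
      have "ideal_prod R (\<aa> i \<inter> \<bb> i) (\<aa> j \<inter> \<bb> j) \<subseteq> ideal_prod R (\<aa> i) (\<aa> j)"
        by (rule ideal_prod_mono[OF ia ia]) auto
      moreover have "ideal_prod R (\<aa> i \<inter> \<bb> i) (\<aa> j \<inter> \<bb> j) \<subseteq> ideal_prod R (\<bb> i) (\<bb> j)"
        by (rule ideal_prod_mono[OF ib ib]) auto
      ultimately show ?thesis using a(1) b(1) unfolding ideal_filtration_def by blast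
    qed
  qed
  moreover have "\<aa> k \<inter> \<bb> k \<subseteq> I" using a(2) by blast
  moreover have "frob_bound (\<lambda>n. \<aa> n \<inter> \<bb> n) (max h1 h2) (max c1 c2)"
    unfolding frob_bound_def
  proof (intro allI)
    fix m e
    define N where "N = (max h1 h2 + int m) * int (p ^ e) + max c1 c2"
    have "filtration_at R \<aa> N \<subseteq> frob e (\<aa> (m + 1))" "filtration_at R \<bb> N \<subseteq> frob e (\<bb> (m + 1))"
      using frob_bound_mono[OF a(1,4), of "max h1 h2" "max c1 c2"]
        frob_bound_mono[OF b(1,3), of "max h1 h2" "max c1 c2"] unfolding frob_bound_def N_def by auto
    moreover have "filtration_at R (\<lambda>n. \<aa> n \<inter> \<bb> n) N = filtration_at R \<aa> N \<inter> filtration_at R \<bb> N"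
      unfolding filtration_at_def by simp
    ultimately show "filtration_at R (\<lambda>n. \<aa> n \<inter> \<bb> n) N \<subseteq> frob e (\<aa> (m + 1) \<inter> \<bb> (m + 1))"
      using frob_Int[OF reg ia ib] by blast
  qed
  moreover have "max h1 h2 > 0" using a(3) by simp
  ultimately show ?thesis unfolding admissible_filtration_iff by blast
qed

text \<open>Condition (ii) read backwards: an arbitrary index \<open>i\<close> is assigned the level
  \<open>j\<close> that it reaches. The least \<open>j\<close> whose threshold exceeds
  \<open>i\<close> works, because the threshold of its predecessor does not; \<open>j = 0\<close>
  costs nothing, as \<open>\<aa> 0\<close> is the whole ring.\<close>

lemma frob_level:
  assumes a: "ideal_filtration R \<aa>" "frob_bound \<aa> h c"
  shows "\<exists>j. i < (h + int j) * int (p ^ e) + c \<and> filtration_at R \<aa> i \<subseteq> frob e (\<aa> j)"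
proof -
  let ?Q = "\<lambda>j. i < (h + int j) * int (p ^ e) + c"
  define j where "j = (LEAST j. ?Q j)"
  \<comment> \<open>As \<open>p ^ e \<ge> 1\<close>, any \<open>j\<close> exceeding
    \<open>i - c - h * p ^ e\<close> is large enough, so a least one exists.\<close>
  have "?Q (nat (i - c - h * int (p ^ e)) + 1)"
  proof -
    define k where "k = nat (i - c - h * int (p ^ e)) + 1"
    have "int k * 1 \<le> int k * int (p ^ e)" using frob_pos[of e] by (intro mult_left_mono) linarith+
    then have "h * int (p ^ e) + int k \<le> (h + int k) * int (p ^ e)" by (simp add: distrib_right)
    moreover have "int k > i - c - h * int (p ^ e)" unfolding k_def by linarith
    ultimately have "?Q k" by linarith
    then show ?thesis unfolding k_def .
  qed
  then have j: "?Q j" unfolding j_def by (rule LeastI)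
  have "filtration_at R \<aa> i \<subseteq> frob e (\<aa> j)"
  proof (cases j)
    case 0
    have "\<aa> 0 = carrier R" using a(1) unfolding ideal_filtration_def by blast
    then have "frob e (\<aa> j) = carrier R" using 0 frob_carrier_eq by simp
    then show ?thesis using ideal_subset_carrier[OF ideal_filtration_at[OF a(1)]] by simp
  next
    case (Suc m)
    then have "\<not> ?Q m" using not_less_Least[of m ?Q] unfolding j_def by simp
    then have "filtration_at R \<aa> i \<subseteq> filtration_at R \<aa> ((h + int m) * int (p ^ e) + c)"
      using filtration_at_antimono[OF a(1)] by simp
    also have "\<dots> \<subseteq> frob e (\<aa> (m + 1))" using a(2) unfolding frob_bound_def by blast
    finally show ?thesis using Suc by simp
  qed
  then show ?thesis using j by blast
qed

text \<open>For two indices with sum \<open>N\<close>, adding the strict bounds for the levels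
  \<open>j\<close> and \<open>l\<close> gives
  \<open>N < (h1 + h2 + j + l) * p ^ e + c1 + c2\<close>, so the choice of \<open>N\<close> forces
  \<open>m < j + l\<close>. This is why the constants add up.\<close>

lemma admissible_sum:
  assumes A: "admissible_filtration R I p \<aa>" and B: "admissible_filtration R I p \<bb>" and I: "ideal I R"
  shows "admissible_filtration R I p (\<lambda>n. \<Oplus>\<^bsub>ideals_set R\<^esub> i \<in> {..n}. ideal_prod R (\<aa> i) (\<bb> (n - i)))"
proof -
  obtain h1 c1 k1 where a: "ideal_filtration R \<aa>" "\<aa> k1 \<subseteq> I" "h1 > 0" "frob_bound \<aa> h1 c1"
    using A unfolding admissible_filtration_iff by blast
  obtain h2 c2 k2 where b: "ideal_filtration R \<bb>" "\<bb> k2 \<subseteq> I" "h2 > 0" "frob_bound \<bb> h2 c2"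
    using B unfolding admissible_filtration_iff by blast
  have ia: "ideal (\<aa> n) R" and ib: "ideal (\<bb> n) R" for n using a(1) b(1) unfolding ideal_filtration_def by auto
  have a0: "\<aa> 0 = carrier R" and b0: "\<bb> 0 = carrier R" using a(1) b(1) unfolding ideal_filtration_def by auto
  have iab: "ideal (ideal_prod R (\<aa> i) (\<bb> j)) R" for i j using ideal_prod_is_ideal[OF ia ib] .
  define E where "E n = ideal_sum (\<lambda>i. ideal_prod R (\<aa> i) (\<bb> (n - i))) {..n}" for n
  have iE: "ideal (E n) R" for n unfolding E_def by (rule ideal_ideal_sum[OF finite_atMost iab])
  have E_upper: "ideal_prod R (\<aa> i) (\<bb> j) \<subseteq> E (i + j)" for i j
    using ideal_sum_upper[of "{..i + j}" "\<lambda>k. ideal_prod R (\<aa> k) (\<bb> (i + j - k))" i] iab unfolding E_def by simp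
  have E_least: "E n \<subseteq> L" if "ideal L R" "\<And>i. i \<le> n \<Longrightarrow> ideal_prod R (\<aa> i) (\<bb> (n - i)) \<subseteq> L" for n L
    unfolding E_def by (rule ideal_sum_least[OF finite_atMost iab that(1)]) (use that(2) in simp)
  have E0: "E 0 = carrier R"
  proof -
    have "ideal_prod R (\<aa> 0) (\<bb> 0) \<subseteq> E 0" using E_upper[of 0 0] by simp
    then show ?thesis using ideal_prod_one[OF oneideal] ideal_subset_carrier[OF iE[of 0]] a0 b0 by auto
  qed
  have ESuc: "E (Suc n) \<subseteq> E n" for n
  proof (rule E_least[OF iE])
    fix i assume i: "i \<le> Suc n"
    show "ideal_prod R (\<aa> i) (\<bb> (Suc n - i)) \<subseteq> E n"
    proof (cases "i \<le> n")
      case True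
      have "ideal_prod R (\<aa> i) (\<bb> (Suc n - i)) \<subseteq> ideal_prod R (\<aa> i) (\<bb> (n - i))"
        using ideal_filtration_antimono[OF b(1), of "n - i" "Suc n - i"] by (intro ideal_prod_mono ia ib) auto
      then show ?thesis using E_upper[of i "n - i"] True by simp
    next
      case False
      then have "i = Suc n" using i by simp
      then have "ideal_prod R (\<aa> i) (\<bb> (Suc n - i)) \<subseteq> ideal_prod R (\<aa> n) (\<bb> 0)"
        using ideal_filtration_antimono[OF a(1), of n "Suc n"] by (intro ideal_prod_mono ia ib) auto
      then show ?thesis using E_upper[of n 0] by simp
    qed
  qed
  have EE: "ideal_prod R (E i) (E j) \<subseteq> E (i + j)" for i j
  proof (rule ideal_prod_least[OF iE])
    fix x y assume x: "x \<in> E i" and y: "y \<in> E j"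
    have yc: "y \<in> carrier R" using ideal.Icarr[OF iE y] .
    \<comment> \<open>Products of sums are reduced to products of summands by two colon ideals, one
      for each factor.\<close>
    have "E i \<subseteq> {z \<in> carrier R. z \<otimes> y \<in> E (i + j)}"
    proof (rule E_least[OF ideal_colon[OF iE yc]], rule subsetI)
      fix k u assume k: "k \<le> i" and u: "u \<in> ideal_prod R (\<aa> k) (\<bb> (i - k))"
      have uc: "u \<in> carrier R" using ideal.Icarr[OF iab u] .
      have "E j \<subseteq> {z \<in> carrier R. z \<otimes> u \<in> E (i + j)}"
      proof (rule E_least[OF ideal_colon[OF iE uc]], rule subsetI)
        fix l v assume l: "l \<le> j" and v: "v \<in> ideal_prod R (\<aa> l) (\<bb> (j - l))"
        have vc: "v \<in> carrier R" using ideal.Icarr[OF iab v] .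
        have "v \<otimes> u \<in> ideal_prod R (ideal_prod R (\<aa> l) (\<bb> (j - l))) (ideal_prod R (\<aa> k) (\<bb> (i - k)))"
          using v u by (rule ideal_prod.prod)
        also have "\<dots> = ideal_prod R (ideal_prod R (\<aa> l) (\<aa> k)) (ideal_prod R (\<bb> (j - l)) (\<bb> (i - k)))"
          by (rule ideal_prod_exchange[OF ia ib ia ib])
        also have "\<dots> \<subseteq> ideal_prod R (\<aa> (l + k)) (\<bb> (j - l + (i - k)))"
          using a(1) b(1) unfolding ideal_filtration_def by (intro ideal_prod_mono) auto
        also have "\<dots> \<subseteq> E (i + j)" using E_upper[of "l + k" "j - l + (i - k)"] k l by (simp add: add.commute)
        finally show "v \<in> {z \<in> carrier R. z \<otimes> u \<in> E (i + j)}" using vc by simp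
      qed
      then have "y \<otimes> u \<in> E (i + j)" using y by blast
      then show "u \<in> {z \<in> carrier R. z \<otimes> y \<in> E (i + j)}" using uc yc by (simp add: m_comm)
    qed
    then show "x \<otimes> y \<in> E (i + j)" using x by blast
  qed
  have fE: "ideal_filtration R E" unfolding ideal_filtration_def using iE E0 ESuc EE by blast
  have "E (k1 + k2) \<subseteq> I"
  proof (rule E_least[OF I])
    fix i assume i: "i \<le> k1 + k2"
    have "\<aa> i \<subseteq> I \<or> \<bb> (k1 + k2 - i) \<subseteq> I"
    proof (cases "k1 \<le> i")
      case True
      then show ?thesis using ideal_filtration_antimono[OF a(1)] a(2) by blast
    next
      case False
      then have "k2 \<le> k1 + k2 - i" by simp
      then show ?thesis using ideal_filtration_antimono[OF b(1)] b(2) by blast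
    qed
    then show "ideal_prod R (\<aa> i) (\<bb> (k1 + k2 - i)) \<subseteq> I"
      using ideal_prod_inter[OF ia[of i] ib[of "k1 + k2 - i"]] by blast
  qed
  moreover have "frob_bound E (h1 + h2) (c1 + c2)"
    unfolding frob_bound_def
  proof (intro allI)
    fix m e
    define N where "N = (h1 + h2 + int m) * int (p ^ e) + (c1 + c2)"
    have Ec: "E n \<subseteq> carrier R" for n using ideal_subset_carrier[OF iE] .
    have *: "ideal_prod R (filtration_at R \<aa> i) (filtration_at R \<bb> (N - i)) \<subseteq> frob e (E (m + 1))" for i
    proof -
      obtain j where j: "i < (h1 + int j) * int (p ^ e) + c1" "filtration_at R \<aa> i \<subseteq> frob e (\<aa> j)"
        using frob_level[OF a(1,4)] by blast
      obtain l where l: "N - i < (h2 + int l) * int (p ^ e) + c2" "filtration_at R \<bb> (N - i) \<subseteq> frob e (\<bb> l)"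
        using frob_level[OF b(1,4)] by blast
      have "int m * int (p ^ e) < (int j + int l) * int (p ^ e)"
        using j(1) l(1) unfolding N_def by (simp add: algebra_simps)
      then have "int m < int j + int l" using mult_less_cancel_right_pos frob_pos[of e] by (metis of_nat_0_less_iff)
      then have m: "m + 1 \<le> j + l" by linarith
      have "ideal_prod R (filtration_at R \<aa> i) (filtration_at R \<bb> (N - i)) \<subseteq> ideal_prod R (frob e (\<aa> j)) (frob e (\<bb> l))"
        using j(2) l(2) ideal_subset_carrier ia ib by (intro ideal_prod_mono ideal_frob) auto
      also have "\<dots> \<subseteq> frob e (ideal_prod R (\<aa> j) (\<bb> l))" by (rule frob_prod[OF ia ib])
      also have "\<dots> \<subseteq> frob e (E (m + 1))"
        using E_upper[of j l] ideal_filtration_antimono[OF fE m] by (intro frob_mono[OF Ec]) blast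
      finally show ?thesis .
    qed
    have "filtration_at R E N \<subseteq> frob e (E (m + 1))"
    proof (cases "N < 0")
      case True
      \<comment> \<open>For negative \<open>N\<close> the indices \<open>-1\<close> and
        \<open>N + 1\<close> are both at most \<open>0\<close>, so the product is the whole
        ring.\<close>
      have "filtration_at R \<aa> (-1) = carrier R" "filtration_at R \<bb> (N - (-1)) = carrier R"
        using True b0 unfolding filtration_at_def by auto
      then have "carrier R \<subseteq> frob e (E (m + 1))" using *[of "-1"] ideal_prod_one[OF oneideal] by simp
      then show ?thesis using True unfolding filtration_at_def by simp
    next
      case False
      have "E (nat N) \<subseteq> frob e (E (m + 1))"
      proof (rule E_least[OF ideal_frob[OF Ec]])
        fix i assume "i \<le> nat N"
        then have "filtration_at R \<aa> (int i) = \<aa> i" "filtration_at R \<bb> (N - int i) = \<bb> (nat N - i)"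
          using False unfolding filtration_at_def by (auto simp: nat_diff_distrib')
        then show "ideal_prod R (\<aa> i) (\<bb> (nat N - i)) \<subseteq> frob e (E (m + 1))" using *[of "int i"] by simp
      qed
      then show ?thesis using False unfolding filtration_at_def by simp
    qed
    then show "filtration_at R E ((h1 + h2 + int m) * int (p ^ e) + (c1 + c2)) \<subseteq> frob e (E (m + 1))"
      unfolding N_def .
  qed
  moreover have "h1 + h2 > 0" using a(3) b(3) by simp
  ultimately have "admissible_filtration R I p E" unfolding admissible_filtration_iff using fE by blast
  then show ?thesis unfolding E_def .
qed

end

theorem proposition4p3:
  fixes R :: "('a, 'b) ring_scheme" (structure)
    and p :: nat
    and I :: "'a set"
    and \<aa> \<bb> :: "nat \<Rightarrow> 'a set"
  assumes "cring R"
    and "noetherian_ring R"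
    and "Factorial_Ring.prime p"
    and "has_characteristic R p"
    and "ideal I R"
    and "I \<noteq> {\<zero>}"
    and "I \<noteq> carrier R"
    and "admissible_filtration R I p \<aa>"
    and "admissible_filtration R I p \<bb>"
  shows "admissible_filtration R I p (\<lambda>n. ideal_prod R (\<aa> n) (\<bb> n)) \<and>
    (regular_ring R \<longrightarrow> admissible_filtration R I p (\<lambda>n. \<aa> n \<inter> \<bb> n)) \<and>
    admissible_filtration R I p
      (\<lambda>n. \<Oplus>\<^bsub>ideals_set R\<^esub> i \<in> {..n}. ideal_prod R (\<aa> i) (\<bb> (n - i)))"
proof -
  interpret noetherian_prime_char R p
    using assms(1-4) by (simp add: noetherian_prime_char_def noetherian_cring_def prime_char_cring_def
        prime_char_cring_axioms_def)
  show ?thesis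
    using admissible_prod[OF assms(8,9)] admissible_Int[OF _ assms(8,9)] admissible_sum[OF assms(8,9,5)]
    by blast
qed

end
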